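(* In the setting and with the notation of the context, let $L_0=\mathbf 0$, let $\mu>-1/\tilde n$, and let the pair $(A,C)$ be observable. Let $\rho>0$, $P_a\in\mathbb R^{n\times n}$ and $Y\in\mathbb R^{n\times p}$ solve the system of linear matrix inequalities $$P_a\succ 0,\quad (\Delta^\top+\Delta)\otimes P_a\succ 0,\quad P_aG_{\mathbf d}+G_{\mathbf d}^\top P_a\succ 0,$$ $$P_aA+A^\top P_a+YC+C^\top Y^\top+\rho\,(P_aG_{\mathbf d}+G_{\mathbf d}^\top P_a)\prec 0 .$$ Put $\bar H=P_a^{-1}Y=(\bar H_1,\dots,\bar H_N)$ with $\bar H_i\in\mathbb R^{n\times p_i}$, let $H_i=\bar H_i/\zeta_i$, $i=1,\dots,N$, and let $\nu>0$ be large enough. Let the canonical homogeneous norm $\|\cdot\|_{\mathbf d}$ be induced by $\|x\|_{P_a}=\sqrt{x^\top P_a x}$. Let the nonlinear distributed observer $$\dot{\hat x}_i=A\hat x_i+Bu+\gamma(t,\hat x_i)+g(|\omega_i|)H_i\omega_i+\nu\|\theta_i\|_{\mathbf d}^{\mu}\theta_i,\qquad i=1,\dots,N,$$ operate under a strongly connected graph $\mathcal G$. Let $\mu\neq0$ be close enough to zero and let $\gamma$ satisfy $$\big\|\tilde{\mathbf d}(-\ln\|\hat x-\tilde x\|_{\tilde{\mathbf d}})\,(\hat\gamma(t,\hat x)-\tilde\gamma(t,x))\big\|_P\le \tau\,\|\hat x-\tilde x\|_{\tilde{\mathbf d}}^{\mu}\qquad \forall t>0,\ \forall \hat x_i,x\in\mathbb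 R^n\ (\hat x\ne\tilde x),$$ with $0<\tau<\rho/3$. Then the error equation $$\dot e=\big(\tilde A+\mathrm{diag}\{g(|\omega_i|)\}_{i=1}^N\tilde H\tilde C-\nu\,\mathrm{diag}\{\|\theta_i\|_{\mathbf d}^{\mu}I_n\}_{i=1}^N(\mathcal L\otimes I_n)\big)e+\Gamma(t,\hat x,x)-\mathrm{diag}\{g(|\omega_i|)\}_{i=1}^N\tilde Hq_y-\mathbf 1_N\otimes q_x$$ is input-to-state stable with respect to the bounded perturbation $q=(q_x^\top,q_y^\top)^\top\in L^\infty(\mathbb R,\mathbb R^{n+p})$.
   Context: **Plant and sensors.** $\dot x=Ax+Bu+\gamma(t,x)+q_x$, $t>0$, with $x\in\mathbb R^n$, $u\in\mathbb R^m$, $A\in\mathbb R^{n\times n}$, $B\in\mathbb R^{n\times m}$, $\gamma\in C(\mathbb R\times\mathbb R^n,\mathbb R^n)$, $q_x\in L^\infty(\mathbb R,\mathbb R^n)$. Local outputs: $y_i=C_ix+q_{y,i}$, $i=1,\dots,N$, with $C_i\in\mathbb R^{p_i\times n}$, $q_{y,i}\in L^\infty(\mathbb R,\mathbb R^{p_i})$. Let $C=(C_1^\top,\dots,C_N^\top)^\top\in\mathbb R^{p\times n}$, $p=\sum_i p_i$, $q_y=(q_{y,1}^\top,\dots,q_{y,N}^\top)^\top$. $|\cdot|$ is the Euclidean norm; $M\succ0$ ($\prec0$) means symmetric positive (negative) definite; $\otimes$ is the Kronecker product; $\mathbf 1_N\in\mathbb R^N$ is the all-ones vector. **Graph.** $\mathcal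 G$ is a directed graph on nodes $\{1,\dots,N\}$ without self-loops; $(i,j)$ is an edge if $j$ can send information to $i$; $a_{ij}=1$ if $(i,j)$ is an edge and $0$ otherwise. $\mathcal L=\{l_{ij}\}$ with $l_{ij}=-a_{ij}$ for $i\ne j$, $l_{ii}=\sum_k a_{ik}$ is the Laplacian, $\mathcal L_i$ its $i$-th row. When $\mathcal G$ is strongly connected, $\zeta=(\zeta_1,\dots,\zeta_N)^\top$ is the left $0$-eigenvector of $\mathcal L$ with $\zeta^\top\mathbf 1_N=1$ (all $\zeta_i>0$), and $\Delta$ is an $(N-1)\times(N-1)$ matrix, whose eigenvalues are the nonzero eigenvalues of $\mathcal L$, such that $T^{-1}\mathcal LT=\begin{pmatrix}0&0\\0&\Delta\end{pmatrix}$ with $T=(\mathbf 1_N,Y_1)$, $T^{-1}=(\zeta,Y_2)^\top$, $T\in\mathbb R^{N\times N}$. **The matrices $G_0$, $L_0$.** For observable $(A,C)$, $(Y_0,G_0)\in\mathbb R^{n\times p}\times\mathbb R^{n\times n}$ is a solution of $G_0A-AG_0+Y_0C=-A$, $CG_0=\mathbf 0$, such that $I_n+G_0$ is invertible and $A_0=A+L_0C$ is nilpotent, where $L_0=(I_n+G_0)^{-1}Y_0$. Let $\tilde n$ be the least $k$ such that the matrix with blocks $C,CA,\dots,CA^{k-1}$ has full rank $n$. **Dilations and homogeneous norms.** $G_{\mathbf d}=\mu G_0+I_n$, $\mathbf d(s)=\exp(sG_{\mathbf d})$, $s\in\mathbb R$. For a linear dilation $\mathbf d(s)=\exp(sG)$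 (with all eigenvalues of $G$ having positive real part) that is monotone for a norm $\|\cdot\|$ (i.e. $s\mapsto\|\mathbf d(s)x\|$ is strictly increasing for every $x\ne\mathbf 0$), the canonical homogeneous norm induced by $\|\cdot\|$ is $\|\mathbf 0\|_{\mathbf d}=0$ and $\|x\|_{\mathbf d}=e^{s_x}$ where $\|\mathbf d(-s_x)x\|=1$, for $x\neq\mathbf 0$. Further, $P=I_N\otimes P_a$, $\|e\|_P=\sqrt{e^\top Pe}$, $\tilde{\mathbf d}=I_N\otimes\mathbf d$ (generated by $G_{\tilde{\mathbf d}}=I_N\otimes G_{\mathbf d}$), and $\|\cdot\|_{\tilde{\mathbf d}}$ is the canonical homogeneous norm on $\mathbb R^{Nn}$ induced by $\|\cdot\|_P$. **Observer notation.** $\hat x_i\in\mathbb R^n$ is the state of observer $i$; $e_i=\hat x_i-x$, $e=(e_1^\top,\dots,e_N^\top)^\top$, $\hat x=(\hat x_1^\top,\dots,\hat x_N^\top)^\top$, $\tilde x=\mathbf 1_N\otimes x$. $\omega_i=C_i\hat x_i-y_i=C_ie_i-q_{y,i}$; $\theta_i=\sum_j a_{ij}(\hat x_j-\hat x_i)=-(\mathcal L_i\otimes I_n)e$; $g(|\omega_i|)=\exp(\mu(G_0+I_n)\ln|\omega_i|)$. The terms $g(|\omega_i|)H_i\omega_i$ and $\|\theta_i\|_{\mathbf d}^\mu\theta_i$ are set to $\mathbf 0$ (by continuity) at $\omega_i=\mathbf 0$, $\theta_i=\mathbf 0$. $\tilde A=I_N\otimes A$, $\tilde H=\mathrm{diag}\{H_i\}_{i=1}^N$,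 $\tilde C=\mathrm{diag}\{C_i\}_{i=1}^N$. $\hat\gamma(t,\hat x)=(\gamma^\top(t,\hat x_1),\dots,\gamma^\top(t,\hat x_N))^\top$, $\tilde\gamma(t,x)=\mathbf 1_N\otimes\gamma(t,x)$, $\Gamma(t,\hat x,x)=\hat\gamma(t,\hat x)-\tilde\gamma(t,x)$. **Input-to-state stability (ISS).** A system with state $e$ and input $q$ is ISS if there exist $\beta\in\mathcal{KL}$ and $\alpha\in\mathcal K$ such that $\|e(t)\|\le\beta(\|e(0)\|,t)+\alpha(\|q\|_{L^\infty[0,t)})$ for every initial state $e(0)$ and every $q\in L^\infty$. Here $\|q\|_{L^\infty}=\mathrm{ess\,sup}_t\|q(t)\|_\infty$. *)

theory Defs
  imports "HOL-Analysis.Analysis" "HOL-Probability.Essential_Supremum"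
begin

section \<open>Matrices\<close>

definition matpow :: "real^'a^'a \<Rightarrow> nat \<Rightarrow> real^'a^'a" where
  "matpow M k = (((**) M) ^^ k) (mat 1)"

text \<open>
  The library function \<^const>\<open>exp\<close> needs a normed algebra, and the product \<open>*\<close> of the library's
  vector type is componentwise; the series is therefore written out for the matrix product.
\<close>

definition mexp :: "real^'a^'a \<Rightarrow> real^'a^'a" where
  "mexp M = (\<Sum>k. matpow M k /\<^sub>R fact k)"

definition nilpotent_matrix :: "real^'a^'a \<Rightarrow> bool" where
  "nilpotent_matrix M \<longleftrightarrow> (\<exists>k. matpow M k = 0)"

definition pos_def :: "real^'a^'a \<Rightarrow> bool" where
  "pos_def M \<longleftrightarrow> transpose M = M \<and> (\<forall>x. x \<noteq> 0 \<longrightarrow> x \<bullet> (M *v x) > 0)"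

definition neg_def :: "real^'a^'a \<Rightarrow> bool" where
  "neg_def M \<longleftrightarrow> transpose M = M \<and> (\<forall>x. x \<noteq> 0 \<longrightarrow> x \<bullet> (M *v x) < 0)"

definition eigenvalues :: "real^'a^'a \<Rightarrow> complex set" where
  "eigenvalues M = {z. \<exists>v. v \<noteq> 0 \<and> map_matrix complex_of_real M *v v = z *s v}"

definition kron :: "real^'b^'a \<Rightarrow> real^'d^'c \<Rightarrow> real^('b \<times> 'd)^('a \<times> 'c)" where
  "kron M K = (\<chi> r c. M $ fst r $ fst c * K $ snd r $ snd c)"

definition kronv :: "real^'a \<Rightarrow> real^'b \<Rightarrow> real^('a \<times> 'b)" where
  "kronv v w = (\<chi> r. v $ fst r * w $ snd r)"

definition block_diag :: "('N::finite \<Rightarrow> real^'b^'a) \<Rightarrow> real^('N \<times> 'b)^('N \<times> 'a)" where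
  "block_diag M = (\<chi> r c. if fst r = fst c then M (fst r) $ snd r $ snd c else 0)"

definition wnorm :: "real^'a^'a \<Rightarrow> real^'a \<Rightarrow> real" where
  "wnorm P x = sqrt (x \<bullet> (P *v x))"

text \<open>A vector of \<open>\<real>\<^bsup>Nn\<^esup>\<close> is indexed by pairs (node, coordinate).\<close>

definition stack :: "('N::finite \<Rightarrow> real^'n) \<Rightarrow> real^('N \<times> 'n)" where
  "stack f = (\<chi> r. f (fst r) $ snd r)"

definition agent :: "real^('N::finite \<times> 'n) \<Rightarrow> 'N \<Rightarrow> real^'n" where
  "agent z i = (\<chi> j. z $ (i, j))"

section \<open>Observability\<close>

text \<open>The row rank of the matrix with blocks \<open>C, C A, \<dots>, C A\<^bsup>k-1\<^esup>\<close>.\<close>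

definition obs_rank :: "real^'n^'n \<Rightarrow> real^'n^'p \<Rightarrow> nat \<Rightarrow> nat" where
  "obs_rank A C k = dim (\<Union>i<k. rows (C ** matpow A i))"

definition observable :: "real^'n^'n \<Rightarrow> real^'n^'p \<Rightarrow> bool" where
  "observable A C \<longleftrightarrow> obs_rank A C CARD('n) = CARD('n)"

definition obs_index :: "real^'n^'n \<Rightarrow> real^'n^'p \<Rightarrow> nat" where
  "obs_index A C = (LEAST k. obs_rank A C k = CARD('n))"

section \<open>Graphs\<close>

text \<open>\<open>(i, j) \<in> E\<close> means that node \<open>j\<close> can send information to node \<open>i\<close>.\<close>

definition adj :: "('N::finite \<times> 'N) set \<Rightarrow> 'N \<Rightarrow> 'N \<Rightarrow> real" where
  "adj E i j = (if (i, j) \<in> E then 1 else 0)"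

definition laplacian :: "('N::finite \<times> 'N) set \<Rightarrow> real^'N^'N" where
  "laplacian E = (\<chi> i j. if i = j then (\<Sum>k\<in>UNIV. adj E i k) else - adj E i j)"

definition strongly_connected :: "('N::finite \<times> 'N) set \<Rightarrow> bool" where
  "strongly_connected E \<longleftrightarrow> (\<forall>i j. (i, j) \<in> E\<^sup>*)"

definition left_null_vector :: "('N::finite \<times> 'N) set \<Rightarrow> real^'N \<Rightarrow> bool" where
  "left_null_vector E \<zeta> \<longleftrightarrow> \<zeta> v* laplacian E = 0 \<and> \<zeta> \<bullet> 1 = 1"

text \<open>
  The columns of \<open>T\<close> are indexed by \<open>'l option\<close>, with \<open>None\<close> as the distinguished first
  index. Invertibility of \<open>T\<close> forces \<open>N = CARD('l) + 1\<close>, so \<open>\<Delta>\<close> has size \<open>N - 1\<close>.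
  The constant \<open>1\<close> of a vector type is the all-ones vector.
\<close>

definition laplacian_splitting ::
    "('N::finite \<times> 'N) set \<Rightarrow> real^'N \<Rightarrow> real^('l::finite option)^'N \<Rightarrow> real^'l^'l \<Rightarrow> bool" where
  "laplacian_splitting E \<zeta> T \<Delta> \<longleftrightarrow>
     invertible T \<and> column None T = 1 \<and> row None (matrix_inv T) = \<zeta> \<and>
     matrix_inv T ** laplacian E ** T =
       (\<chi> a b. case a of None \<Rightarrow> 0 | Some i \<Rightarrow> (case b of None \<Rightarrow> 0 | Some j \<Rightarrow> \<Delta> $ i $ j)) \<and>
     eigenvalues \<Delta> = eigenvalues (laplacian E) - {0}"

section \<open>Dilations and canonical homogeneous norms\<close>

definition dilation :: "real^'a^'a \<Rightarrow> real \<Rightarrow> real^'a^'a" where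
  "dilation G s = mexp (s *\<^sub>R G)"

text \<open>
  The description is well defined when \<open>d\<close> is a monotone dilation for the norm \<open>nrm\<close>; for
  \<open>nrm = wnorm P\<close> and generator \<open>G\<close> this follows from \<open>P G + G\<^sup>T P\<close> being positive definite.
\<close>

definition hom_norm :: "(real \<Rightarrow> real^'a^'a) \<Rightarrow> (real^'a \<Rightarrow> real) \<Rightarrow> real^'a \<Rightarrow> real" where
  "hom_norm d nrm x = (if x = 0 then 0 else exp (THE s. nrm (d (- s) *v x) = 1))"

definition dil_gen :: "real \<Rightarrow> real^'n^'n \<Rightarrow> real^'n^'n" where
  "dil_gen \<mu> G0 = \<mu> *\<^sub>R G0 + mat 1"

definition agent_hnorm :: "real \<Rightarrow> real^'n^'n \<Rightarrow> real^'n^'n \<Rightarrow> real^'n \<Rightarrow> real" where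
  "agent_hnorm \<mu> G0 Pa = hom_norm (dilation (dil_gen \<mu> G0)) (wnorm Pa)"

definition stacked_dilation :: "real \<Rightarrow> real^'n^'n \<Rightarrow> real \<Rightarrow> real^('N::finite \<times> 'n)^('N \<times> 'n)" where
  "stacked_dilation \<mu> G0 s = kron (mat 1) (dilation (dil_gen \<mu> G0) s)"

definition stacked_wnorm :: "real^'n^'n \<Rightarrow> real^('N::finite \<times> 'n) \<Rightarrow> real" where
  "stacked_wnorm Pa = wnorm (kron (mat 1) Pa)"

definition stacked_hnorm :: "real \<Rightarrow> real^'n^'n \<Rightarrow> real^'n^'n \<Rightarrow> real^('N::finite \<times> 'n) \<Rightarrow> real" where
  "stacked_hnorm \<mu> G0 Pa = hom_norm (stacked_dilation \<mu> G0) (stacked_wnorm Pa)"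

section \<open>Plant, observer and error equation\<close>

text \<open>
  The output partition is given by a map \<open>own\<close> from the \<open>p\<close> output coordinates to the
  nodes: \<open>p\<^sub>i\<close> is the number of \<open>r\<close> with \<open>own r = i\<close>, and \<open>\<real>\<^bsup>p\<^sub>i\<^esup>\<close> is identified, isometrically, with the
  vectors of \<open>\<real>\<^bsup>p\<^esup>\<close> supported on that block. Likewise \<open>H\<^sub>i\<close> is padded with zero columns.
\<close>

definition out_block :: "('p \<Rightarrow> 'N::finite) \<Rightarrow> 'N \<Rightarrow> real^'p \<Rightarrow> real^'p" where
  "out_block own i y = (\<chi> r. if own r = i then y $ r else 0)"

definition H_gain :: "('p \<Rightarrow> 'N::finite) \<Rightarrow> real^'N \<Rightarrow> real^'p^'n \<Rightarrow> 'N \<Rightarrow> real^'p^'n" where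
  "H_gain own \<zeta> Hbar i = (\<chi> j r. if own r = i then Hbar $ j $ r / \<zeta> $ i else 0)"

definition C_tilde :: "('p \<Rightarrow> 'N::finite) \<Rightarrow> real^'n^'p \<Rightarrow> real^('N \<times> 'n)^'p" where
  "C_tilde own C = (\<chi> r c. if own r = fst c then C $ r $ snd c else 0)"

definition H_tilde :: "('N::finite \<Rightarrow> real^'p^'n) \<Rightarrow> real^'p^('N \<times> 'n)" where
  "H_tilde H = (\<chi> c r. H (fst c) $ snd c $ r)"

text \<open>
  The observer and the error equation contain \<open>g(|\<omega>|) H \<omega>\<close> and \<open>\<parallel>\<theta>\<parallel>\<^bsup>\<mu>\<^esup> \<theta>\<close>. Since \<open>ln 0 = 0\<close> and
  \<open>0 powr \<mu> = 0\<close> in the library, both products are \<open>0\<close> at \<open>\<omega> = 0\<close> and \<open>\<theta> = 0\<close>, as intended.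
\<close>

definition g_fun :: "real \<Rightarrow> real^'n^'n \<Rightarrow> real \<Rightarrow> real^'n^'n" where
  "g_fun \<mu> G0 r = mexp ((\<mu> * ln r) *\<^sub>R (G0 + mat 1))"

definition theta :: "('N::finite \<times> 'N) set \<Rightarrow> real^('N \<times> 'n) \<Rightarrow> 'N \<Rightarrow> real^'n" where
  "theta E z i = (\<Sum>j\<in>UNIV. adj E i j *\<^sub>R (agent z j - agent z i))"

definition plant_rhs ::
    "real^'n^'n \<Rightarrow> real^'m^'n \<Rightarrow> (real \<Rightarrow> real^'n \<Rightarrow> real^'n) \<Rightarrow>
     (real \<Rightarrow> real^'m) \<Rightarrow> (real \<Rightarrow> real^'n) \<Rightarrow> real \<Rightarrow> real^'n \<Rightarrow> real^'n" where
  "plant_rhs A B \<gamma> u qx t x = A *v x + B *v u t + \<gamma> t x + qx t"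

definition observer_rhs ::
    "real^'n^'n \<Rightarrow> real^'m^'n \<Rightarrow> real^'n^'p \<Rightarrow> ('p \<Rightarrow> 'N) \<Rightarrow> real^'n^'n \<Rightarrow> ('N::finite \<times> 'N) set \<Rightarrow>
     real^'n^'n \<Rightarrow> ('N \<Rightarrow> real^'p^'n) \<Rightarrow> real \<Rightarrow> real \<Rightarrow> (real \<Rightarrow> real^'n \<Rightarrow> real^'n) \<Rightarrow>
     (real \<Rightarrow> real^'m) \<Rightarrow> (real \<Rightarrow> real^'p) \<Rightarrow> real \<Rightarrow> real^('N \<times> 'n) \<Rightarrow> 'N \<Rightarrow> real^'n" where
  "observer_rhs A B C own G0 E Pa H \<mu> \<nu> \<gamma> u y t xh i =
     (let \<omega> = out_block own i (C *v agent xh i - y t); \<theta> = theta E xh i in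
        A *v agent xh i + B *v u t + \<gamma> t (agent xh i) +
        g_fun \<mu> G0 (norm \<omega>) *v (H i *v \<omega>) +
        \<nu> *\<^sub>R (agent_hnorm \<mu> G0 Pa \<theta> powr \<mu>) *\<^sub>R \<theta>)"

definition gamma_hat ::
    "(real \<Rightarrow> real^'n \<Rightarrow> real^'n) \<Rightarrow> real \<Rightarrow> real^('N::finite \<times> 'n) \<Rightarrow> real^('N \<times> 'n)" where
  "gamma_hat \<gamma> t xh = stack (\<lambda>i. \<gamma> t (agent xh i))"

definition gamma_tilde ::
    "(real \<Rightarrow> real^'n \<Rightarrow> real^'n) \<Rightarrow> real \<Rightarrow> real^'n \<Rightarrow> real^('N::finite \<times> 'n)" where
  "gamma_tilde \<gamma> t x = kronv 1 (\<gamma> t x)"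

definition error_rhs ::
    "real^'n^'n \<Rightarrow> real^'n^'p \<Rightarrow> ('p \<Rightarrow> 'N) \<Rightarrow> real^'n^'n \<Rightarrow> ('N::finite \<times> 'N) set \<Rightarrow>
     real^'n^'n \<Rightarrow> ('N \<Rightarrow> real^'p^'n) \<Rightarrow> real \<Rightarrow> real \<Rightarrow> (real \<Rightarrow> real^'n \<Rightarrow> real^'n) \<Rightarrow>
     (real \<Rightarrow> real^'n) \<Rightarrow> (real \<Rightarrow> (real^'n) \<times> (real^'p)) \<Rightarrow> real \<Rightarrow> real^('N \<times> 'n) \<Rightarrow> real^('N \<times> 'n)" where
  "error_rhs A C own G0 E Pa H \<mu> \<nu> \<gamma> x q t e =
     (let qx = fst (q t); qy = snd (q t);
          \<omega> = (\<lambda>i. out_block own i (C *v agent e i - qy));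
          \<theta> = theta E e;
          Dg = block_diag (\<lambda>i. g_fun \<mu> G0 (norm (\<omega> i)));
          D\<theta> = block_diag (\<lambda>i. (agent_hnorm \<mu> G0 Pa (\<theta> i) powr \<mu>) *\<^sub>R mat 1)
      in (kron (mat 1) A + Dg ** H_tilde H ** C_tilde own C
            - \<nu> *\<^sub>R (D\<theta> ** kron (laplacian E) (mat 1))) *v e
         + (gamma_hat \<gamma> t (e + kronv 1 (x t)) - gamma_tilde \<gamma> t (x t))
         - (Dg ** H_tilde H) *v qy - kronv 1 qx)"

definition gamma_condition ::
    "'N::finite itself \<Rightarrow> real^'n^'n \<Rightarrow> real^'n^'n \<Rightarrow> real \<Rightarrow> real \<Rightarrow> (real \<Rightarrow> real^'n \<Rightarrow> real^'n) \<Rightarrow> bool" where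
  "gamma_condition _ G0 Pa \<mu> \<tau> \<gamma> \<longleftrightarrow>
     (\<forall>t>0. \<forall>(xh :: real^('N \<times> 'n)) x. xh \<noteq> kronv 1 x \<longrightarrow>
        stacked_wnorm Pa
          (stacked_dilation \<mu> G0 (- ln (stacked_hnorm \<mu> G0 Pa (xh - kronv 1 x)))
             *v (gamma_hat \<gamma> t xh - gamma_tilde \<gamma> t x))
        \<le> \<tau> * stacked_hnorm \<mu> G0 Pa (xh - kronv 1 x) powr \<mu>)"

section \<open>Input-to-state stability\<close>

definition class_K :: "(real \<Rightarrow> real) \<Rightarrow> bool" where
  "class_K \<alpha> \<longleftrightarrow> continuous_on {0..} \<alpha> \<and> strict_mono_on {0..} \<alpha> \<and> \<alpha> 0 = 0"

definition class_KL :: "(real \<Rightarrow> real \<Rightarrow> real) \<Rightarrow> bool" where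
  "class_KL \<beta> \<longleftrightarrow>
     continuous_on ({0..} \<times> {0..}) (\<lambda>(r, t). \<beta> r t) \<and>
     (\<forall>t\<ge>0. class_K (\<lambda>r. \<beta> r t)) \<and>
     (\<forall>r\<ge>0. antimono_on {0..} (\<beta> r) \<and> (\<beta> r \<longlongrightarrow> 0) at_top)"

text \<open>
  \<^const>\<open>infnorm\<close> is the maximum norm; on a product type it is the maximum over the coordinates
  of both components. The type \<^typ>\<open>ennreal\<close> makes the essential supremum over a null set \<open>0\<close>.
\<close>

definition Linf_norm_on :: "real set \<Rightarrow> (real \<Rightarrow> 'a::euclidean_space) \<Rightarrow> ennreal" where
  "Linf_norm_on S q = esssup (lebesgue_on S) (\<lambda>t. ennreal (infnorm (q t)))"

definition Linf :: "(real \<Rightarrow> 'a::euclidean_space) \<Rightarrow> bool" where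
  "Linf q \<longleftrightarrow> q \<in> borel_measurable lebesgue \<and> Linf_norm_on UNIV q < \<infinity>"

text \<open>Caratheodory solutions on \<open>[0, S)\<close>, where \<open>S\<close> may be \<open>\<infinity>\<close>.\<close>

definition solves_on :: "ereal \<Rightarrow> (real \<Rightarrow> 'a::euclidean_space \<Rightarrow> 'a) \<Rightarrow> (real \<Rightarrow> 'a) \<Rightarrow> bool" where
  "solves_on S f x \<longleftrightarrow>
     (\<forall>t\<ge>0. ereal t < S \<longrightarrow>
        (\<lambda>s. f s (x s)) absolutely_integrable_on {0..t} \<and>
        x t = x 0 + integral {0..t} (\<lambda>s. f s (x s)))"

text \<open>
  A system is given by the relation \<open>traj S e q\<close>: \<open>e\<close> is a state trajectory on \<open>[0, S)\<close> under
  the input \<open>q\<close>. Solutions need not be unique, and the estimate is required of all of them, on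
  their whole interval of existence.
\<close>

definition input_to_state_stable ::
    "(ereal \<Rightarrow> (real \<Rightarrow> 'e::real_normed_vector) \<Rightarrow> (real \<Rightarrow> 'q::euclidean_space) \<Rightarrow> bool) \<Rightarrow> bool" where
  "input_to_state_stable traj \<longleftrightarrow>
     (\<exists>\<beta> \<alpha>. class_KL \<beta> \<and> class_K \<alpha> \<and>
        (\<forall>S e q. Linf q \<longrightarrow> traj S e q \<longrightarrow>
           (\<forall>t\<ge>0. ereal t < S \<longrightarrow>
              norm (e t) \<le> \<beta> (norm (e 0)) t + \<alpha> (enn2real (Linf_norm_on {0..<t} q)))))"

text \<open>Here \<open>x\<close> is a plant trajectory, for some control \<open>u\<close>, under the same perturbation.\<close>

definition error_trajectory ::
    "real^'n^'n \<Rightarrow> real^'m^'n \<Rightarrow> real^'n^'p \<Rightarrow> ('p \<Rightarrow> 'N) \<Rightarrow> real^'n^'n \<Rightarrow> ('N::finite \<times> 'N) set \<Rightarrow>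
     real^'n^'n \<Rightarrow> ('N \<Rightarrow> real^'p^'n) \<Rightarrow> real \<Rightarrow> real \<Rightarrow> (real \<Rightarrow> real^'n \<Rightarrow> real^'n) \<Rightarrow>
     ereal \<Rightarrow> (real \<Rightarrow> real^('N \<times> 'n)) \<Rightarrow> (real \<Rightarrow> (real^'n) \<times> (real^'p)) \<Rightarrow> bool" where
  "error_trajectory A B C own G0 E Pa H \<mu> \<nu> \<gamma> S e q \<longleftrightarrow>
     (\<exists>u x. solves_on S (plant_rhs A B \<gamma> u (\<lambda>t. fst (q t))) x \<and>
            solves_on S (error_rhs A C own G0 E Pa H \<mu> \<nu> \<gamma> x q) e)"

text \<open>The error equation is the difference of observer and plant.\<close>

lemma agent_simps [simp]:
  "agent (z + w) i = agent z i + agent w i"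
  "agent (z - w) i = agent z i - agent w i"
  "agent (- z) i = - agent z i"
  "agent (c *\<^sub>R z) i = c *\<^sub>R agent z i"
  "agent (kronv 1 v) i = v"
  "agent (stack f) i = f i"
  by (simp_all add: agent_def kronv_def stack_def vec_eq_iff)

lemma sum_pair_UNIV:
  "(\<Sum>c\<in>(UNIV :: ('a::finite \<times> 'b::finite) set). f c) = (\<Sum>i\<in>UNIV. \<Sum>j\<in>UNIV. (f (i, j) :: real))"
  by (simp add: sum.cartesian_product)

lemma agent_block_diag: "agent (block_diag M *v z) i = M i *v agent z i"
  by (simp add: agent_def block_diag_def matrix_vector_mult_def vec_eq_iff sum_pair_UNIV
      if_distrib if_distribR sum.If_cases cong: if_cong)

lemma agent_kron_left:
  fixes M :: "real^'n^'n" and z :: "real^('N::finite \<times> 'n)"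
  shows "agent (kron (mat 1) M *v z) i = M *v agent z i"
proof -
  have "kron (mat 1 :: real^'N^'N) M = block_diag (\<lambda>_. M)"
    by (simp add: kron_def block_diag_def mat_def vec_eq_iff)
  then show ?thesis by (simp add: agent_block_diag)
qed

lemma theta_laplacian:
  assumes "irrefl E"
  shows "theta E z i = - agent (kron (laplacian E) (mat 1) *v z) i"
proof -
  have "agent (kron (laplacian E) (mat 1) *v z) i $ k = - theta E z i $ k" for k
  proof -
    have "agent (kron (laplacian E) (mat 1) *v z) i $ k
        = (\<Sum>j\<in>UNIV. \<Sum>l\<in>UNIV. laplacian E $ i $ j * (if k = l then 1 else 0) * z $ (j, l))"
      by (simp add: agent_def kron_def matrix_vector_mult_def mat_def sum_pair_UNIV)
    also have "\<dots> = (\<Sum>j\<in>UNIV. laplacian E $ i $ j * z $ (j, k))"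
      by (intro sum.cong refl) (simp add: if_distrib if_distribR sum.If_cases cong: if_cong)
    also have "\<dots> = (\<Sum>j\<in>UNIV. (if i = j then (\<Sum>k\<in>UNIV. adj E i k) * z $ (i, k) else 0)
                              - adj E i j * z $ (j, k))"
      using assms by (intro sum.cong refl) (auto simp: laplacian_def adj_def irrefl_def)
    also have "\<dots> = (\<Sum>k\<in>UNIV. adj E i k) * z $ (i, k) - (\<Sum>j\<in>UNIV. adj E i j * z $ (j, k))"
      by (simp add: sum_subtractf)
    also have "\<dots> = - theta E z i $ k"
      by (simp add: theta_def agent_def sum_subtractf sum_distrib_right right_diff_distrib)
    finally show ?thesis .
  qed
  then show ?thesis by (simp add: vec_eq_iff)
qed

lemma agent_H_tilde: "agent (H_tilde H *v y) i = H i *v y"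
  by (simp add: agent_def H_tilde_def matrix_vector_mult_def vec_eq_iff)

lemma H_gain_C_tilde:
  "H_gain own \<zeta> Hbar i *v (C_tilde own C *v e - y)
     = H_gain own \<zeta> Hbar i *v out_block own i (C *v agent e i - y)"
proof -
  have C: "(C_tilde own C *v e) $ r = (C *v agent e i) $ r" if "own r = i" for r
    using that
    by (simp add: C_tilde_def agent_def matrix_vector_mult_def sum_pair_UNIV
        if_distrib if_distribR sum.If_cases cong: if_cong)
  show ?thesis
    unfolding vec_eq_iff matrix_vector_mult_def[of "H_gain own \<zeta> Hbar i"]
    by (auto intro!: sum.cong simp: H_gain_def out_block_def C)
qed

lemma theta_shift: "theta E (z - kronv 1 x) i = theta E z i"
  by (simp add: theta_def)

lemma observer_minus_plant:
  fixes q :: "real \<Rightarrow> (real^'n) \<times> (real^'p)"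
  assumes E: "irrefl E" and H: "H = H_gain own \<zeta> Hbar"
  shows "observer_rhs A B C own G0 E Pa H \<mu> \<nu> \<gamma> u (\<lambda>t. C *v x t + snd (q t)) t xh i
           - plant_rhs A B \<gamma> u (\<lambda>t. fst (q t)) t (x t)
         = agent (error_rhs A C own G0 E Pa H \<mu> \<nu> \<gamma> x q t (xh - kronv 1 (x t))) i"
proof -
  define e where "e = xh - kronv 1 (x t)"
  define qy where "qy = snd (q t)"
  have ei: "agent e i = agent xh i - x t"
    by (simp add: e_def)
  define \<omega> where "\<omega> = (\<lambda>i. out_block own i (C *v agent e i - qy))"
  define Dg where "Dg = block_diag (\<lambda>i. g_fun \<mu> G0 (norm (\<omega> i)))"
  define D where "D = block_diag (\<lambda>i. (agent_hnorm \<mu> G0 Pa (theta E e i) powr \<mu>) *\<^sub>R (mat 1 :: real^'n^'n))"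
  have om: "out_block own i (C *v agent xh i - (C *v x t + snd (q t))) = \<omega> i"
    by (simp add: \<omega>_def ei qy_def matrix_vector_mult_diff_distrib algebra_simps)
  have om': "out_block own i (C *v (agent xh i - x t) - qy) = \<omega> i"
    by (simp add: \<omega>_def ei)
  have th: "theta E xh i = theta E e i"
    by (simp add: e_def theta_shift)
  have "error_rhs A C own G0 E Pa H \<mu> \<nu> \<gamma> x q t e
      = kron (mat 1) A *v e + Dg *v (H_tilde H *v (C_tilde own C *v e - qy))
        - \<nu> *\<^sub>R (D *v (kron (laplacian E) (mat 1) *v e))
        + (gamma_hat \<gamma> t (e + kronv 1 (x t)) - gamma_tilde \<gamma> t (x t)) - kronv 1 (fst (q t))"
    unfolding error_rhs_def Let_def qy_def \<omega>_def Dg_def D_def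
    by (simp add: matrix_vector_mult_add_rdistrib matrix_vector_mult_diff_rdistrib
        scaleR_matrix_vector_assoc[symmetric] matrix_vector_mul_assoc[symmetric]
        matrix_vector_mult_diff_distrib algebra_simps)
  then have "agent (error_rhs A C own G0 E Pa H \<mu> \<nu> \<gamma> x q t e) i
      = A *v agent e i + g_fun \<mu> G0 (norm (\<omega> i)) *v (H i *v \<omega> i)
        + \<nu> *\<^sub>R (agent_hnorm \<mu> G0 Pa (theta E e i) powr \<mu>) *\<^sub>R theta E e i
        + (\<gamma> t (agent xh i) - \<gamma> t (x t)) - fst (q t)"
    by (simp add: agent_kron_left agent_block_diag agent_H_tilde H H_gain_C_tilde Dg_def D_def
        theta_laplacian[OF E] gamma_hat_def gamma_tilde_def ei om'
        scaleR_matrix_vector_assoc[symmetric])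
  then show ?thesis
    unfolding observer_rhs_def plant_rhs_def Let_def om th e_def[symmetric]
    by (simp add: ei
        matrix_vector_mult_diff_distrib algebra_simps)
qed

end

theory Submission
  imports Defs
begin

text \<open>
  With \<open>L\<^sub>0 = 0\<close> one has \<open>A G\<^sub>0 = (G\<^sub>0 + I) A\<close> and \<open>C G\<^sub>0 = 0\<close>, so that the error equation is homogeneous of
  degree \<open>\<mu>\<close> for the dilation \<open>d(s) = exp (s G\<^sub>d)\<close>: the scaled error \<open>z = d(- ln r) e\<close> obeys the same
  equation with the perturbations scaled by powers of \<open>r\<close>. On bounded sets this equation converges to
  the linear observer as \<open>\<mu> \<rightarrow> 0\<close>. The linear observer has the quadratic Lyapunov function
  \<open>V z = \<Sum>\<^sub>a |\<xi>\<^sub>a|\<^sup>2\<close>, where \<open>\<xi> = (T\<^sup>-\<^sup>1 \<otimes> I) z\<close> and \<open>|\<cdot>|\<close> is the norm of \<open>P\<^sub>a\<close>: the \<open>\<zeta>\<close>-weighted mean is stabilised by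
  the matrix inequality and the disagreement by a large \<open>\<nu>\<close>. Hence \<open>V\<close> decreases along the scaled equation
  where \<open>1 \<le> V \<le> 2\<close>, even if \<open>r\<close> shrinks slowly, as long as \<open>r\<close> dominates the perturbations. So
  \<open>V (d(- ln r(t)) e(t)) \<le> 1\<close> is preserved, and \<open>r(t)\<close> bounds the error. This barrier argument needs neither a
  derivative of the homogeneous norm nor the differentiability of trajectories.
\<close>

section \<open>The matrix exponential\<close>

text \<open>Two obstacles shape the argument. Trajectories are Caratheodory solutions, so only
  integral identities are available: \<open>primitive_on\<close> carries such an identity, and the
  product rule is proved for it directly. Moreover the constants must be fixed in the order
  \<open>\<nu>\<close>, then \<open>\<delta>\<close> and \<open>\<mu>\<close>, then
  \<open>\<gamma>\<close> and the disturbance. The rate \<open>\<rho> / 2\<close>, which the matrix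
  inequality yields for small \<open>\<mu>\<close>, is therefore spent in fixed portions: at most
  \<open>\<rho> / 3\<close> on \<open>\<gamma>\<close>, \<open>\<rho> / 12\<close> on the cross
  terms between mean and disagreement, and, where \<open>V \<ge> 1\<close>, the last
  \<open>\<rho> / 12\<close> on everything else. That rest consists of the nonlinearity, of order
  \<open>\<bar>\<mu>\<bar>\<close>, and of the scaled disturbance and the shrinking of
  \<open>r\<close>, of order \<open>\<delta>\<close>; its constants may depend on
  \<open>\<nu>\<close>. The factor \<open>r powr \<mu>\<close> in front of the scaled equation is a
  change of time: for \<open>\<mu> > 0\<close> it slows the motion near the origin, for
  \<open>\<mu> < 0\<close> far away from it. The radius has to follow a profile slow enough for
  both.\<close>

lemma bounded_bilinear_matrix_mult: "bounded_bilinear ((**) :: real^'b^'a \<Rightarrow> real^'c^'b \<Rightarrow> real^'c^'a)"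
  unfolding bilinear_conv_bounded_bilinear[symmetric] bilinear_def
  by (auto intro!: linearI simp: vec_eq_iff matrix_matrix_mult_def
      sum_distrib_left mult_ac sum.distrib algebra_simps)

lemma bounded_bilinear_matrix_vector_mult: "bounded_bilinear ((*v) :: real^'b^'a \<Rightarrow> real^'b \<Rightarrow> real^'a)"
  unfolding bilinear_conv_bounded_bilinear[symmetric] bilinear_def
  by (auto intro!: linearI simp: matrix_vector_right_distrib matrix_vector_mult_add_rdistrib
      scaleR_matrix_vector_assoc[symmetric] matrix_vector_mult_scaleR)

lemma matpow_0 [simp]: "matpow M 0 = mat 1"
  by (simp add: matpow_def)

lemma matpow_Suc: "matpow M (Suc k) = M ** matpow M k"
  by (simp add: matpow_def)

lemma matpow_scaleR: "matpow (s *\<^sub>R M) k = s ^ k *\<^sub>R matpow M k"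
  by (induction k)
     (simp_all add: matpow_Suc bounded_bilinear.scaleR_left[OF bounded_bilinear_matrix_mult]
        bounded_bilinear.scaleR_right[OF bounded_bilinear_matrix_mult] mult_ac)

lemma matpow_intertwine:
  assumes "K ** M = M' ** K"
  shows "K ** matpow M k = matpow M' k ** K"
proof (induction k)
  case (Suc k)
  then show ?case
    by (simp add: matpow_Suc matrix_mul_assoc assms) (simp add: matrix_mul_assoc[symmetric])
qed simp

text \<open>Dominated by the real series of \<open>exp (norm M * K)\<close>, where \<open>K\<close>
  is a bilinear bound of the matrix product.\<close>

lemma summable_mexp: "summable (\<lambda>k. matpow (M :: real^'a^'a) k /\<^sub>R fact k)"
proof -
  obtain K where K: "K > 0" "\<And>(X :: real^'a^'a) (Y :: real^'a^'a). norm (X ** Y) \<le> norm X * norm Y * K"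
    using bounded_bilinear.pos_bounded[OF bounded_bilinear_matrix_mult] by metis
  have *: "norm (matpow M k) \<le> norm (mat 1 :: real^'a^'a) * (norm M * K) ^ k" for k
  proof (induction k)
    case (Suc k)
    have "norm (matpow M (Suc k)) \<le> norm (matpow M k) * (norm M * K)"
      using K(2)[of M "matpow M k"] by (simp add: matpow_Suc mult_ac)
    also have "\<dots> \<le> norm (mat 1 :: real^'a^'a) * (norm M * K) ^ k * (norm M * K)"
      using Suc K by (intro mult_right_mono) auto
    finally show ?case by (simp add: mult_ac)
  qed simp
  show ?thesis
  proof (rule summable_comparison_test[OF _ summable_mult])
    show "\<exists>N. \<forall>n\<ge>N. norm (matpow M n /\<^sub>R fact n)
        \<le> norm (mat 1 :: real^'a^'a) * ((norm M * K) ^ n /\<^sub>R fact n)"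
      using * by (simp add: field_simps)
  qed (rule summable_exp_generic)
qed

lemma mexp_sums: "(\<lambda>k. matpow M k /\<^sub>R fact k) sums mexp M"
  unfolding mexp_def using summable_mexp by (rule summable_sums)

lemma mexp_0 [simp]: "mexp 0 = mat 1"
proof -
  have 1: "matpow (0::real^'a^'a) k /\<^sub>R fact k = 0" if "k \<notin> {0}" for k
    using that by (cases k) (auto simp: matpow_Suc)
  have "mexp (0::real^'a^'a) = (\<Sum>k\<in>{0}. matpow (0::real^'a^'a) k /\<^sub>R fact k)"
    unfolding mexp_def by (rule suminf_finite) (use 1 in auto)
  then show ?thesis by simp
qed

text \<open>The matrix \<open>K\<close> may be rectangular and the generators may differ. With
  \<open>K = A\<close> and \<open>K = C\<close> this turns the algebraic relations between
  \<open>A\<close>, \<open>C\<close> and \<open>G0\<close> into homogeneity; \<open>M' = M\<close>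
  gives commutation.\<close>

lemma mexp_intertwine:
  assumes "K ** M = M' ** K"
  shows "K ** mexp M = mexp M' ** K"
proof -
  have "(\<lambda>k. K ** (matpow M k /\<^sub>R fact k)) sums (K ** mexp M)"
    by (rule bounded_linear.sums[OF bounded_bilinear.bounded_linear_right[OF bounded_bilinear_matrix_mult] mexp_sums])
  moreover have "(\<lambda>k. matpow M' k /\<^sub>R fact k ** K) sums (mexp M' ** K)"
    by (rule bounded_linear.sums[OF bounded_bilinear.bounded_linear_left[OF bounded_bilinear_matrix_mult] mexp_sums])
  moreover have "K ** (matpow M k /\<^sub>R fact k) = matpow M' k /\<^sub>R fact k ** K" for k
    using matpow_intertwine[OF assms, of k]
    by (simp add: bounded_bilinear.scaleR_left[OF bounded_bilinear_matrix_mult]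
        bounded_bilinear.scaleR_right[OF bounded_bilinear_matrix_mult])
  ultimately show ?thesis by (simp add: sums_unique2)
qed

text \<open>Each component is an everywhere convergent real power series in \<open>s\<close>, and
  \<open>diffs\<close> of its coefficients are the coefficients of the same component of
  \<open>M ** mexp (s *\<^sub>R M)\<close>.\<close>

lemma mexp_has_vector_derivative:
  "((\<lambda>s. mexp (s *\<^sub>R M)) has_vector_derivative (M ** mexp (s *\<^sub>R M))) (at s within S)"
proof -
  have D: "((\<lambda>s. mexp (s *\<^sub>R M) \<bullet> b) has_real_derivative ((M ** mexp (s *\<^sub>R M)) \<bullet> b)) (at s)" for b
  proof -
    define c where "c k = (matpow M k /\<^sub>R fact k) \<bullet> b" for k
    have sc: "(\<lambda>k. c k * s ^ k) sums (mexp (s *\<^sub>R M) \<bullet> b)" for s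
      using bounded_linear.sums[OF bounded_linear_inner_left mexp_sums[of "s *\<^sub>R M"], of b]
      by (simp add: c_def matpow_scaleR mult_ac)
    have "(\<lambda>k. diffs c k * s ^ k) sums ((M ** mexp (s *\<^sub>R M)) \<bullet> b)"
    proof -
      have "(\<lambda>k. (M ** (matpow (s *\<^sub>R M) k /\<^sub>R fact k)) \<bullet> b) sums ((M ** mexp (s *\<^sub>R M)) \<bullet> b)"
        by (intro bounded_linear.sums[OF bounded_linear_inner_left] mexp_sums
            bounded_linear.sums[OF bounded_bilinear.bounded_linear_right[OF bounded_bilinear_matrix_mult]])
      moreover have "(M ** (matpow (s *\<^sub>R M) k /\<^sub>R fact k)) \<bullet> b = diffs c k * s ^ k" for k
        by (simp add: c_def diffs_def matpow_scaleR matpow_Suc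
            bounded_bilinear.scaleR_right[OF bounded_bilinear_matrix_mult] field_simps del: of_nat_Suc)
      ultimately show ?thesis by simp
    qed
    then have eq: "(M ** mexp (s *\<^sub>R M)) \<bullet> b = (\<Sum>k. diffs c k * s ^ k)"
      by (simp add: sums_unique)
    have "((\<lambda>x. \<Sum>k. c k * x ^ k) has_real_derivative (\<Sum>k. diffs c k * s ^ k)) (at s)"
      by (rule termdiffs_strong_converges_everywhere) (use sc sums_summable in blast)
    moreover have "(\<lambda>x. \<Sum>k. c k * x ^ k) = (\<lambda>x. mexp (x *\<^sub>R M) \<bullet> b)"
      using sc by (auto simp: sums_unique[symmetric])
    ultimately show ?thesis by (simp add: eq)
  qed
  have "((\<lambda>s. mexp (s *\<^sub>R M)) has_vector_derivative (M ** mexp (s *\<^sub>R M))) (at s)"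
    unfolding has_vector_derivative_def
    by (subst has_derivative_componentwise_within)
       (use D in \<open>auto simp: has_field_derivative_def has_vector_derivative_def mult_commute_abs mult.commute\<close>)
  then show ?thesis by (rule has_vector_derivative_at_within)
qed

lemma mexp_commute: "M ** mexp (s *\<^sub>R M) = mexp (s *\<^sub>R M) ** M"
  by (rule mexp_intertwine)
     (simp add: bounded_bilinear.scaleR_left[OF bounded_bilinear_matrix_mult]
        bounded_bilinear.scaleR_right[OF bounded_bilinear_matrix_mult])

text \<open>The product along \<open>s\<close> has derivative zero, since \<open>M\<close> commutes
  with its exponential; hence its value at 1 is its value at 0.\<close>

lemma mexp_uminus: "mexp (- M) ** mexp M = mat 1"
proof -
  define f where "f s = mexp (s *\<^sub>R (- M)) ** mexp (s *\<^sub>R M)" for s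
  have "(f has_vector_derivative 0) (at s)" for s
    unfolding f_def
    by (rule has_vector_derivative_eq_rhs,
        rule bounded_bilinear.has_vector_derivative[OF bounded_bilinear_matrix_mult
          mexp_has_vector_derivative mexp_has_vector_derivative])
       (simp only: mexp_commute[of "- M" s] matrix_mul_assoc,
        simp add: bounded_bilinear.minus_left[OF bounded_bilinear_matrix_mult]
          bounded_bilinear.minus_right[OF bounded_bilinear_matrix_mult])
  then have "f 1 = f 0"
    by (metis has_vector_derivative_zero_constant[of UNIV f] convex_UNIV UNIV_I)
  then show ?thesis by (simp add: f_def)
qed

text \<open>\<open>s \<mapsto> exp (- s (M + N)) exp (s M) exp (s N)\<close> has derivative \<open>0\<close>.\<close>

lemma mexp_add_commuting:
  assumes MN: "M ** N = N ** M"
  shows "mexp (M + N) = mexp M ** mexp N"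
proof -
  define e where "e s = mexp (s *\<^sub>R (- (M + N)))" for s
  define a where "a s = mexp (s *\<^sub>R M)" for s
  define b where "b s = mexp (s *\<^sub>R N)" for s
  note bilin = bounded_bilinear.add_left[OF bounded_bilinear_matrix_mult]
    bounded_bilinear.add_right[OF bounded_bilinear_matrix_mult]
    bounded_bilinear.minus_left[OF bounded_bilinear_matrix_mult]
    bounded_bilinear.minus_right[OF bounded_bilinear_matrix_mult]
    bounded_bilinear.scaleR_left[OF bounded_bilinear_matrix_mult]
    bounded_bilinear.scaleR_right[OF bounded_bilinear_matrix_mult]
  have Na: "a s ** N = N ** a s" for s
    unfolding a_def by (rule mexp_intertwine[symmetric]) (simp add: bilin MN)
  have eM: "(M + N) ** e s = e s ** (M + N)" for s
    unfolding e_def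
    by (rule mexp_intertwine)
       (simp add: bilin MN bounded_bilinear.diff_left[OF bounded_bilinear_matrix_mult]
          bounded_bilinear.diff_right[OF bounded_bilinear_matrix_mult] algebra_simps)
  have "((\<lambda>s. e s ** (a s ** b s)) has_vector_derivative 0) (at s)" for s
  proof (rule has_vector_derivative_eq_rhs)
    show "((\<lambda>s. e s ** (a s ** b s)) has_vector_derivative
        e s ** (a s ** (N ** b s) + (M ** a s) ** b s) + (- (M + N) ** e s) ** (a s ** b s)) (at s)"
      unfolding e_def a_def b_def
      by (intro bounded_bilinear.has_vector_derivative[OF bounded_bilinear_matrix_mult]
          mexp_has_vector_derivative)
    have "a s ** (N ** b s) = N ** (a s ** b s)"
      by (simp add: matrix_mul_assoc Na)
    moreover have "(- (M + N) ** e s) ** (a s ** b s) = - (e s ** ((M + N) ** (a s ** b s)))"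
      by (simp only: bilin(3) matrix_mul_assoc eM)
    ultimately show "e s ** (a s ** (N ** b s) + (M ** a s) ** b s) + (- (M + N) ** e s) ** (a s ** b s) = 0"
      by (simp add: bilin matrix_mul_assoc)
  qed
  then have "e 1 ** (a 1 ** b 1) = e 0 ** (a 0 ** b 0)"
    by (metis (mono_tags, lifting) has_vector_derivative_zero_constant[of UNIV "\<lambda>s. e s ** (a s ** b s)"] convex_UNIV UNIV_I)
  then have "mexp (- (M + N)) ** (mexp M ** mexp N) = mat 1"
    by (simp add: e_def a_def b_def)
  then have "mexp (M + N) ** (mexp (- (M + N)) ** (mexp M ** mexp N)) = mexp (M + N)"
    by simp
  moreover have "mexp (M + N) ** mexp (- (M + N)) = mat 1"
    using mexp_uminus[of "- (M + N)"] by (simp add: add.commute)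
  ultimately show ?thesis
    by (simp add: matrix_mul_assoc)
qed

lemma mexp_add: "mexp ((a + b) *\<^sub>R M) = mexp (a *\<^sub>R M) ** mexp (b *\<^sub>R M)"
  unfolding scaleR_add_left
  by (rule mexp_add_commuting)
     (simp add: bounded_bilinear.scaleR_left[OF bounded_bilinear_matrix_mult]
        bounded_bilinear.scaleR_right[OF bounded_bilinear_matrix_mult])

text \<open>Splits the dilation into the uniform scaling \<open>exp s\<close> and the factor
  generated by \<open>\<mu> G0\<close>, which is close to the identity for small
  \<open>\<mu>\<close>.\<close>

lemma mexp_add_scalar: "mexp (M + c *\<^sub>R mat 1) = exp c *\<^sub>R mexp M"
proof -
  have 1: "matpow (c *\<^sub>R mat 1) k = c ^ k *\<^sub>R (mat 1 :: real^'a^'a)" for k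
    unfolding matpow_scaleR by (induction k) (auto simp: matpow_Suc)
  have "(\<lambda>k. (c ^ k /\<^sub>R fact k) *\<^sub>R (mat 1 :: real^'a^'a)) sums (exp c *\<^sub>R mat 1)"
    by (rule bounded_linear.sums[OF bounded_linear_scaleR_left exp_converges])
  then have "mexp (c *\<^sub>R mat 1 :: real^'a^'a) = exp c *\<^sub>R mat 1"
    using mexp_sums[of "c *\<^sub>R mat 1 :: real^'a^'a"] by (simp add: 1 sums_unique2 mult_ac)
  then show ?thesis
    by (subst mexp_add_commuting)
       (simp_all add: bounded_bilinear.scaleR_left[OF bounded_bilinear_matrix_mult]
        bounded_bilinear.scaleR_right[OF bounded_bilinear_matrix_mult])
qed

section \<open>Primitives of integrable functions\<close>

text \<open>Absolute continuity in integral form; \<open>f\<close> stands for a derivative that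
  exists only almost everywhere. Absolute integrability makes \<open>norm (f t)\<close> integrable,
  on which the error bound in the product rule rests.\<close>

definition primitive_on :: "real \<Rightarrow> (real \<Rightarrow> 'a::euclidean_space) \<Rightarrow> (real \<Rightarrow> 'a) \<Rightarrow> bool" where
  "primitive_on T f x \<longleftrightarrow>
     f absolutely_integrable_on {0..T} \<and> (\<forall>t\<in>{0..T}. x t = x 0 + integral {0..t} f)"

lemma primitive_on_integrable:
  assumes "primitive_on T f x" "0 \<le> s" "t \<le> T"
  shows "f absolutely_integrable_on {s..t}" "f integrable_on {s..t}"
proof -
  show "f absolutely_integrable_on {s..t}"
    using assms(1)[unfolded primitive_on_def, THEN conjunct1] assms(2,3)
    by (auto intro: set_integrable_subset)
  then show "f integrable_on {s..t}"
    using set_lebesgue_integral_eq_integral(1) by blast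
qed

lemma primitive_onD: "primitive_on T f x \<Longrightarrow> 0 \<le> t \<Longrightarrow> t \<le> T \<Longrightarrow> x t = x 0 + integral {0..t} f"
  unfolding primitive_on_def by (meson atLeastAtMost_iff)

lemma primitive_on_increment:
  assumes "primitive_on T f x" "0 \<le> s" "s \<le> t" "t \<le> T"
  shows "x t - x s = integral {s..t} f"
proof -
  have "integral {0..s} f + integral {s..t} f = integral {0..t} f"
    using assms primitive_on_integrable(2)[OF assms(1), of 0 t] by (intro Henstock_Kurzweil_Integration.integral_combine) auto
  moreover have "x t = x 0 + integral {0..t} f" "x s = x 0 + integral {0..s} f"
    using assms by (auto intro: primitive_onD)
  ultimately show ?thesis by (simp add: algebra_simps)
qed

lemma primitive_on_continuous:
  assumes "primitive_on T f x"
  shows "continuous_on {0..T} x"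
proof -
  have "continuous_on {0..T} (\<lambda>t. x 0 + integral {0..t} f)"
    using primitive_on_integrable(2)[OF assms, of 0 T] by (intro continuous_intros indefinite_integral_continuous_1) auto
  moreover have "x 0 + integral {0..t} f = x t" if "t \<in> {0..T}" for t
    using that by (intro primitive_onD[OF assms, symmetric]) auto
  ultimately show ?thesis
    by (rule continuous_on_eq)
qed

lemma primitive_on_C1:
  assumes D: "\<And>t. t \<in> {0..T} \<Longrightarrow> (x has_vector_derivative f t) (at t within {0..T})"
    and c: "continuous_on {0..T} f"
  shows "primitive_on T f x"
  unfolding primitive_on_def
proof (intro conjI ballI)
  show "f absolutely_integrable_on {0..T}"
    by (rule absolutely_integrable_continuous_real[OF c])
  fix t assume t: "t \<in> {0..T}"
  have "(f has_integral (x t - x 0)) {0..t}"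
    using t by (intro fundamental_theorem_of_calculus) (auto intro!: has_vector_derivative_within_subset[OF D])
  then show "x t = x 0 + integral {0..t} f"
    by (simp add: integral_unique)
qed

text \<open>Telescoping over a fine equidistant partition gives
  \<open>norm (D T - D 0) \<le> \<epsilon> * (m T - m 0)\<close> for every
  \<open>\<epsilon>\<close>. This replaces the zero-derivative argument: the increments of
  \<open>D\<close> are small relative to those of \<open>m\<close>, not relative to the length of
  the interval.\<close>

lemma const_if_small_increments:
  fixes D :: "real \<Rightarrow> 'b::real_normed_vector" and m :: "real \<Rightarrow> real"
  assumes small: "\<And>\<epsilon>. \<epsilon> > 0 \<Longrightarrow> \<exists>\<delta>>0. \<forall>s t. 0 \<le> s \<longrightarrow> s \<le> t \<longrightarrow> t \<le> T \<longrightarrow> t - s < \<delta> \<longrightarrow>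
      norm (D t - D s) \<le> \<epsilon> * (m t - m s)"
    and T: "0 \<le> T"
  shows "D T = D 0"
proof -
  have *: "norm (D T - D 0) \<le> \<epsilon> * (m T - m 0)" if \<epsilon>: "\<epsilon> > 0" for \<epsilon>
  proof -
    obtain \<delta> where \<delta>: "\<delta> > 0" and inc: "\<And>s t. 0 \<le> s \<Longrightarrow> s \<le> t \<Longrightarrow> t \<le> T \<Longrightarrow> t - s < \<delta> \<Longrightarrow>
        norm (D t - D s) \<le> \<epsilon> * (m t - m s)"
      using small[OF \<epsilon>] by blast
    obtain n :: nat where n: "T / \<delta> < real n" using reals_Archimedean2 by blast
    with T \<delta> have n0: "n > 0" by (cases n) (auto simp: divide_less_0_iff)
    have st: "T / n < \<delta>" using n n0 \<delta> by (simp add: field_simps)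
    have "norm (D (k * (T / n)) - D 0) \<le> \<epsilon> * (m (k * (T / n)) - m 0)" if "k \<le> n" for k
      using that
    proof (induction k)
      case (Suc k)
      let ?s = "k * (T / n)" and ?t = "Suc k * (T / n)"
      have "?t \<le> n * (T / n)" using Suc.prems T n0 by (intro mult_right_mono) auto
      then have "?t \<le> T" using n0 by simp
      moreover have "?s \<le> ?t" using T by (intro mult_right_mono) auto
      moreover have "0 \<le> ?s" using T by simp
      moreover have "?t - ?s = T / n" by (simp add: algebra_simps add_divide_distrib)
      ultimately have "norm (D ?t - D ?s) \<le> \<epsilon> * (m ?t - m ?s)"
        using st by (intro inc) auto
      moreover have "norm (D ?s - D 0) \<le> \<epsilon> * (m ?s - m 0)" using Suc by auto
      moreover have "norm (D ?t - D 0) \<le> norm (D ?t - D ?s) + norm (D ?s - D 0)"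
        using norm_triangle_ineq[of "D ?t - D ?s" "D ?s - D 0"] by simp
      ultimately show ?case by (simp only: right_diff_distrib)
    qed simp
    from this[of n] show ?thesis using n0 by simp
  qed
  have "norm (D T - D 0) \<le> 0"
  proof (rule field_le_epsilon)
    fix e :: real assume e: "e > 0"
    let ?K = "\<bar>m T - m 0\<bar> + 1"
    have "norm (D T - D 0) \<le> e / ?K * (m T - m 0)" using e by (intro *) auto
    also have "\<dots> \<le> e / ?K * ?K" using e by (intro mult_left_mono) auto
    also have "\<dots> = e" by simp
    finally show "norm (D T - D 0) \<le> 0 + e" by simp
  qed
  then show ?thesis by simp
qed

lemma absolutely_integrable_bilinear_continuous:
  fixes h :: "'a::euclidean_space \<Rightarrow> 'b::euclidean_space \<Rightarrow> 'c::euclidean_space"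
  assumes "bounded_bilinear h" "continuous_on {a..b::real} f" "g absolutely_integrable_on {a..b}"
  shows "(\<lambda>t. h (f t) (g t)) absolutely_integrable_on {a..b}"
proof (rule absolutely_integrable_bounded_measurable_product[where h = h and f = f and g = g])
  show "bilinear h" using assms(1) by (simp add: bilinear_conv_bounded_bilinear)
  show "f \<in> borel_measurable (lebesgue_on {a..b})"
    using assms(2) by (rule continuous_imp_measurable_on_sets_lebesgue) auto
  show "bounded (f ` {a..b})"
    using assms(2) by (intro compact_imp_bounded compact_continuous_image) auto
qed (use assms(3) in auto)

text \<open>Over a short interval the increment of the product is the integral of \<open>h\<close>
  with \<open>x\<close> and \<open>y\<close> frozen at end points. By uniform continuity the
  freezing costs at most \<open>\<epsilon>\<close> times the integral of
  \<open>norm (f u) + norm (g u)\<close>, so the difference \<open>D\<close> between the product and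
  the integral of \<open>h\<close> is constant.\<close>

lemma primitive_on_product:
  assumes bb: "bounded_bilinear pr"
    and x: "primitive_on T f (x :: real \<Rightarrow> 'a::euclidean_space)"
    and y: "primitive_on T g (y :: real \<Rightarrow> 'b::euclidean_space)"
  shows "primitive_on T (\<lambda>t. pr (x t) (g t) + pr (f t) (y t)) (\<lambda>t. pr (x t) (y t) :: 'c::euclidean_space)"
proof -
  interpret pr: bounded_bilinear pr by fact
  define h where "h t = pr (x t) (g t) + pr (f t) (y t)" for t
  note cx = primitive_on_continuous[OF x] and cy = primitive_on_continuous[OF y]
  have fi: "f absolutely_integrable_on {0..T}" and gi: "g absolutely_integrable_on {0..T}"
    using primitive_on_integrable(1)[OF x, of 0 T] primitive_on_integrable(1)[OF y, of 0 T] by auto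
  have hi: "h absolutely_integrable_on {0..T}"
    unfolding h_def
    by (intro set_integral_add absolutely_integrable_bilinear_continuous[OF bb cx gi]
        absolutely_integrable_bilinear_continuous[OF pr.flip cy fi])
  define n where "n t = norm (f t) + norm (g t)" for t
  have ni: "n integrable_on {0..T}"
    unfolding n_def
    by (intro integrable_add) (use fi gi absolutely_integrable_on_def in auto)
  obtain K where K: "K > 0" "\<And>u v. norm (pr u v) \<le> norm u * norm v * K"
    using pr.pos_bounded by metis
  define D where "D t = pr (x t) (y t) - integral {0..t} h" for t
  have step: "\<exists>\<delta>>0. \<forall>s t. 0 \<le> s \<longrightarrow> s \<le> t \<longrightarrow> t \<le> T \<longrightarrow> t - s < \<delta> \<longrightarrow>
      norm (D t - D s) \<le> \<epsilon> * (integral {0..t} n - integral {0..s} n)" if \<epsilon>: "\<epsilon> > 0" for \<epsilon>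
  proof -
    have "uniformly_continuous_on {0..T} x" "uniformly_continuous_on {0..T} y"
      using cx cy by (auto intro: compact_uniformly_continuous)
    then obtain \<delta>1 \<delta>2 where \<delta>: "\<delta>1 > 0" "\<delta>2 > 0"
      and ux: "\<And>u v. u \<in> {0..T} \<Longrightarrow> v \<in> {0..T} \<Longrightarrow> dist u v < \<delta>1 \<Longrightarrow> dist (x u) (x v) < \<epsilon> / K"
      and uy: "\<And>u v. u \<in> {0..T} \<Longrightarrow> v \<in> {0..T} \<Longrightarrow> dist u v < \<delta>2 \<Longrightarrow> dist (y u) (y v) < \<epsilon> / K"
    proof -
      assume u: "uniformly_continuous_on {0..T} x" "uniformly_continuous_on {0..T} y"
      have "\<epsilon> / K > 0" using \<epsilon> K(1) by simp
      with u show ?thesis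
        unfolding uniformly_continuous_on_def using that by (metis dist_commute)
    qed
    show ?thesis
    proof (intro exI[of _ "min \<delta>1 \<delta>2"] conjI allI impI)
      fix s t :: real assume st: "0 \<le> s" "s \<le> t" "t \<le> T" "t - s < min \<delta>1 \<delta>2"
      have iv: "h integrable_on {s..t}" "f integrable_on {s..t}" "g integrable_on {s..t}" "n integrable_on {s..t}"
        using integrable_on_subinterval[OF set_lebesgue_integral_eq_integral(1)[OF hi], of s t]
          integrable_on_subinterval[OF ni, of s t]
          primitive_on_integrable(2)[OF x, of s t] primitive_on_integrable(2)[OF y, of s t] st by auto
      have ih: "integral {0..t} h - integral {0..s} h = integral {s..t} h"
        using Henstock_Kurzweil_Integration.integral_combine[of 0 s t h] st
          integrable_on_subinterval[OF set_lebesgue_integral_eq_integral(1)[OF hi], of 0 t]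
        by (simp add: algebra_simps)
      have iN: "integral {0..t} n - integral {0..s} n = integral {s..t} n"
        using Henstock_Kurzweil_Integration.integral_combine[of 0 s t n] st
          integrable_on_subinterval[OF ni, of 0 t]
        by (simp add: algebra_simps)
      \<comment> \<open>One factor is frozen at \<open>t\<close> and the other at \<open>s\<close>,
        which makes the identity exact, without a second order remainder.\<close>
      have "pr (x t) (y t) - pr (x s) (y s) = pr (x t) (y t - y s) + pr (x t - x s) (y s)"
        by (simp add: pr.diff_left pr.diff_right)
      also have "\<dots> = pr (x t) (integral {s..t} g) + pr (integral {s..t} f) (y s)"
        using st by (simp add: primitive_on_increment[OF x] primitive_on_increment[OF y])
      also have "\<dots> = integral {s..t} (\<lambda>u. pr (x t) (g u)) + integral {s..t} (\<lambda>u. pr (f u) (y s))"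
        using integral_linear[OF iv(3) pr.bounded_linear_right[of "x t"]]
          integral_linear[OF iv(2) pr.bounded_linear_left[of "y s"]] by (simp add: o_def)
      also have "\<dots> = integral {s..t} (\<lambda>u. pr (x t) (g u) + pr (f u) (y s))"
        using integrable_linear[OF iv(3) pr.bounded_linear_right[of "x t"]]
          integrable_linear[OF iv(2) pr.bounded_linear_left[of "y s"]]
        by (simp add: o_def Henstock_Kurzweil_Integration.integral_add)
      finally have "D t - D s = integral {s..t} (\<lambda>u. pr (x t) (g u) + pr (f u) (y s)) - integral {s..t} h"
        using ih by (simp add: D_def algebra_simps)
      also have "\<dots> = integral {s..t} (\<lambda>u. pr (x t) (g u) + pr (f u) (y s) - h u)"
        using integrable_linear[OF iv(3) pr.bounded_linear_right[of "x t"]]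
          integrable_linear[OF iv(2) pr.bounded_linear_left[of "y s"]] iv(1)
        by (subst Henstock_Kurzweil_Integration.integral_diff) (auto simp: o_def intro: integrable_add)
      finally have DD: "D t - D s = \<dots>" .
      have "norm (D t - D s) \<le> integral {s..t} (\<lambda>u. \<epsilon> * n u)"
        unfolding DD
      proof (rule integral_norm_bound_integral)
        show "(\<lambda>u. pr (x t) (g u) + pr (f u) (y s) - h u) integrable_on {s..t}"
          using integrable_linear[OF iv(3) pr.bounded_linear_right[of "x t"]]
            integrable_linear[OF iv(2) pr.bounded_linear_left[of "y s"]] iv(1)
          by (auto simp: o_def intro!: integrable_add integrable_diff)
        show "(\<lambda>u. \<epsilon> * n u) integrable_on {s..t}"
          using iv(4) integrable_on_cmult_left by fastforce
        fix u assume u: "u \<in> {s..t}"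
        have "dist (x t) (x u) < \<epsilon> / K" "dist (y s) (y u) < \<epsilon> / K"
          using u st by (auto intro!: ux uy simp: dist_real_def)
        then have l: "norm (x t - x u) * K \<le> \<epsilon>" "norm (y s - y u) * K \<le> \<epsilon>"
          using K(1) by (auto simp: dist_norm field_simps)
        have "pr (x t) (g u) + pr (f u) (y s) - h u = pr (x t - x u) (g u) + pr (f u) (y s - y u)"
          by (simp add: h_def pr.diff_left pr.diff_right)
        also have "norm \<dots> \<le> norm (x t - x u) * norm (g u) * K + norm (f u) * norm (y s - y u) * K"
          by (rule norm_triangle_le[OF add_mono[OF K(2) K(2)]])
        also have "\<dots> \<le> \<epsilon> * norm (g u) + \<epsilon> * norm (f u)"
          using mult_right_mono[OF l(1), of "norm (g u)"] mult_right_mono[OF l(2), of "norm (f u)"]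
          by (simp add: mult_ac)
        finally show "norm (pr (x t) (g u) + pr (f u) (y s) - h u) \<le> \<epsilon> * n u"
          by (simp add: n_def algebra_simps)
      qed
      then show "norm (D t - D s) \<le> \<epsilon> * (integral {0..t} n - integral {0..s} n)"
        by (simp add: iN)
    qed (use \<delta> in auto)
  qed
  show ?thesis
    unfolding primitive_on_def h_def[symmetric]
  proof (intro conjI hi ballI)
    fix t assume t: "t \<in> {0..T}"
    have "D t = D 0"
    proof (rule const_if_small_increments)
      fix \<epsilon> :: real assume "\<epsilon> > 0"
      from step[OF this] obtain \<delta> where "\<delta> > 0" and \<delta>: "\<And>s t. 0 \<le> s \<Longrightarrow> s \<le> t \<Longrightarrow> t \<le> T \<Longrightarrow> t - s < \<delta> \<Longrightarrow>
          norm (D t - D s) \<le> \<epsilon> * (integral {0..t} n - integral {0..s} n)"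
        by blast
      then show "\<exists>\<delta>>0. \<forall>s ta. 0 \<le> s \<longrightarrow> s \<le> ta \<longrightarrow> ta \<le> t \<longrightarrow> ta - s < \<delta> \<longrightarrow>
          norm (D ta - D s) \<le> \<epsilon> * (integral {0..ta} n - integral {0..s} n)"
        using t by (intro exI[of _ \<delta>]) (auto intro!: \<delta>)
    qed (use t in auto)
    then show "pr (x t) (y t) = pr (x 0) (y 0) + integral {0..t} h"
      by (simp add: D_def algebra_simps)
  qed
qed

text \<open>After the last time \<open>a\<close> with \<open>\<psi> a \<le> 1\<close>, continuity
  keeps \<open>\<psi>\<close> in the shell between 1 and 2 for a while. There \<open>h\<close> is
  nonpositive almost everywhere, so \<open>\<psi>\<close> cannot have risen above 1.\<close>

lemma primitive_on_barrier:
  fixes \<psi> :: "real \<Rightarrow> real"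
  assumes p: "primitive_on T h \<psi>" and T: "0 \<le> T" and 0: "\<psi> 0 \<le> 1"
    and N: "negligible N"
    and h: "\<And>s. s \<in> {0..T} - N \<Longrightarrow> 1 \<le> \<psi> s \<Longrightarrow> \<psi> s \<le> 2 \<Longrightarrow> h s \<le> 0"
  shows "\<psi> T \<le> 1"
proof (rule ccontr)
  assume gt: "\<not> \<psi> T \<le> 1"
  note c = primitive_on_continuous[OF p]
  define S where "S = {s \<in> {0..T}. \<psi> s \<le> 1}"
  have "closed S"
    unfolding S_def by (rule continuous_on_closed_Collect_le[OF c continuous_on_const closed_atLeastAtMost])
  moreover have "bounded S"
    by (rule bounded_subset[OF bounded_closed_interval[of 0 T]]) (auto simp: S_def)
  ultimately have "compact S"
    by (simp add: compact_eq_bounded_closed)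
  moreover have "0 \<in> S" using 0 T by (simp add: S_def)
  ultimately obtain a where a: "a \<in> S" "\<And>s. s \<in> S \<Longrightarrow> s \<le> a"
    using compact_attains_sup[of S] by blast
  have aT: "0 \<le> a" "a < T" "\<psi> a \<le> 1"
    using a(1) gt unfolding S_def by (auto simp: less_le)
  have gt1: "\<psi> s > 1" if "a < s" "s \<le> T" for s
    using a(2)[of s] that aT by (force simp: S_def)
  obtain d where d: "d > 0" "\<And>s. s \<in> {0..T} \<Longrightarrow> dist s a < d \<Longrightarrow> dist (\<psi> s) (\<psi> a) < 1"
  proof -
    have "a \<in> {0..T}" using aT by simp
    with c have "\<exists>d>0. \<forall>s\<in>{0..T}. dist s a < d \<longrightarrow> dist (\<psi> s) (\<psi> a) < 1"
      unfolding continuous_on_iff by (auto simp del: atLeastAtMost_iff)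
    then show ?thesis using that by blast
  qed
  define b where "b = min T (a + d / 2)"
  have b: "a < b" "b \<le> T" "b - a < d" using aT d by (auto simp: b_def)
  have le2: "\<psi> s \<le> 2" if "s \<in> {a..b}" for s
    using d(2)[of s] that b aT by (force simp: dist_real_def)
  \<comment> \<open>At \<open>a\<close> itself only \<open>\<psi> a \<le> 1\<close> is known, so
    \<open>a\<close> joins the null set.\<close>
  have "integral {a..b} h = integral {a..b} (\<lambda>s. if s \<in> insert a N then 0 else h s)"
    by (rule integral_spike[of "insert a N"]) (use N in auto)
  moreover have "integral {a..b} (\<lambda>s. if s \<in> insert a N then 0 else h s) \<le> integral {a..b} (\<lambda>s. 0)"
  proof (rule integral_le)
    show "(\<lambda>s. if s \<in> insert a N then 0 else h s) integrable_on {a..b}"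
      by (rule integrable_spike[OF primitive_on_integrable(2)[OF p, of a b], of "insert a N"]) (use N aT b in auto)
    show "(if s \<in> insert a N then 0 else h s) \<le> 0" if "s \<in> {a..b}" for s
      using h[of s] gt1[of s] le2[OF that] that aT b by auto
  qed (rule integrable_0)
  moreover have "\<psi> b - \<psi> a = integral {a..b} h"
    using primitive_on_increment[OF p] aT b by auto
  ultimately have "\<psi> b \<le> 1" using aT by simp
  with gt1[of b] b show False by auto
qed

section \<open>Weighted inner products and dilations\<close>

text \<open>The constant is the minimum of the quadratic form on the compact unit sphere; scaling
  extends the bound to all vectors.\<close>

lemma pos_def_coercive:
  assumes "pos_def M"
  obtains c where "c > 0" "\<And>x. c * (norm x)\<^sup>2 \<le> x \<bullet> (M *v x)"
proof -
  obtain b :: "real^'a" where "norm b = 1" using vector_choose_size[of 1] by auto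
  then have ne: "sphere (0::real^'a) 1 \<noteq> {}" by auto
  have "\<exists>u\<in>sphere 0 1. \<forall>x\<in>sphere 0 1. u \<bullet> (M *v u) \<le> x \<bullet> (M *v x)"
    by (rule continuous_attains_inf[OF compact_sphere ne])
       (intro continuous_intros linear_continuous_on matrix_vector_mul_bounded_linear)
  then obtain u where u: "norm u = 1" "\<And>x. norm x = 1 \<Longrightarrow> u \<bullet> (M *v u) \<le> x \<bullet> (M *v x)"
    by auto
  show thesis
  proof
    show "u \<bullet> (M *v u) > 0" using assms u(1) unfolding pos_def_def by (metis norm_zero zero_neq_one)
    fix x :: "real^'a"
    show "u \<bullet> (M *v u) * (norm x)\<^sup>2 \<le> x \<bullet> (M *v x)"
    proof (cases "x = 0")
      case False
      then have "u \<bullet> (M *v u) \<le> (x /\<^sub>R norm x) \<bullet> (M *v (x /\<^sub>R norm x))"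
        by (intro u(2)) simp
      also have "\<dots> = (x \<bullet> (M *v x)) / (norm x)\<^sup>2"
        by (simp add: matrix_vector_mult_scaleR power2_eq_square field_simps)
      finally show ?thesis using False by (simp add: field_simps)
    qed simp
  qed
qed

locale pd_matrix =
  fixes P :: "real^'n^'n"
  assumes pd: "pos_def P"
begin

abbreviation ip :: "real^'n \<Rightarrow> real^'n \<Rightarrow> real" where "ip x y \<equiv> x \<bullet> (P *v y)"
abbreviation nrm :: "real^'n \<Rightarrow> real" where "nrm \<equiv> wnorm P"

lemma ip_commute: "ip x y = ip y x"
proof -
  have "ip x y = (transpose P *v x) \<bullet> y" by (simp add: dot_lmul_matrix)
  also have "transpose P = P" using pd by (simp add: pos_def_def)
  finally show ?thesis by (simp add: inner_commute)
qed

lemmas ip_simps = inner_add_left inner_add_right inner_diff_left inner_diff_right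
  matrix_vector_right_distrib matrix_vector_mult_diff_distrib matrix_vector_mult_scaleR

lemma ip_sum_right: "ip x (\<Sum>i\<in>I. f i) = (\<Sum>i\<in>I. ip x (f i))"
  using linear_sum[OF matrix_vector_mul_linear[of P], of f I] by (simp add: inner_sum_right o_def)

lemma ip_nonneg: "0 \<le> ip x x"
  using pd unfolding pos_def_def by (cases "x = 0") (auto simp: less_imp_le)

lemma nrm_sq: "(nrm x)\<^sup>2 = ip x x"
  by (simp add: wnorm_def ip_nonneg)

lemma nrm_nonneg [simp]: "0 \<le> nrm x"
  by (simp add: wnorm_def ip_nonneg)

lemma nrm_0 [simp]: "nrm 0 = 0"
  by (simp add: wnorm_def)

lemma nrm_pos: "x \<noteq> 0 \<Longrightarrow> 0 < nrm x"
  using pd unfolding pos_def_def by (simp add: wnorm_def)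

text \<open>Cauchy-Schwarz: the square of \<open>x\<close> minus its \<open>ip\<close>-orthogonal
  projection \<open>a *\<^sub>R y\<close> is nonnegative.\<close>

lemma ip_le_nrm: "\<bar>ip x y\<bar> \<le> nrm x * nrm y"
proof (cases "y = 0")
  case False
  then have y: "ip y y > 0" using pd unfolding pos_def_def by blast
  define a where "a = ip x y / ip y y"
  have "0 \<le> ip (x - a *\<^sub>R y) (x - a *\<^sub>R y)" by (rule ip_nonneg)
  also have "\<dots> = ip x x - 2 * a * ip x y + a * a * ip y y"
    using ip_commute[of y x] by (simp add: ip_simps algebra_simps)
  also have "\<dots> = ip x x - (ip x y)\<^sup>2 / ip y y"
    using y by (simp add: a_def power2_eq_square field_simps)
  finally have "(ip x y)\<^sup>2 \<le> ip x x * ip y y"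
    using y by (simp add: field_simps)
  then have "(ip x y)\<^sup>2 \<le> (nrm x * nrm y)\<^sup>2"
    by (simp add: power_mult_distrib nrm_sq)
  then show ?thesis
    by (rule abs_le_square_iff[THEN iffD2, THEN order_trans]) simp
qed simp

lemma nrm_triangle: "nrm (x + y) \<le> nrm x + nrm y"
proof (rule power2_le_imp_le)
  have "(nrm (x + y))\<^sup>2 = (nrm x)\<^sup>2 + 2 * ip x y + (nrm y)\<^sup>2"
    using ip_commute[of y x] by (simp add: nrm_sq ip_simps)
  also have "\<dots> \<le> (nrm x + nrm y)\<^sup>2"
    using ip_le_nrm[of x y] by (simp add: power2_sum)
  finally show "(nrm (x + y))\<^sup>2 \<le> (nrm x + nrm y)\<^sup>2" .
qed simp

lemma nrm_scaleR [simp]: "nrm (a *\<^sub>R x) = \<bar>a\<bar> * nrm x"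
  by (simp add: wnorm_def matrix_vector_mult_scaleR real_sqrt_mult mult.assoc[symmetric])

lemma nrm_minus [simp]: "nrm (- x) = nrm x"
  using nrm_scaleR[of "-1" x] by simp

lemma nrm_diff: "nrm (x - y) \<le> nrm x + nrm y"
  using nrm_triangle[of x "- y"] by simp

lemma nrm_sum: "nrm (\<Sum>i\<in>I. f i) \<le> (\<Sum>i\<in>I. nrm (f i))"
proof (induction I rule: infinite_finite_induct)
  case (insert i I)
  then show ?case using nrm_triangle[of "f i" "sum f I"] by simp
qed auto

lemma continuous_on_nrm [continuous_intros]:
  "continuous_on S f \<Longrightarrow> continuous_on S (\<lambda>s. nrm (f s))"
  unfolding wnorm_def
  by (intro continuous_intros bounded_linear.continuous_on[OF matrix_vector_mul_bounded_linear])

lemma tendsto_nrm: "(f \<longlongrightarrow> l) F \<Longrightarrow> ((\<lambda>s. nrm (f s)) \<longlongrightarrow> nrm l) F"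
  unfolding wnorm_def
  by (intro tendsto_intros bounded_linear.tendsto[OF matrix_vector_mul_bounded_linear])

lemma nrm_le_norm:
  obtains K where "K \<ge> 0" "\<And>y :: real^'q. nrm (M *v y) \<le> K * norm y"
proof -
  let ?S = "sphere (0::real^'q) 1"
  obtain b :: "real^'q" where "norm b = 1" using vector_choose_size[of 1] by auto
  then have ne: "?S \<noteq> {}" by auto
  have "\<exists>u\<in>?S. \<forall>x\<in>?S. nrm (M *v x) \<le> nrm (M *v u)"
    by (rule continuous_attains_sup[OF compact_sphere ne])
       (intro continuous_intros linear_continuous_on matrix_vector_mul_bounded_linear)
  then obtain u where u: "\<And>x. norm x = 1 \<Longrightarrow> nrm (M *v x) \<le> nrm (M *v u)"
    by (metis mem_sphere_0)
  show thesis
  proof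
    fix y :: "real^'q"
    show "nrm (M *v y) \<le> nrm (M *v u) * norm y"
    proof (cases "y = 0")
      case False
      then have "nrm (M *v (y /\<^sub>R norm y)) \<le> nrm (M *v u)" by (intro u) simp
      then show ?thesis using False by (simp add: matrix_vector_mult_scaleR field_simps)
    qed simp
  qed simp
qed

lemma norm_le_nrm:
  obtains c where "c > 0" "\<And>x. norm x \<le> c * nrm x"
proof -
  obtain c where c: "c > 0" "\<And>x. c * (norm x)\<^sup>2 \<le> ip x x"
    using pos_def_coercive[OF pd] by blast
  have "norm x \<le> 1 / sqrt c * nrm x" for x
  proof -
    have "sqrt (c * (norm x)\<^sup>2) \<le> nrm x" unfolding wnorm_def using c(2) by (rule real_sqrt_le_mono)
    then show ?thesis using c(1) by (simp add: real_sqrt_mult field_simps)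
  qed
  then show thesis using c(1) by (intro that[of "1 / sqrt c"]) auto
qed

lemma norm_mult_le_nrm:
  obtains K where "K \<ge> 0" "\<And>x. norm ((M :: real^'n^'q) *v x) \<le> K * nrm x"
proof -
  obtain c where c: "c > 0" "\<And>x. norm x \<le> c * nrm x" using norm_le_nrm by blast
  have "norm (M *v x) \<le> onorm ((*v) M) * c * nrm x" for x
  proof -
    have "norm (M *v x) \<le> onorm ((*v) M) * norm x" by (rule onorm) simp
    also have "\<dots> \<le> onorm ((*v) M) * (c * nrm x)"
      using c by (intro mult_left_mono onorm_pos_le) auto
    finally show ?thesis by simp
  qed
  moreover have "0 \<le> onorm ((*v) M) * c"
    using c(1) onorm_pos_le[OF matrix_vector_mul_bounded_linear[of M]] by simp
  ultimately show thesis by (intro that)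
qed

lemma nrm_mult_le_nrm:
  obtains K where "K \<ge> 0" "\<And>x. nrm (M *v x) \<le> K * nrm x"
proof -
  obtain c where c: "c > 0" "\<And>x. norm x \<le> c * nrm x" using norm_le_nrm by blast
  obtain K where K: "K \<ge> 0" "\<And>x. nrm (M *v x) \<le> K * norm x" using nrm_le_norm by blast
  have "nrm (M *v x) \<le> K * c * nrm x" for x
    using K(2)[of x] mult_left_mono[OF c(2) K(1), of x] by simp
  then show thesis using c K by (intro that[of "K * c"]) auto
qed

text \<open>Removing the term of index 0 from the exponential series leaves a tail dominated by the
  series of \<open>exp k - 1\<close>. This factor vanishes with \<open>k\<close>, which is how small
  \<open>\<mu>\<close> enters.\<close>

lemma nrm_mexp_diff:
  assumes k: "\<And>x. nrm (M *v x) \<le> k * nrm x" "k \<ge> 0"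
  shows "nrm (mexp M *v x - x) \<le> (exp k - 1) * nrm x"
proof -
  have pw: "nrm (matpow M j *v x) \<le> k ^ j * nrm x" for j
  proof (induction j)
    case (Suc j)
    have "nrm (matpow M (Suc j) *v x) \<le> k * nrm (matpow M j *v x)"
      using k(1) by (simp add: matpow_Suc matrix_vector_mul_assoc[symmetric])
    also have "\<dots> \<le> k * (k ^ j * nrm x)" using Suc k(2) by (intro mult_left_mono)
    finally show ?case by simp
  qed simp
  have "(\<lambda>j. (matpow M j /\<^sub>R fact j) *v x) sums (mexp M *v x)"
    by (rule bounded_linear.sums[OF bounded_bilinear.bounded_linear_left[OF bounded_bilinear_matrix_vector_mult] mexp_sums])
  then have "(\<lambda>j. (matpow M (Suc j) /\<^sub>R fact (Suc j)) *v x) sums (mexp M *v x - x)"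
    by (intro sums_Suc_iff[where f = "\<lambda>j. (matpow M j /\<^sub>R fact j) *v x", THEN iffD2]) simp
  then have 1: "(\<lambda>n. nrm (\<Sum>j<n. (matpow M (Suc j) /\<^sub>R fact (Suc j)) *v x)) \<longlonglongrightarrow> nrm (mexp M *v x - x)"
    unfolding sums_def by (rule tendsto_nrm)
  have "(\<lambda>j. k ^ j /\<^sub>R fact j) sums exp k" by (rule exp_converges)
  then have e: "(\<lambda>j. k ^ Suc j /\<^sub>R fact (Suc j)) sums (exp k - 1)"
    by (intro sums_Suc_iff[where f = "\<lambda>j. k ^ j /\<^sub>R fact j", THEN iffD2]) simp
  have "nrm (\<Sum>j<n. (matpow M (Suc j) /\<^sub>R fact (Suc j)) *v x) \<le> (exp k - 1) * nrm x" for n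
  proof -
    have "nrm (\<Sum>j<n. (matpow M (Suc j) /\<^sub>R fact (Suc j)) *v x)
        \<le> (\<Sum>j<n. nrm ((matpow M (Suc j) /\<^sub>R fact (Suc j)) *v x))" by (rule nrm_sum)
    also have "\<dots> \<le> (\<Sum>j<n. k ^ Suc j /\<^sub>R fact (Suc j) * nrm x)"
    proof (rule sum_mono)
      fix j
      show "nrm ((matpow M (Suc j) /\<^sub>R fact (Suc j)) *v x) \<le> k ^ Suc j /\<^sub>R fact (Suc j) * nrm x"
        using mult_left_mono[OF pw[of "Suc j"], of "inverse (fact (Suc j))"]
        by (simp add: scaleR_matrix_vector_assoc[symmetric] mult.assoc del: power_Suc fact_Suc)
    qed
    also have "\<dots> = (\<Sum>j<n. k ^ Suc j /\<^sub>R fact (Suc j)) * nrm x"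
      by (simp add: sum_distrib_right)
    also have "\<dots> \<le> (exp k - 1) * nrm x"
      using k(2) sum_le_suminf[OF sums_summable[OF e], of "{..<n}"] sums_unique[OF e]
      by (intro mult_right_mono) auto
    finally show ?thesis .
  qed
  then show ?thesis
    by (intro LIMSEQ_le_const2[OF 1]) auto
qed

lemma nrm_mexp_le:
  assumes k: "\<And>x. nrm (M *v x) \<le> k * nrm x" "k \<ge> 0"
  shows "nrm (mexp M *v x) \<le> exp k * nrm x"
proof -
  have "nrm (mexp M *v x) \<le> nrm (mexp M *v x - x) + nrm x"
    using nrm_triangle[of "mexp M *v x - x" x] by simp
  with nrm_mexp_diff[OF k, of x] show ?thesis by (simp add: algebra_simps)
qed

end

section \<open>Dilations of small degree and the deviation of the nonlinear terms from linear
  ones\<close>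

lemma abs_exp_minus_one_le: "\<bar>exp y - 1\<bar> \<le> exp \<bar>y\<bar> - (1::real)"
proof (cases "y \<ge> 0")
  case False
  have "1 + y \<le> exp y" "1 + (- y) \<le> exp (- y)" by (rule exp_ge_add_one_self)+
  moreover have "exp y < 1" using False by simp
  ultimately show ?thesis using False by linarith
qed simp

text \<open>The quantitative form of \<open>x powr m \<longrightarrow> 1\<close>, uniform on
  \<open>[0, R]\<close> after multiplication by \<open>x\<close>. Near 0,
  \<open>m \<le> 1 / 2\<close> limits the exponential to \<open>1 / sqrt x\<close> and the logarithm
  is at most \<open>2 / sqrt x\<close>, so the factor \<open>x\<close> absorbs both. Beyond 1, the
  logarithm and the exponential are each at most \<open>x\<close>.\<close>

lemma exp_log_minus_one_mult_le:
  assumes m: "0 \<le> m" "m \<le> 1 / 2" and x: "0 \<le> x" "x \<le> (R::real)"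
  shows "(exp (m * \<bar>ln x\<bar>) - 1) * x \<le> m * (2 + R ^ 3)"
proof (cases "x = 0")
  case True
  then show ?thesis using m x by simp
next
  case False
  with x have x0: "x > 0" by simp
  define y where "y = m * \<bar>ln x\<bar>"
  have y: "y \<ge> 0" using m by (simp add: y_def)
  have "1 + (- y) \<le> exp (- y)" by (rule exp_ge_add_one_self)
  then have "(1 - y) * exp y \<le> exp (- y) * exp y" by (intro mult_right_mono) auto
  then have "exp y - 1 \<le> y * exp y" by (simp add: exp_minus algebra_simps)
  then have "(exp y - 1) * x \<le> y * exp y * x" using x0 by (intro mult_right_mono) auto
  also have "\<dots> = m * (\<bar>ln x\<bar> * exp y * x)" by (simp add: y_def)
  also have "\<bar>ln x\<bar> * exp y * x \<le> 2 + R ^ 3"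
  proof (cases "x \<le> 1")
    case True
    have l: "ln x \<le> 0" using True x0 by simp
    have s: "sqrt x > 0" using x0 by simp
    have "y \<le> \<bar>ln x\<bar> / 2" unfolding y_def using m mult_right_mono[of m "1/2" "\<bar>ln x\<bar>"] by simp
    then have "exp y \<le> exp (ln (1 / sqrt x))"
      using l x0 by (simp add: ln_div ln_sqrt)
    then have e: "exp y \<le> 1 / sqrt x" using s by (subst (asm) exp_ln) auto
    have "ln (1 / sqrt x) \<le> 1 / sqrt x - 1"
      using s by (intro ln_le_minus_one) auto
    then have a: "\<bar>ln x\<bar> \<le> 2 / sqrt x" using l x0 by (simp add: ln_div ln_sqrt)
    have "\<bar>ln x\<bar> * exp y * x \<le> 2 / sqrt x * (1 / sqrt x) * x"
      using a e x0 s by (intro mult_mono) auto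
    also have "\<dots> = 2" using x0 s by (simp add: field_simps)
    finally show ?thesis using zero_le_power[of R 3] x by linarith
  next
    case False
    then have l: "ln x \<ge> 0" "ln x \<le> x" using ln_le_minus_one[OF x0] by auto
    have "y \<le> ln x" unfolding y_def using m l mult_right_mono[of m 1 "ln x"] by simp
    then have "exp y \<le> x" using x0 by (metis exp_le_cancel_iff exp_ln)
    then have "\<bar>ln x\<bar> * exp y * x \<le> x * x * x"
      using l x0 by (intro mult_mono) auto
    also have "\<dots> = x ^ 3" by (simp add: power3_eq_cube)
    also have "\<dots> \<le> R ^ 3" using x by (intro power_mono) auto
    finally show ?thesis by simp
  qed
  finally show ?thesis using m by (simp add: y_def mult_left_mono)
qed

text \<open>The smallness makes \<open>\<mu> G0\<close> a perturbation of size at most 1/2 of the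
  identity in the generator. For \<open>s \<ge> 0\<close> the dilation then expands lengths by a
  factor between \<open>exp (s / 2)\<close> and \<open>exp (3 * s / 2)\<close>, which yields
  monotonicity and the existence of homogeneous norms.\<close>

locale small_dilation = pd_matrix P for P :: "real^'n^'n" +
  fixes G0 :: "real^'n^'n" and \<mu> K :: real
  assumes G0_bound: "\<And>x. nrm (G0 *v x) \<le> K * nrm x" and K_nonneg: "K \<ge> 0"
    and small: "\<bar>\<mu>\<bar> * K \<le> 1 / 2"
begin

abbreviation d :: "real \<Rightarrow> real^'n^'n" where "d \<equiv> dilation (dil_gen \<mu> G0)"
abbreviation hn :: "real^'n \<Rightarrow> real" where "hn \<equiv> agent_hnorm \<mu> G0 P"

lemma d_0 [simp]: "d 0 = mat 1"
  by (simp add: dilation_def)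

lemma d_add: "d (s + t) *v x = d s *v (d t *v x)"
  by (simp add: dilation_def mexp_add matrix_vector_mul_assoc)

lemma d_inverse [simp]: "d s *v (d (- s) *v x) = x" "d (- s) *v (d s *v x) = x"
  using d_add[of s "- s" x] d_add[of "- s" s x] by auto

lemma d_eq: "d s = exp s *\<^sub>R mexp ((s * \<mu>) *\<^sub>R G0)"
  using mexp_add_scalar[of "(s * \<mu>) *\<^sub>R G0" s]
  by (simp add: dilation_def dil_gen_def scaleR_right_distrib)

lemma nrm_mexp_G0: "nrm (mexp (r *\<^sub>R G0) *v x) \<le> exp (\<bar>r\<bar> * K) * nrm x"
proof (rule nrm_mexp_le)
  show "nrm ((r *\<^sub>R G0) *v x) \<le> \<bar>r\<bar> * K * nrm x" for x
    using mult_left_mono[OF G0_bound, of "\<bar>r\<bar>" x]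
    by (simp add: scaleR_matrix_vector_assoc[symmetric] mult.assoc)
qed (use K_nonneg in auto)

lemma nrm_d_le: "nrm (d s *v x) \<le> exp (s + \<bar>s\<bar> * (\<bar>\<mu>\<bar> * K)) * nrm x"
  using mult_left_mono[OF nrm_mexp_G0[of "s * \<mu>" x], of "exp s"]
  by (simp add: d_eq scaleR_matrix_vector_assoc[symmetric] exp_add abs_mult mult_ac)

lemma nrm_d_ge: "exp (s - \<bar>s\<bar> * (\<bar>\<mu>\<bar> * K)) * nrm x \<le> nrm (d s *v x)"
proof -
  have "nrm x \<le> exp (- (s - \<bar>s\<bar> * (\<bar>\<mu>\<bar> * K))) * nrm (d s *v x)"
    using nrm_d_le[of "- s" "d s *v x"] by simp
  then have "exp (s - \<bar>s\<bar> * (\<bar>\<mu>\<bar> * K)) * nrm x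
      \<le> exp (s - \<bar>s\<bar> * (\<bar>\<mu>\<bar> * K)) * (exp (- (s - \<bar>s\<bar> * (\<bar>\<mu>\<bar> * K))) * nrm (d s *v x))"
    by (intro mult_left_mono) auto
  then show ?thesis by (simp only: mult.assoc[symmetric] exp_add[symmetric]) simp
qed

lemma abs_mult_small: "\<bar>s\<bar> * (\<bar>\<mu>\<bar> * K) \<le> \<bar>s\<bar> / 2"
  using mult_left_mono[OF small, of "\<bar>s\<bar>"] by simp

lemma nrm_d_half_le: "nrm (d s *v x) \<le> exp (s + \<bar>s\<bar> / 2) * nrm x"
  using abs_mult_small[of s] by (intro order_trans[OF nrm_d_le] mult_right_mono) auto

lemma nrm_d_half_ge: "exp (s - \<bar>s\<bar> / 2) * nrm x \<le> nrm (d s *v x)"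
  using abs_mult_small[of s] by (intro order_trans[OF _ nrm_d_ge] mult_right_mono) auto

lemma nrm_d_strict_antimono:
  assumes "x \<noteq> 0" "s < t"
  shows "nrm (d (- t) *v x) < nrm (d (- s) *v x)"
proof -
  have "x = d t *v (d (- t) *v x)" by simp
  then have "d (- t) *v x \<noteq> 0" using assms(1) by force
  then have p: "nrm (d (- t) *v x) > 0" by (rule nrm_pos)
  have "d (- s) *v x = d (t - s) *v (d (- t) *v x)"
    using d_add[of "t - s" "- t" x] by simp
  then have "exp ((t - s) - \<bar>t - s\<bar> / 2) * nrm (d (- t) *v x) \<le> nrm (d (- s) *v x)"
    using nrm_d_half_ge by simp
  moreover have "exp ((t - s) - \<bar>t - s\<bar> / 2) > 1" using assms(2) by simp
  then have "1 * nrm (d (- t) *v x) < exp ((t - s) - \<bar>t - s\<bar> / 2) * nrm (d (- t) *v x)"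
    using p by (intro mult_strict_right_mono)
  ultimately show ?thesis by simp
qed

lemma d_has_vector_derivative:
  "(d has_vector_derivative (dil_gen \<mu> G0 ** d s)) (at s within S)"
  unfolding dilation_def by (rule mexp_has_vector_derivative)

lemma continuous_on_d: "continuous_on S d"
  by (rule continuous_on_vector_derivative[OF d_has_vector_derivative])

lemma hom_norm_exists:
  assumes "x \<noteq> 0"
  obtains s where "nrm (d (- s) *v x) = 1"
proof -
  \<comment> \<open>The factor \<open>exp (c / 2)\<close> equals
    \<open>exp \<bar>ln (nrm x)\<bar>\<close>, enough to carry \<open>nrm x\<close> across 1 in
    either direction, so the intermediate value theorem applies on \<open>[- c, c]\<close>.\<close>
  define c where "c = 2 * \<bar>ln (nrm x)\<bar>"
  have p: "nrm x > 0" using assms by (rule nrm_pos)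
  have "nrm (d (- c) *v x) \<le> exp (- c / 2) * nrm x"
    using nrm_d_half_le[of "- c" x] by (simp add: c_def)
  also have "\<dots> = exp (- \<bar>ln (nrm x)\<bar> + ln (nrm x))"
    using p by (simp add: c_def exp_add exp_diff exp_minus field_simps)
  also have "\<dots> \<le> 1" by simp
  finally have 1: "nrm (d (- c) *v x) \<le> 1" .
  have "1 \<le> exp (\<bar>ln (nrm x)\<bar> + ln (nrm x))" by simp
  also have "\<dots> = exp (c / 2) * nrm x"
    using p by (simp add: c_def exp_add)
  also have "\<dots> \<le> nrm (d (- (- c)) *v x)"
    using nrm_d_half_ge[of c x] by (simp add: c_def)
  finally have 2: "1 \<le> nrm (d (- (- c)) *v x)" .
  have "\<exists>s\<ge>- c. s \<le> c \<and> nrm (d (- s) *v x) = 1"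
  proof (rule IVT2'[of "\<lambda>s. nrm (d (- s) *v x)"])
    show "continuous_on {- c..c} (\<lambda>s. nrm (d (- s) *v x))"
      by (intro continuous_on_nrm
          bounded_linear.continuous_on[OF bounded_bilinear.bounded_linear_left[OF bounded_bilinear_matrix_vector_mult]]
          continuous_on_compose2[OF continuous_on_d[of UNIV]] continuous_intros) auto
  qed (use 1 2 in \<open>auto simp: c_def\<close>)
  then show thesis using that by blast
qed

text \<open>Strict monotonicity makes the definite description in \<open>hom_norm\<close>
  unambiguous, so any witness determines it.\<close>

lemma hn_eqI:
  assumes "x \<noteq> 0" "nrm (d (- s) *v x) = 1"
  shows "hn x = exp s"
proof -
  have "(THE s. nrm (d (- s) *v x) = 1) = s"
  proof (rule the_equality)
    fix t assume "nrm (d (- t) *v x) = 1"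
    then show "t = s"
      using nrm_d_strict_antimono[OF assms(1), of s t] nrm_d_strict_antimono[OF assms(1), of t s] assms(2)
      by (cases s t rule: linorder_cases) auto
  qed (rule assms(2))
  then show ?thesis using assms(1) by (simp add: agent_hnorm_def hom_norm_def)
qed

lemma hn_0 [simp]: "hn 0 = 0"
  by (simp add: agent_hnorm_def hom_norm_def)

text \<open>Homogeneous polar coordinates. The bound on \<open>s\<close> comes from taking
  logarithms in the two-sided estimate of \<open>nrm (d s *v u)\<close>; through it powers of
  \<open>hn x\<close> are controlled by \<open>\<bar>ln (nrm x)\<bar>\<close>.\<close>

lemma hn_cases:
  assumes "x \<noteq> 0"
  obtains s u where "hn x = exp s" "x = d s *v u" "nrm u = 1" "\<bar>s\<bar> \<le> 2 * \<bar>ln (nrm x)\<bar>"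
proof -
  obtain s where s: "nrm (d (- s) *v x) = 1" using hom_norm_exists[OF assms] .
  have x: "x = d s *v (d (- s) *v x)" by simp
  have "exp (s - \<bar>s\<bar> / 2) \<le> nrm x" "nrm x \<le> exp (s + \<bar>s\<bar> / 2)"
    using nrm_d_half_ge[of s "d (- s) *v x"] nrm_d_half_le[of s "d (- s) *v x"] s by auto
  moreover have "nrm x = exp (ln (nrm x))" using nrm_pos[OF assms] by simp
  ultimately have "s - \<bar>s\<bar> / 2 \<le> ln (nrm x)" "ln (nrm x) \<le> s + \<bar>s\<bar> / 2"
    by (metis exp_le_cancel_iff)+
  then have "\<bar>s\<bar> \<le> 2 * \<bar>ln (nrm x)\<bar>" by auto
  with that[of s "d (- s) *v x"] s x hn_eqI[OF assms s] show thesis by blast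
qed

lemma hn_dilate: "hn (d s *v x) = exp s * hn x"
proof (cases "x = 0")
  case False
  obtain t where t: "nrm (d (- t) *v x) = 1" using hom_norm_exists[OF False] .
  have "d s *v x \<noteq> 0" using False d_inverse(2)[of s x] by force
  moreover have "nrm (d (- (s + t)) *v (d s *v x)) = 1"
    using t d_add[of "- (s + t)" s x] by simp
  ultimately have "hn (d s *v x) = exp (s + t)" by (rule hn_eqI)
  then show ?thesis using hn_eqI[OF False t] by (simp add: exp_add)
qed simp

text \<open>By polar coordinates the factor \<open>hn \<theta> powr \<mu>\<close> differs from 1 by
  at most \<open>exp (2 * \<bar>\<mu>\<bar> * \<bar>ln (nrm \<theta>)\<bar>) - 1\<close>, and the
  factor \<open>\<theta>\<close> absorbs the singularity at 0. On bounded sets the coupling thus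
  becomes linear as \<open>\<mu> \<longrightarrow> 0\<close>.\<close>

lemma theta_term_deviation:
  assumes "\<bar>\<mu>\<bar> \<le> 1 / 4" "nrm \<theta> \<le> R"
  shows "nrm ((hn \<theta> powr \<mu>) *\<^sub>R \<theta> - \<theta>) \<le> 2 * \<bar>\<mu>\<bar> * (2 + R ^ 3)"
proof (cases "\<theta> = 0")
  case True
  then show ?thesis using assms(2) by simp
next
  case False
  obtain s u where s: "hn \<theta> = exp s" "\<bar>s\<bar> \<le> 2 * \<bar>ln (nrm \<theta>)\<bar>"
    and "\<theta> = d s *v u" "nrm u = 1"
    using hn_cases[OF False] .
  have "hn \<theta> powr \<mu> = exp (\<mu> * s)" using s(1) by (simp add: powr_def)
  moreover have "\<bar>\<mu> * s\<bar> \<le> 2 * \<bar>\<mu>\<bar> * \<bar>ln (nrm \<theta>)\<bar>"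
    using mult_left_mono[OF s(2), of "\<bar>\<mu>\<bar>"] by (simp add: abs_mult)
  ultimately have "\<bar>hn \<theta> powr \<mu> - 1\<bar> \<le> exp (2 * \<bar>\<mu>\<bar> * \<bar>ln (nrm \<theta>)\<bar>) - 1"
    using abs_exp_minus_one_le[of "\<mu> * s"] by (simp add: order_trans[OF _ diff_right_mono])
  then have "\<bar>hn \<theta> powr \<mu> - 1\<bar> * nrm \<theta> \<le> (exp (2 * \<bar>\<mu>\<bar> * \<bar>ln (nrm \<theta>)\<bar>) - 1) * nrm \<theta>"
    by (rule mult_right_mono) simp
  also have "\<dots> \<le> 2 * \<bar>\<mu>\<bar> * (2 + R ^ 3)"
    using assms by (intro exp_log_minus_one_mult_le) auto
  finally show ?thesis
    using nrm_scaleR[of "hn \<theta> powr \<mu> - 1" \<theta>] by (simp add: scaleR_left_diff_distrib)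
qed

text \<open>Here the gain is the exponential of a matrix of size at most
  \<open>\<bar>\<mu>\<bar> * K1 * \<bar>ln (norm \<omega>)\<bar>\<close>; its blow-up at 0 is
  absorbed by the factor \<open>\<omega>\<close>.\<close>

lemma g_term_deviation:
  assumes K1: "\<And>x. nrm ((G0 + mat 1) *v x) \<le> K1 * nrm x" "K1 \<ge> 0"
    and h: "\<And>y. nrm (H *v y) \<le> h * norm y" "h \<ge> 0"
    and m: "\<bar>\<mu>\<bar> * K1 \<le> 1 / 2" and R: "norm \<omega> \<le> R"
  shows "nrm (g_fun \<mu> G0 (norm \<omega>) *v (H *v \<omega>) - H *v \<omega>) \<le> h * (\<bar>\<mu>\<bar> * K1 * (2 + R ^ 3))"
proof -
  let ?k = "\<bar>\<mu>\<bar> * K1 * \<bar>ln (norm \<omega>)\<bar>"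
  have "nrm (g_fun \<mu> G0 (norm \<omega>) *v (H *v \<omega>) - H *v \<omega>) \<le> (exp ?k - 1) * nrm (H *v \<omega>)"
    unfolding g_fun_def
  proof (rule nrm_mexp_diff)
    show "nrm (((\<mu> * ln (norm \<omega>)) *\<^sub>R (G0 + mat 1)) *v x) \<le> ?k * nrm x" for x
      using mult_left_mono[OF K1(1)[of x], of "\<bar>\<mu> * ln (norm \<omega>)\<bar>"]
      by (simp add: scaleR_matrix_vector_assoc[symmetric] abs_mult mult_ac)
  qed (use K1 in auto)
  also have "\<dots> \<le> (exp ?k - 1) * (h * norm \<omega>)"
    using h K1 by (intro mult_left_mono) auto
  also have "\<dots> = h * ((exp ?k - 1) * norm \<omega>)" by simp
  also have "\<dots> \<le> h * (\<bar>\<mu>\<bar> * K1 * (2 + R ^ 3))"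
    using h K1 m R by (intro mult_left_mono exp_log_minus_one_mult_le) auto
  finally show ?thesis .
qed

text \<open>Turns the homogeneous growth bound into a linear one whose leading coefficient is
  exactly \<open>\<tau>\<close>; only the remainder carries \<open>\<mu>\<close>. This keeps the
  margin in \<open>\<tau> < \<rho> / 3\<close> usable.\<close>

lemma gamma_term_deviation:
  assumes m: "\<bar>\<mu>\<bar> * (2 * (2 * K + 1)) \<le> 1 / 2" and R: "nrm z \<le> R" and \<tau>: "\<tau> \<ge> 0" and z: "z \<noteq> 0"
    and w: "nrm (d (- ln (hn z)) *v w) \<le> \<tau> * hn z powr \<mu>"
  shows "nrm w \<le> \<tau> * nrm z + \<tau> * (\<bar>\<mu>\<bar> * (2 * (2 * K + 1)) * (2 + R ^ 3))"
proof -
  obtain s u where s: "hn z = exp s" "z = d s *v u" "nrm u = 1" "\<bar>s\<bar> \<le> 2 * \<bar>ln (nrm z)\<bar>"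
    using hn_cases[OF z] .
  let ?e = "\<bar>s\<bar> * (\<bar>\<mu>\<bar> * K)" and ?k = "\<bar>\<mu>\<bar> * (2 * (2 * K + 1)) * \<bar>ln (nrm z)\<bar>"
  have "\<mu> * s \<le> \<bar>\<mu>\<bar> * \<bar>s\<bar>" by (metis abs_ge_self abs_mult)
  then have "?e + (\<mu> * s + ?e) \<le> \<bar>s\<bar> * (\<bar>\<mu>\<bar> * (2 * K + 1))" by (simp add: algebra_simps)
  also have "\<dots> \<le> 2 * \<bar>ln (nrm z)\<bar> * (\<bar>\<mu>\<bar> * (2 * K + 1))"
    using s(4) K_nonneg by (intro mult_right_mono) auto
  finally have ex: "?e + (\<mu> * s + ?e) \<le> ?k" by (simp add: algebra_simps)
  have "nrm w = nrm (d s *v (d (- s) *v w))" by simp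
  also have "\<dots> \<le> exp (s + ?e) * nrm (d (- s) *v w)" by (rule nrm_d_le)
  also have "\<dots> \<le> exp (s + ?e) * (\<tau> * exp (\<mu> * s))"
    using w by (intro mult_left_mono) (auto simp: s(1) powr_def)
  \<comment> \<open>The factor \<open>exp (s - ?e)\<close> is split off because it is the lower
    bound of \<open>nrm z\<close>; what remains has an exponent of order
    \<open>\<mu> * s\<close>.\<close>
  also have "\<dots> = \<tau> * exp (?e + (\<mu> * s + ?e)) * exp (s - ?e)"
    by (simp only: mult_ac exp_add[symmetric]) (simp add: mult.commute mult.left_commute exp_add[symmetric])
  also have "\<dots> \<le> \<tau> * exp ?k * nrm z"
    using ex nrm_d_ge[of s u] s(2,3) \<tau> by (intro mult_mono) auto
  also have "\<dots> = \<tau> * nrm z + \<tau> * ((exp ?k - 1) * nrm z)" by (simp add: algebra_simps)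
  also have "\<dots> \<le> \<tau> * nrm z + \<tau> * (\<bar>\<mu>\<bar> * (2 * (2 * K + 1)) * (2 + R ^ 3))"
    using m R \<tau> K_nonneg by (intro add_left_mono mult_left_mono exp_log_minus_one_mult_le) auto
  finally show ?thesis .
qed

end

section \<open>Consensus coordinates and the linear estimate\<close>

lemma left_null_vector_balance:
  assumes "irrefl E" "left_null_vector E \<zeta>"
  shows "(\<Sum>i\<in>UNIV. \<zeta> $ i * adj E i j) = \<zeta> $ j * (\<Sum>k\<in>UNIV. adj E j k)"
proof -
  have a: "adj E j j = 0" using assms(1) by (auto simp: adj_def irrefl_def)
  have "0 = (\<zeta> v* laplacian E) $ j" using assms(2) by (simp add: left_null_vector_def)
  also have "\<dots> = (\<Sum>i\<in>UNIV. \<zeta> $ i * laplacian E $ i $ j)"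
    by (simp add: vector_matrix_mult_def mult.commute)
  also have "\<dots> = (\<Sum>i\<in>UNIV. (if i = j then \<zeta> $ j * (\<Sum>k\<in>UNIV. adj E j k) else 0) - \<zeta> $ i * adj E i j)"
    by (intro sum.cong) (auto simp: laplacian_def a)
  also have "\<dots> = \<zeta> $ j * (\<Sum>k\<in>UNIV. adj E j k) - (\<Sum>i\<in>UNIV. \<zeta> $ i * adj E i j)"
    by (simp add: sum_subtractf)
  finally show ?thesis by simp
qed

text \<open>The positive part of a left null vector is again one: it satisfies the balance equations as
  inequalities, and both sides have the same sum.\<close>

lemma left_null_vector_pos:
  assumes E: "irrefl E" "strongly_connected E" and \<zeta>: "left_null_vector E \<zeta>"
  shows "\<zeta> $ i > 0"
proof (rule ccontr)
  assume neg: "\<not> \<zeta> $ i > 0"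
  define p where "p i = max 0 (\<zeta> $ i)" for i
  have p: "p i \<ge> 0" "\<zeta> $ i \<le> p i" for i by (auto simp: p_def)
  have adj: "adj E i j \<ge> 0" for i j by (simp add: adj_def)
  have le: "p j * (\<Sum>k\<in>UNIV. adj E j k) \<le> (\<Sum>i\<in>UNIV. p i * adj E i j)" for j
  proof (cases "\<zeta> $ j \<ge> 0")
    case True
    then have "p j * (\<Sum>k\<in>UNIV. adj E j k) = (\<Sum>i\<in>UNIV. \<zeta> $ i * adj E i j)"
      using left_null_vector_balance[OF E(1) \<zeta>, of j] by (simp add: p_def)
    also have "\<dots> \<le> (\<Sum>i\<in>UNIV. p i * adj E i j)"
      using p adj by (intro sum_mono mult_right_mono)
    finally show ?thesis .
  next
    case False
    then show ?thesis using p adj by (auto simp: p_def intro!: sum_nonneg mult_nonneg_nonneg)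
  qed
  have "(\<Sum>j\<in>UNIV. p j * (\<Sum>k\<in>UNIV. adj E j k)) = (\<Sum>j\<in>UNIV. \<Sum>i\<in>UNIV. p i * adj E i j)"
    by (subst sum.swap) (simp add: sum_distrib_left)
  then have eq: "p j * (\<Sum>k\<in>UNIV. adj E j k) = (\<Sum>i\<in>UNIV. p i * adj E i j)" for j
    by (rule sum_mono_inv) (use le in auto)
  \<comment> \<open>Zeros of \<open>p\<close> spread backwards along edges, so by strong
    connectivity the zero at \<open>i\<close> reaches every node, against the sum of the
    \<open>\<zeta>\<close> being 1.\<close>
  have step: "p k = 0" if "(k, j) \<in> E" "p j = 0" for k j
  proof -
    have "(\<Sum>i\<in>UNIV. p i * adj E i j) = 0" using eq[of j] that by simp
    then have "p k * adj E k j = 0"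
      using p adj by (subst (asm) sum_nonneg_eq_0_iff) auto
    then show ?thesis using that by (simp add: adj_def)
  qed
  have "p i = 0" using neg by (simp add: p_def)
  have "p k = 0" for k
  proof -
    have "(k, i) \<in> E\<^sup>*" using E(2) by (simp add: strongly_connected_def)
    then show ?thesis
      by (induction rule: converse_rtrancl_induct) (use \<open>p i = 0\<close> step in auto)
  qed
  then have "\<zeta> $ k \<le> 0" for k using p(2)[of k] by simp
  then have "\<zeta> \<bullet> 1 \<le> 0" by (simp add: inner_vec_def sum_nonpos)
  then show False using \<zeta> by (simp add: left_null_vector_def)
qed

section \<open>Kronecker quadratic forms and modal coordinates\<close>

lemma inner_kron:
  "x \<bullet> (kron M P *v y) = (\<Sum>l\<in>UNIV. \<Sum>m\<in>UNIV. M $ l $ m * (agent x l \<bullet> (P *v agent y m)))"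
proof -
  have "x \<bullet> (kron M P *v y)
      = (\<Sum>l\<in>UNIV. \<Sum>a\<in>UNIV. \<Sum>m\<in>UNIV. \<Sum>b\<in>UNIV. x $ (l, a) * (M $ l $ m * P $ a $ b * y $ (m, b)))"
    by (simp add: inner_vec_def matrix_vector_mult_def kron_def sum_pair_UNIV sum_distrib_left)
  also have "\<dots> = (\<Sum>l\<in>UNIV. \<Sum>m\<in>UNIV. \<Sum>a\<in>UNIV. \<Sum>b\<in>UNIV. x $ (l, a) * (M $ l $ m * P $ a $ b * y $ (m, b)))"
    by (intro sum.cong refl sum.swap)
  also have "\<dots> = (\<Sum>l\<in>UNIV. \<Sum>m\<in>UNIV. M $ l $ m * (agent x l \<bullet> (P *v agent y m)))"
    by (simp add: inner_vec_def matrix_vector_mult_def agent_def sum_distrib_left mult_ac)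
  finally show ?thesis .
qed

lemma norm_stack_sq: "(norm (stack f))\<^sup>2 = (\<Sum>i\<in>UNIV. (norm (f i))\<^sup>2)"
  by (simp add: power2_norm_eq_inner inner_vec_def stack_def sum_pair_UNIV)

text \<open>A quadratic form sees only the symmetric part of \<open>D\<close>: by symmetry of
  \<open>ip\<close> the double sums with \<open>D\<close> and with its transpose coincide, so the
  form of \<open>transpose D + D\<close> is twice that of \<open>D\<close>.\<close>

lemma (in pd_matrix) kron_sym_coercive:
  fixes D :: "real^'l^'l"
  assumes "pos_def (kron (transpose D + D) P)"
  obtains c where "c > 0"
    "\<And>f. c * (\<Sum>l\<in>UNIV. (nrm (f l))\<^sup>2) \<le> (\<Sum>l\<in>UNIV. ip (f l) (\<Sum>m\<in>UNIV. D $ l $ m *\<^sub>R f m))"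
proof -
  obtain c where c: "c > 0"
    "\<And>x. c * (norm x)\<^sup>2 \<le> x \<bullet> (kron (transpose D + D) P *v x)"
    using pos_def_coercive[OF assms] by blast
  \<comment> \<open>With the identity matrix the operator bound becomes a comparison of the two
    norms.\<close>
  obtain k where k: "k \<ge> 0" "\<And>x. nrm (mat 1 *v x) \<le> k * norm x"
    using nrm_le_norm[of "mat 1"] by blast
  define K where "K = k + 1"
  have K: "K > 0" "nrm x \<le> K * norm x" for x
    using k(1) k(2)[of x] by (auto simp: K_def algebra_simps intro: order_trans)
  show thesis
  proof
    show "c / K\<^sup>2 / 2 > 0" using c K by simp
    fix f :: "'l \<Rightarrow> real^'n"
    let ?q = "\<Sum>l\<in>UNIV. ip (f l) (\<Sum>m\<in>UNIV. D $ l $ m *\<^sub>R f m)"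
    have q: "?q = (\<Sum>l\<in>UNIV. \<Sum>m\<in>UNIV. D $ l $ m * ip (f l) (f m))"
      by (simp add: ip_sum_right matrix_vector_mult_scaleR)
    have qt: "?q = (\<Sum>l\<in>UNIV. \<Sum>m\<in>UNIV. D $ m $ l * ip (f l) (f m))"
      unfolding q by (subst sum.swap) (intro sum.cong refl, subst ip_commute, rule refl)
    have "(\<Sum>l\<in>UNIV. (nrm (f l))\<^sup>2) \<le> (\<Sum>l\<in>UNIV. K\<^sup>2 * (norm (f l))\<^sup>2)"
      using K by (intro sum_mono) (simp add: power_mult_distrib[symmetric] power_mono)
    also have "\<dots> = K\<^sup>2 * (norm (stack f))\<^sup>2" by (simp add: norm_stack_sq sum_distrib_left)
    finally have "c / K\<^sup>2 / 2 * (\<Sum>l\<in>UNIV. (nrm (f l))\<^sup>2) \<le> c / K\<^sup>2 / 2 * (K\<^sup>2 * (norm (stack f))\<^sup>2)"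
      using c by (intro mult_left_mono) auto
    also have "\<dots> = c * (norm (stack f))\<^sup>2 / 2" using K(1) by simp
    also have "\<dots> \<le> (stack f \<bullet> (kron (transpose D + D) P *v stack f)) / 2"
      using c(2) by (intro divide_right_mono) auto
    also have "stack f \<bullet> (kron (transpose D + D) P *v stack f) = 2 * ?q"
      by (subst mult_2, subst (2) q, subst qt)
         (simp add: inner_kron transpose_def algebra_simps sum.distrib)
    finally show "c / K\<^sup>2 / 2 * (\<Sum>l\<in>UNIV. (nrm (f l))\<^sup>2) \<le> ?q" by simp
  qed
qed

text \<open>The block \<open>a\<close> of the vector obtained by applying the Kronecker product of
  \<open>S\<close> and the identity to \<open>z\<close>. For \<open>S\<close> the inverse of
  \<open>T\<close>, the index \<open>None\<close> gives the \<open>\<zeta>\<close>-weighted mean and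
  the indices \<open>Some l\<close> measure disagreement.\<close>

definition modal :: "real^'N^'a \<Rightarrow> 'a \<Rightarrow> real^('N \<times> 'n) \<Rightarrow> real^'n" where
  "modal S a z = (\<Sum>i\<in>UNIV. S $ a $ i *\<^sub>R agent z i)"

lemma modal_simps:
  "modal S a (x + y) = modal S a x + modal S a y"
  "modal S a (x - y) = modal S a x - modal S a y"
  "modal S a (c *\<^sub>R x) = c *\<^sub>R modal S a x"
  by (simp_all add: modal_def sum.distrib sum_subtractf scaleR_right_distrib scaleR_right_diff_distrib
      scaleR_sum_right mult.commute)

lemma modal_kron_left: "modal S a (kron (mat 1) (M :: real^'n^'n) *v z) = M *v modal S a z"
  by (simp add: modal_def agent_kron_left linear_sum[OF matrix_vector_mul_linear] o_def matrix_vector_mult_scaleR)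

lemma agent_modal:
  fixes T :: "real^'a^'N"
  assumes "T ** S = mat 1"
  shows "agent z i = (\<Sum>a\<in>UNIV. T $ i $ a *\<^sub>R modal S a z)"
proof -
  have "(\<Sum>a\<in>UNIV. T $ i $ a *\<^sub>R modal S a z) = (\<Sum>a\<in>UNIV. \<Sum>j\<in>UNIV. (T $ i $ a * S $ a $ j) *\<^sub>R agent z j)"
    by (simp add: modal_def scaleR_sum_right)
  also have "\<dots> = (\<Sum>j\<in>UNIV. (T ** S) $ i $ j *\<^sub>R agent z j)"
    by (subst sum.swap) (simp add: matrix_matrix_mult_def scaleR_sum_left)
  also have "\<dots> = agent z i"
    unfolding assms by (simp add: mat_def if_distrib if_distribR cong: if_cong)
  finally show ?thesis by simp
qed

lemma modal_laplacian:
  fixes L :: "real^'N^'N" and S :: "real^'N^'a"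
  assumes "S ** L = D ** S"
  shows "modal S a (kron L (mat 1) *v z) = (\<Sum>b\<in>UNIV. D $ a $ b *\<^sub>R modal S b z)"
proof -
  have k: "agent (kron L (mat 1) *v z) i = (\<Sum>j\<in>UNIV. L $ i $ j *\<^sub>R agent z j)" for i
    by (simp add: vec_eq_iff agent_def kron_def matrix_vector_mult_def mat_def sum_pair_UNIV
        if_distrib if_distribR cong: if_cong)
  have "modal S a (kron L (mat 1) *v z) = (\<Sum>i\<in>UNIV. \<Sum>j\<in>UNIV. (S $ a $ i * L $ i $ j) *\<^sub>R agent z j)"
    by (simp add: modal_def k scaleR_sum_right)
  also have "\<dots> = (\<Sum>j\<in>UNIV. (S ** L) $ a $ j *\<^sub>R agent z j)"
    by (subst sum.swap) (simp add: matrix_matrix_mult_def scaleR_sum_left)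
  also have "\<dots> = (\<Sum>j\<in>UNIV. \<Sum>b\<in>UNIV. (D $ a $ b * S $ b $ j) *\<^sub>R agent z j)"
    unfolding assms by (simp add: matrix_matrix_mult_def scaleR_sum_left)
  also have "\<dots> = (\<Sum>b\<in>UNIV. D $ a $ b *\<^sub>R modal S b z)"
    by (subst sum.swap) (simp add: modal_def scaleR_sum_right)
  finally show ?thesis .
qed

lemma sum_out_block: "(\<Sum>i\<in>UNIV. out_block own i y) = y"
  by (simp add: vec_eq_iff out_block_def if_distrib if_distribR cong: if_cong)

lemma out_block_diff: "out_block own i (x - y) = out_block own i x - out_block own i y"
  and out_block_scaleR: "out_block own i (c *\<^sub>R x) = c *\<^sub>R out_block own i x"
  by (auto simp: out_block_def vec_eq_iff)

lemma norm_out_block_le: "norm (out_block own i y) \<le> norm y"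
  by (rule norm_le_componentwise_cart) (simp add: out_block_def)

text \<open>The division by \<open>\<zeta> $ i\<close> will cancel the weight of node
  \<open>i\<close> in the mean. Together with \<open>sum_out_block\<close> it lets the local gains
  add up to \<open>M ** C\<close> there.\<close>

lemma H_gain_out_block:
  "H_gain own \<zeta> M i *v out_block own i y = (1 / \<zeta> $ i) *\<^sub>R (M *v out_block own i y)"
  unfolding vec_eq_iff matrix_vector_mult_def
  by (auto intro!: sum.cong simp: H_gain_def out_block_def sum_distrib_left)

lemma matrix_inv_mult:
  assumes "invertible M"
  shows "M ** matrix_inv M = mat 1" "matrix_inv M ** M = mat 1"
  using someI_ex[OF assms[unfolded invertible_def]] by (auto simp: matrix_inv_def)

section \<open>The quadratic Lyapunov function and the linear observer\<close>

context pd_matrix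
begin

text \<open>Kept bilinear so that the product rule for primitives applies: \<open>lyap S z y\<close>
  is half the derivative of the Lyapunov function at \<open>z\<close> in the direction
  \<open>y\<close>.\<close>

definition lyap :: "real^'N^'a \<Rightarrow> real^('N \<times> 'n) \<Rightarrow> real^('N \<times> 'n) \<Rightarrow> real" where
  "lyap S x y = (\<Sum>a\<in>UNIV. ip (modal S a x) (modal S a y))"

lemma lyap_nonneg: "0 \<le> lyap S x x"
  by (simp add: lyap_def sum_nonneg ip_nonneg)

lemma lyap_eq: "lyap S x x = (\<Sum>a\<in>UNIV. (nrm (modal S a x))\<^sup>2)"
  by (simp add: lyap_def nrm_sq)

lemma lyap_commute: "lyap S x y = lyap S y x"
  unfolding lyap_def by (intro sum.cong refl ip_commute)

lemma bounded_bilinear_lyap: "bounded_bilinear (lyap S)"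
  unfolding bilinear_conv_bounded_bilinear[symmetric] bilinear_def
  by (auto intro!: linearI simp: lyap_def modal_simps ip_simps sum.distrib sum_distrib_left)

lemma nrm_modal_le: "nrm (modal S a x) \<le> sqrt (lyap S x x)"
  unfolding lyap_eq by (intro real_le_rsqrt member_le_sum) auto

lemma nrm_agent_le:
  fixes T :: "real^'a^'N"
  assumes "T ** S = mat 1"
  shows "nrm (agent x i) \<le> (\<Sum>a\<in>UNIV. \<bar>T $ i $ a\<bar>) * sqrt (lyap S x x)"
proof -
  have "nrm (agent x i) \<le> (\<Sum>a\<in>UNIV. nrm (T $ i $ a *\<^sub>R modal S a x))"
    unfolding agent_modal[OF assms, of x i] by (rule nrm_sum)
  also have "\<dots> \<le> (\<Sum>a\<in>UNIV. \<bar>T $ i $ a\<bar> * sqrt (lyap S x x))"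
    by (intro sum_mono) (simp add: mult_left_mono nrm_modal_le)
  finally show ?thesis by (simp add: sum_distrib_right)
qed

lemma out_block_gain_bound:
  fixes M :: "real^'p^'n" and C :: "real^'n^'p"
  obtains h where "h \<ge> 0" "\<And>i x. nrm (M *v out_block own i (C *v x)) \<le> h * nrm x"
proof -
  obtain h1 where h1: "h1 \<ge> 0" "\<And>y. nrm (M *v y) \<le> h1 * norm y" using nrm_le_norm by blast
  obtain h2 where h2: "h2 \<ge> 0" "\<And>x. norm (C *v x) \<le> h2 * nrm x" using norm_mult_le_nrm by blast
  have "nrm (M *v out_block own i (C *v x)) \<le> h1 * h2 * nrm x" for i x
  proof -
    have "nrm (M *v out_block own i (C *v x)) \<le> h1 * norm (out_block own i (C *v x))" by (rule h1)
    also have "\<dots> \<le> h1 * (h2 * nrm x)"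
      using h1(1) h2(2)[of x] norm_out_block_le[of own i "C *v x"] by (intro mult_left_mono) linarith+
    finally show ?thesis by simp
  qed
  then show thesis using h1 h2 by (intro that[of "h1 * h2"]) auto
qed

text \<open>
  The mean \<open>\<Sum> \<zeta>\<^sub>i z\<^sub>i\<close> is driven by \<open>A + M C\<close> and does not feel the coupling, whose gain \<open>\<nu>\<close> only
  contracts the other modal coordinates; \<open>X\<close> and \<open>W\<close> are the sizes of the two parts.
\<close>

lemma linear_estimate:
  fixes A :: "real^'n^'n" and C :: "real^'n^'p" and M :: "real^'p^'n" and own :: "'p \<Rightarrow> 'N::finite"
    and T :: "real^('l::finite option)^'N"
  assumes E: "irrefl E" "strongly_connected E" and \<zeta>: "left_null_vector E \<zeta>"
    and split: "laplacian_splitting E \<zeta> T \<Delta>"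
    and \<Delta>: "pos_def (kron (transpose \<Delta> + \<Delta>) P)" and \<rho>: "\<rho> > 0"
  obtains \<nu>0 k where "\<nu>0 > 0" "k > 0"
    "\<And>\<nu> \<tau> \<eta> z y \<epsilon>. \<nu> \<ge> \<nu>0 \<Longrightarrow> 0 \<le> \<tau> \<Longrightarrow> \<tau> \<le> \<rho> / 3 \<Longrightarrow> 0 \<le> \<eta> \<Longrightarrow>
      (\<And>x. ip x ((A + M ** C) *v x) \<le> - (\<rho> / 2) * (nrm x)\<^sup>2) \<Longrightarrow>
      (\<And>i. agent y i = A *v agent z i
        + H_gain own \<zeta> M i *v out_block own i (C *v agent z i) + \<nu> *\<^sub>R theta E z i + \<epsilon> i) \<Longrightarrow>
      (\<And>i. nrm (\<epsilon> i) \<le> \<tau> * nrm (agent z i) + \<eta>) \<Longrightarrow>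
      lyap (matrix_inv T) z z \<le> 2 \<Longrightarrow>
      lyap (matrix_inv T) z y \<le> - (\<rho> / 12) * lyap (matrix_inv T) z z + k * \<eta>"
proof -
  define S where "S = matrix_inv T"
  have inv: "invertible T" and T1: "column None T = 1" and S\<zeta>: "row None S = \<zeta>"
    and SLT: "S ** laplacian E ** T =
       (\<chi> a b. case a of None \<Rightarrow> 0 | Some i \<Rightarrow> (case b of None \<Rightarrow> 0 | Some j \<Rightarrow> \<Delta> $ i $ j))"
    using split by (auto simp: laplacian_splitting_def S_def)
  define D :: "real^('l option)^('l option)" where
    "D = (\<chi> a b. case a of None \<Rightarrow> 0 | Some i \<Rightarrow> (case b of None \<Rightarrow> 0 | Some j \<Rightarrow> \<Delta> $ i $ j))"
  have ST: "S ** T = mat 1" and TS: "T ** S = mat 1"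
    unfolding S_def using matrix_inv_mult[OF inv] by auto
  have "S ** laplacian E ** T ** S = D ** S" by (simp add: SLT D_def)
  then have SL: "S ** laplacian E = D ** S"
    by (simp add: matrix_mul_assoc[symmetric] TS)
  have T1': "T $ i $ None = 1" for i
    using T1 by (simp add: column_def vec_eq_iff)
  have S\<zeta>': "S $ None $ i = \<zeta> $ i" for i
    using S\<zeta> by (simp add: row_def vec_eq_iff)
  have \<zeta>pos: "\<zeta> $ i > 0" for i by (rule left_null_vector_pos[OF E \<zeta>])
  have \<zeta>sum: "(\<Sum>i\<in>UNIV. \<zeta> $ i) = 1"
    using \<zeta> by (simp add: left_null_vector_def inner_vec_def)
  obtain c1 where c1: "c1 > 0"
    "\<And>f. c1 * (\<Sum>l\<in>UNIV. (nrm (f l))\<^sup>2) \<le> (\<Sum>l\<in>UNIV. ip (f l) (\<Sum>m\<in>UNIV. \<Delta> $ l $ m *\<^sub>R f m))"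
    using kron_sym_coercive[OF \<Delta>] by blast
  obtain h where h: "h \<ge> 0" "\<And>i x. nrm (M *v out_block own i (C *v x)) \<le> h * nrm x"
    using out_block_gain_bound by blast
  obtain kA where kA: "kA \<ge> 0" "\<And>x. nrm (A *v x) \<le> kA * nrm x"
    using nrm_mult_le_nrm by blast
  define hG where "hG = (\<Sum>i\<in>UNIV. h / \<zeta> $ i)"
  define kT where "kT = (\<Sum>i\<in>UNIV. \<Sum>l\<in>UNIV. \<bar>T $ i $ Some l\<bar>)"
  define kS where "kS = (\<Sum>a\<in>UNIV. \<Sum>i\<in>UNIV. \<bar>S $ a $ i\<bar>)"
  define n where "n = real CARD('N)"
  define m where "m = real CARD('l)"
  have nn: "n \<ge> 0" "m \<ge> 0" by (simp_all add: n_def m_def)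
  have hG: "hG \<ge> 0" unfolding hG_def using h(1) \<zeta>pos by (auto intro!: sum_nonneg divide_nonneg_pos)
  have kT: "kT \<ge> 0" unfolding kT_def by (intro sum_nonneg) auto
  have kS: "kS \<ge> 0" unfolding kS_def by (intro sum_nonneg) auto
  have hG': "nrm (H_gain own \<zeta> M i *v out_block own i (C *v x)) \<le> hG * nrm x" for i x
  proof -
    have "nrm (H_gain own \<zeta> M i *v out_block own i (C *v x))
        = nrm (M *v out_block own i (C *v x)) / \<zeta> $ i"
      using \<zeta>pos[of i] by (simp add: H_gain_out_block)
    also have "\<dots> \<le> h * nrm x / \<zeta> $ i"
      using \<zeta>pos[of i] h(2) by (intro divide_right_mono) auto
    also have "\<dots> = h / \<zeta> $ i * nrm x" by simp
    also have "\<dots> \<le> hG * nrm x"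
      unfolding hG_def using h(1) \<zeta>pos
      by (intro mult_right_mono member_le_sum) (auto intro: divide_nonneg_pos)
    finally show ?thesis .
  qed
  \<comment> \<open>These are the coefficients of \<open>X * W\<close>, of \<open>W\<^sup>2\<close>
    and, up to a factor, of \<open>\<eta>\<close> in the final estimate. The threshold
    \<open>\<nu>0\<close> makes \<open>\<nu> * c1\<close> exceed \<open>K2\<close>, the term
    \<open>3 * K1\<^sup>2 / \<rho>\<close> from completing the square, and the wanted rate
    \<open>\<rho> / 12\<close>.\<close>
  define K1 where "K1 = n * h * kT + \<rho> / 3 * kT + m * kS * (hG + \<rho> / 3)"
  define K2 where "K2 = m * (kA + kS * (hG + \<rho> / 3) * kT)"
  define K3 where "K3 = 1 + m * kS"
  define \<nu>0 where "\<nu>0 = (K2 + 3 * K1\<^sup>2 / \<rho> + \<rho> / 12) / c1"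
  have K: "K1 \<ge> 0" "K2 \<ge> 0" "K3 > 0"
    unfolding K1_def K2_def K3_def using nn h(1) kT kS hG kA(1) \<rho> by (auto intro!: add_nonneg_nonneg add_pos_nonneg mult_nonneg_nonneg)
  have \<nu>0: "\<nu>0 > 0"
    unfolding \<nu>0_def using K \<rho> c1(1) by (auto intro!: divide_pos_pos add_nonneg_pos add_nonneg_nonneg)
  show thesis
  proof (rule that[of \<nu>0 "4 * K3"])
    fix \<nu> \<tau> \<eta> :: real and z y :: "real^('N \<times> 'n)" and \<epsilon> :: "'N \<Rightarrow> real^'n"
    assume \<nu>: "\<nu> \<ge> \<nu>0" and \<tau>: "0 \<le> \<tau>" "\<tau> \<le> \<rho> / 3" and \<eta>: "0 \<le> \<eta>"
      and AMC: "\<And>x. ip x ((A + M ** C) *v x) \<le> - (\<rho> / 2) * (nrm x)\<^sup>2"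
      and y: "\<And>i. agent y i = A *v agent z i
        + H_gain own \<zeta> M i *v out_block own i (C *v agent z i) + \<nu> *\<^sub>R theta E z i + \<epsilon> i"
      and \<epsilon>: "\<And>i. nrm (\<epsilon> i) \<le> \<tau> * nrm (agent z i) + \<eta>"
      and V2': "lyap (matrix_inv T) z z \<le> 2"
    define \<xi> where "\<xi> a = modal S a z" for a
    define x where "x = \<xi> None"
    define X where "X = nrm x"
    define W where "W = sqrt (\<Sum>l\<in>UNIV. (nrm (\<xi> (Some l)))\<^sup>2)"
    define G where "G i = H_gain own \<zeta> M i *v out_block own i (C *v agent z i)" for i
    have XW: "X \<ge> 0" "W \<ge> 0" by (auto simp: X_def W_def intro!: sum_nonneg)
    have W2: "W\<^sup>2 = (\<Sum>l\<in>UNIV. (nrm (\<xi> (Some l)))\<^sup>2)"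
      by (simp add: W_def sum_nonneg)
    have split_opt: "(\<Sum>a\<in>UNIV. f a) = f None + (\<Sum>l\<in>UNIV. f (Some l))" for f :: "'l option \<Rightarrow> 'b::comm_monoid_add"
      by (simp add: UNIV_option_conv sum.reindex)
    have V: "lyap S z z = X\<^sup>2 + W\<^sup>2"
      by (simp add: lyap_eq split_opt W2 X_def x_def \<xi>_def)
    \<comment> \<open>The resulting crude bounds on \<open>X\<close> and \<open>W\<close> serve to
      make the contribution of \<open>\<eta>\<close> independent of \<open>z\<close>.\<close>
    have V2: "X\<^sup>2 + W\<^sup>2 \<le> 2" using V2' by (simp add: V S_def[symmetric])
    then have "X\<^sup>2 \<le> 4" "W\<^sup>2 \<le> 4" using zero_le_power2[of X] zero_le_power2[of W] by linarith+
    then have XW2: "X \<le> 2" "W \<le> 2" by (auto intro: power2_le_imp_le)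
    have \<xi>W: "nrm (\<xi> (Some l)) \<le> W" for l
      unfolding W_def by (intro real_le_rsqrt member_le_sum) auto
    \<comment> \<open>The first column of \<open>T\<close> is the all-ones vector, so the mean
      enters every agent with coefficient 1 and the difference involves disagreement alone.\<close>
    have zx: "agent z i - x = (\<Sum>l\<in>UNIV. T $ i $ Some l *\<^sub>R \<xi> (Some l))" for i
      unfolding agent_modal[OF TS, of z i] split_opt by (simp add: T1' x_def \<xi>_def)
    have zxW: "nrm (agent z i - x) \<le> kT * W" for i
    proof -
      have "nrm (agent z i - x) \<le> (\<Sum>l\<in>UNIV. nrm (T $ i $ Some l *\<^sub>R \<xi> (Some l)))"
        unfolding zx by (rule nrm_sum)
      also have "\<dots> \<le> (\<Sum>l\<in>UNIV. \<bar>T $ i $ Some l\<bar> * W)"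
        using \<xi>W by (intro sum_mono) (simp add: mult_left_mono)
      also have "\<dots> = (\<Sum>l\<in>UNIV. \<bar>T $ i $ Some l\<bar>) * W" by (simp add: sum_distrib_right)
      also have "\<dots> \<le> kT * W"
        unfolding kT_def using XW by (intro mult_right_mono member_le_sum) (auto intro: sum_nonneg)
      finally show ?thesis .
    qed
    have zi: "nrm (agent z i) \<le> X + kT * W" for i
      using nrm_triangle[of "agent z i - x" x] zxW[of i] by (simp add: X_def)
    have \<epsilon>i: "nrm (\<epsilon> i) \<le> \<tau> * (X + kT * W) + \<eta>" for i
      using \<epsilon>[of i] mult_left_mono[OF zi \<tau>(1), of i] by linarith
    have th: "modal S a (stack (theta E z)) = - (\<Sum>b\<in>UNIV. D $ a $ b *\<^sub>R \<xi> b)" for a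
    proof -
      have "stack (theta E z) = (-1) *\<^sub>R (kron (laplacian E) (mat 1) *v z)"
        using theta_laplacian[OF E(1), of z]
        by (simp add: vec_eq_iff stack_def agent_def split_paired_all)
      then show ?thesis
        by (simp only: modal_simps modal_laplacian[OF SL] \<xi>_def) simp
    qed
    have "y = kron (mat 1) A *v z + stack G + \<nu> *\<^sub>R stack (theta E z) + stack \<epsilon>"
    proof -
      have "agent y i = agent (kron (mat 1) A *v z + stack G + \<nu> *\<^sub>R stack (theta E z) + stack \<epsilon>) i" for i
        by (simp add: agent_kron_left y G_def)
      then show ?thesis by (simp add: vec_eq_iff agent_def split_paired_all)
    qed
    then have my: "modal S a y = A *v \<xi> a + (\<Sum>i\<in>UNIV. S $ a $ i *\<^sub>R (G i + \<epsilon> i))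
        - \<nu> *\<^sub>R (\<Sum>b\<in>UNIV. D $ a $ b *\<^sub>R \<xi> b)" for a
      by (simp add: modal_simps modal_kron_left th \<xi>_def) (simp add: modal_def sum.distrib scaleR_right_distrib)

    have mean: "ip x (modal S None y) \<le> - (\<rho> / 2) * X\<^sup>2 + X * (n * (h * (kT * W)) + (\<tau> * (X + kT * W) + \<eta>))"
    proof -
      define g where "g i = M *v out_block own i (C *v (agent z i - x))" for i
      \<comment> \<open>The weight cancels the \<open>1 / \<zeta> $ i\<close> in the gain.
        Evaluating the output at the mean \<open>x\<close> instead of at \<open>z\<close> leaves
        \<open>g i\<close>, which is of order \<open>W\<close>.\<close>
      have "(\<Sum>i\<in>UNIV. \<zeta> $ i *\<^sub>R G i) = (\<Sum>i\<in>UNIV. M *v out_block own i (C *v x) + g i)"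
        using \<zeta>pos by (intro sum.cong refl)
          (simp add: G_def g_def H_gain_out_block less_imp_neq[symmetric] matrix_vector_mult_diff_distrib out_block_diff)
      also have "\<dots> = M *v (\<Sum>i\<in>UNIV. out_block own i (C *v x)) + (\<Sum>i\<in>UNIV. g i)"
        by (simp add: sum.distrib linear_sum[OF matrix_vector_mul_linear] o_def)
      finally have "modal S None y = (A + M ** C) *v x + ((\<Sum>i\<in>UNIV. g i) + (\<Sum>i\<in>UNIV. \<zeta> $ i *\<^sub>R \<epsilon> i))"
        unfolding my x_def[symmetric]
        by (simp add: D_def S\<zeta>' scaleR_right_distrib sum.distrib sum_out_block
            matrix_vector_mult_add_rdistrib matrix_vector_mul_assoc[symmetric])
      then have "ip x (modal S None y) = ip x ((A + M ** C) *v x) + ip x ((\<Sum>i\<in>UNIV. g i) + (\<Sum>i\<in>UNIV. \<zeta> $ i *\<^sub>R \<epsilon> i))"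
        by (simp only: matrix_vector_right_distrib inner_add_right)
      also have "ip x ((\<Sum>i\<in>UNIV. g i) + (\<Sum>i\<in>UNIV. \<zeta> $ i *\<^sub>R \<epsilon> i))
          \<le> X * nrm ((\<Sum>i\<in>UNIV. g i) + (\<Sum>i\<in>UNIV. \<zeta> $ i *\<^sub>R \<epsilon> i))"
        unfolding X_def by (rule order_trans[OF abs_ge_self ip_le_nrm])
      also have "\<dots> \<le> X * (n * (h * (kT * W)) + (\<tau> * (X + kT * W) + \<eta>))"
      proof (intro mult_left_mono order_trans[OF nrm_triangle add_mono] XW)
        have "nrm (g i) \<le> h * (kT * W)" for i
          unfolding g_def using h(2) mult_left_mono[OF zxW h(1), of i] by (rule order_trans)
        then have "(\<Sum>i\<in>UNIV. nrm (g i)) \<le> (\<Sum>i\<in>(UNIV::'N set). h * (kT * W))" by (intro sum_mono)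
        then show "nrm (\<Sum>i\<in>UNIV. g i) \<le> n * (h * (kT * W))"
          using nrm_sum[of g UNIV] by (simp add: n_def)
        have "(\<Sum>i\<in>UNIV. nrm (\<zeta> $ i *\<^sub>R \<epsilon> i)) \<le> (\<Sum>i\<in>UNIV. \<zeta> $ i * (\<tau> * (X + kT * W) + \<eta>))"
          using \<zeta>pos \<epsilon>i by (intro sum_mono) (simp add: less_imp_le mult_left_mono)
        also have "\<dots> = \<tau> * (X + kT * W) + \<eta>"
          by (simp only: sum_distrib_right[symmetric] \<zeta>sum mult_1)
        finally show "nrm (\<Sum>i\<in>UNIV. \<zeta> $ i *\<^sub>R \<epsilon> i) \<le> \<tau> * (X + kT * W) + \<eta>"
          using nrm_sum[of "\<lambda>i. \<zeta> $ i *\<^sub>R \<epsilon> i" UNIV] by linarith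
      qed
      finally have "ip x (modal S None y) \<le> ip x ((A + M ** C) *v x) + X * (n * (h * (kT * W)) + (\<tau> * (X + kT * W) + \<eta>))"
        by simp
      also have "\<dots> \<le> - (\<rho> / 2) * X\<^sup>2 + X * (n * (h * (kT * W)) + (\<tau> * (X + kT * W) + \<eta>))"
        using AMC[of x] by (simp only: X_def add_le_cancel_right)
      finally show ?thesis .
    qed

    have dis: "(\<Sum>l\<in>UNIV. ip (\<xi> (Some l)) (modal S (Some l) y))
        \<le> m * (W * (kA * W + kS * (hG * (X + kT * W) + (\<tau> * (X + kT * W) + \<eta>)))) - \<nu> * (c1 * W\<^sup>2)"
    proof -
      define r where "r l = A *v \<xi> (Some l) + (\<Sum>i\<in>UNIV. S $ Some l $ i *\<^sub>R (G i + \<epsilon> i))" for l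
      let ?B = "kA * W + kS * (hG * (X + kT * W) + (\<tau> * (X + kT * W) + \<eta>))"
      have GB: "nrm (G i + \<epsilon> i) \<le> hG * (X + kT * W) + (\<tau> * (X + kT * W) + \<eta>)" for i
      proof (intro order_trans[OF nrm_triangle add_mono] \<epsilon>i)
        show "nrm (G i) \<le> hG * (X + kT * W)"
          unfolding G_def using hG' mult_left_mono[OF zi hG, of i] by (rule order_trans)
      qed
      have r: "nrm (r l) \<le> ?B" for l
        unfolding r_def
      proof (intro order_trans[OF nrm_triangle add_mono])
        show "nrm (A *v \<xi> (Some l)) \<le> kA * W"
          using kA(2) mult_left_mono[OF \<xi>W kA(1), of l] by (rule order_trans)
        let ?b = "hG * (X + kT * W) + (\<tau> * (X + kT * W) + \<eta>)"
        have b: "?b \<ge> 0" using nrm_nonneg GB by (rule order_trans)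
        have "nrm (\<Sum>i\<in>UNIV. S $ Some l $ i *\<^sub>R (G i + \<epsilon> i)) \<le> (\<Sum>i\<in>UNIV. nrm (S $ Some l $ i *\<^sub>R (G i + \<epsilon> i)))"
          by (rule nrm_sum)
        also have "\<dots> \<le> (\<Sum>i\<in>UNIV. \<bar>S $ Some l $ i\<bar> * ?b)"
          using GB by (intro sum_mono) (simp add: mult_left_mono)
        also have "\<dots> = (\<Sum>i\<in>UNIV. \<bar>S $ Some l $ i\<bar>) * ?b" by (simp only: sum_distrib_right)
        also have "\<dots> \<le> kS * ?b"
          unfolding kS_def using b by (intro mult_right_mono member_le_sum) (auto intro: sum_nonneg)
        finally show "nrm (\<Sum>i\<in>UNIV. S $ Some l $ i *\<^sub>R (G i + \<epsilon> i)) \<le> kS * ?b" .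
      qed
      have "modal S (Some l) y = r l - \<nu> *\<^sub>R (\<Sum>b\<in>UNIV. \<Delta> $ l $ b *\<^sub>R \<xi> (Some b))" for l
        unfolding my r_def split_opt by (simp add: D_def)
      then have "(\<Sum>l\<in>UNIV. ip (\<xi> (Some l)) (modal S (Some l) y))
          = (\<Sum>l\<in>UNIV. ip (\<xi> (Some l)) (r l)) - \<nu> * (\<Sum>l\<in>UNIV. ip (\<xi> (Some l)) (\<Sum>b\<in>UNIV. \<Delta> $ l $ b *\<^sub>R \<xi> (Some b)))"
        by (simp add: ip_simps sum_subtractf sum_distrib_left)
      also have "\<dots> \<le> (\<Sum>l\<in>(UNIV::'l set). W * ?B) - \<nu> * (c1 * W\<^sup>2)"
      proof (intro diff_mono sum_mono mult_left_mono)
        fix l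
        have "ip (\<xi> (Some l)) (r l) \<le> nrm (\<xi> (Some l)) * nrm (r l)"
          by (rule order_trans[OF abs_ge_self ip_le_nrm])
        also have "\<dots> \<le> W * ?B" using \<xi>W r XW by (intro mult_mono) auto
        finally show "ip (\<xi> (Some l)) (r l) \<le> W * ?B" .
      qed (use c1(2)[of "\<lambda>l. \<xi> (Some l)"] \<nu> \<nu>0 in \<open>auto simp: W2\<close>)
      finally show ?thesis by (simp add: m_def)
    qed

    \<comment> \<open>From here on \<open>\<rho> / 3\<close> replaces \<open>\<tau>\<close>, since
      \<open>\<nu>0\<close> was chosen before \<open>\<tau>\<close>.\<close>
    have \<tau>X: "\<tau> * (X + kT * W) \<le> \<rho> / 3 * (X + kT * W)"
      using \<tau> XW kT by (intro mult_right_mono) auto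
    have a: "X * (p + (\<tau> * (X + kT * W) + \<eta>)) \<le> X * (p + (\<rho> / 3 * (X + kT * W) + \<eta>))" for p
      using \<tau>X XW by (intro mult_left_mono add_left_mono add_right_mono)
    have b: "m * (W * (p + kS * (q + (\<tau> * (X + kT * W) + \<eta>))))
        \<le> m * (W * (p + kS * (q + (\<rho> / 3 * (X + kT * W) + \<eta>))))" for p q
      using \<tau>X XW nn kS by (intro mult_left_mono add_left_mono add_right_mono)
    have "lyap S z y = ip x (modal S None y) + (\<Sum>l\<in>UNIV. ip (\<xi> (Some l)) (modal S (Some l) y))"
      by (simp add: lyap_def split_opt x_def \<xi>_def)
    also have "\<dots> \<le> (- (\<rho> / 2) * X\<^sup>2 + X * (n * (h * (kT * W)) + (\<rho> / 3 * (X + kT * W) + \<eta>)))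
        + (m * (W * (kA * W + kS * (hG * (X + kT * W) + (\<rho> / 3 * (X + kT * W) + \<eta>)))) - \<nu> * (c1 * W\<^sup>2))"
      by (intro add_mono order_trans[OF mean add_left_mono[OF a]] order_trans[OF dis diff_right_mono[OF b]])
    also have "\<dots> = - (\<rho> / 6) * X\<^sup>2 + K1 * X * W + K2 * W\<^sup>2 - \<nu> * c1 * W\<^sup>2 + \<eta> * (X + (m * kS) * W)"
      by (simp add: K1_def K2_def power2_eq_square field_simps)
    also have "\<dots> \<le> - (\<rho> / 12) * (X\<^sup>2 + W\<^sup>2) + 4 * K3 * \<eta>"
    proof -
      \<comment> \<open>Completing the square, weighted so that the cross term consumes half of the
        rate \<open>\<rho> / 6 = \<rho> / 2 - \<rho> / 3\<close> left for the mean.\<close>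
      have "0 \<le> (\<rho> * X - 6 * K1 * W)\<^sup>2 / (12 * \<rho>)" using \<rho> by simp
      also have "\<dots> = \<rho> / 12 * X\<^sup>2 - K1 * X * W + 3 * K1\<^sup>2 / \<rho> * W\<^sup>2"
        using \<rho> by (simp add: power2_eq_square field_simps)
      finally have 1: "K1 * X * W \<le> \<rho> / 12 * X\<^sup>2 + 3 * K1\<^sup>2 / \<rho> * W\<^sup>2" by simp
      have "\<nu>0 * c1 \<le> \<nu> * c1" using \<nu> c1 by (intro mult_right_mono) auto
      then have "(K2 + 3 * K1\<^sup>2 / \<rho> + \<rho> / 12) * W\<^sup>2 \<le> \<nu> * c1 * W\<^sup>2"
        using c1(1) by (intro mult_right_mono) (auto simp: \<nu>0_def)
      then have 2: "K2 * W\<^sup>2 + 3 * K1\<^sup>2 / \<rho> * W\<^sup>2 + \<rho> / 12 * W\<^sup>2 \<le> \<nu> * c1 * W\<^sup>2"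
        by (simp only: distrib_right)
      have "m * kS * W \<le> m * kS * 2" using XW2 nn kS by (intro mult_left_mono) auto
      moreover have "0 \<le> m * kS" using nn kS by simp
      ultimately have "X + (m * kS) * W \<le> 4 * K3" using XW2(1) by (simp add: K3_def)
      then have 3: "\<eta> * (X + (m * kS) * W) \<le> 4 * K3 * \<eta>" using \<eta> mult_left_mono by (metis mult.commute)
      from 1 2 3 show ?thesis by (simp add: distrib_left)
    qed
    finally show "lyap (matrix_inv T) z y \<le> - (\<rho> / 12) * lyap (matrix_inv T) z z + 4 * K3 * \<eta>"
      by (simp only: V S_def[symmetric])
  qed (use \<nu>0 K in auto)
qed

end

section \<open>Comparison functions\<close>

definition decay_den :: "real \<Rightarrow> real \<Rightarrow> real \<Rightarrow> real" where
  "decay_den \<kappa> r t = 1 + \<kappa> * t * (r / (1 + r)\<^sup>2)"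

text \<open>The solution of \<open>u' = - \<kappa> * (u / (1 + r))\<^sup>2\<close> with
  \<open>u 0 = r\<close>; its reciprocal grows linearly in \<open>t\<close>. The quotient form stays
  meaningful at \<open>r = 0\<close>.\<close>

definition decay :: "real \<Rightarrow> real \<Rightarrow> real \<Rightarrow> real" where
  "decay \<kappa> r t = r / decay_den \<kappa> r t"

lemma decay_den_ge_1: "\<kappa> \<ge> 0 \<Longrightarrow> r \<ge> 0 \<Longrightarrow> t \<ge> 0 \<Longrightarrow> decay_den \<kappa> r t \<ge> 1"
  by (simp add: decay_den_def)

lemma decay_den_pos: "\<kappa> \<ge> 0 \<Longrightarrow> r \<ge> 0 \<Longrightarrow> t \<ge> 0 \<Longrightarrow> decay_den \<kappa> r t > 0"
  using decay_den_ge_1[of \<kappa> r t] by linarith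

lemma decay_nonneg: "\<kappa> \<ge> 0 \<Longrightarrow> r \<ge> 0 \<Longrightarrow> t \<ge> 0 \<Longrightarrow> 0 \<le> decay \<kappa> r t"
  using decay_den_pos[of \<kappa> r t] by (simp add: decay_def)

lemma decay_le:
  assumes "\<kappa> \<ge> 0" "r \<ge> 0" "t \<ge> 0"
  shows "decay \<kappa> r t \<le> r"
proof -
  have "r / decay_den \<kappa> r t \<le> r / 1"
    using decay_den_ge_1[OF assms] decay_den_pos[OF assms] assms(2) by (intro divide_left_mono) auto
  then show ?thesis by (simp add: decay_def)
qed

lemma decay_time_0 [simp]: "decay \<kappa> r 0 = r"
  by (simp add: decay_def decay_den_def)

lemma decay_0 [simp]: "decay \<kappa> 0 t = 0"
  by (simp add: decay_def)

lemma decay_eq_inverse: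
  assumes "r > 0"
  shows "decay \<kappa> r t = inverse (inverse r + \<kappa> * t / (1 + r)\<^sup>2)"
proof -
  have "decay_den \<kappa> r t = r * (inverse r + \<kappa> * t / (1 + r)\<^sup>2)"
    using assms by (simp add: distrib_left decay_den_def)
  then show ?thesis using assms by (simp add: decay_def divide_inverse)
qed

text \<open>Both summands of the reciprocal are decreasing in the initial value, the first one
  strictly.\<close>

lemma decay_strict_mono:
  assumes "\<kappa> \<ge> 0" "t \<ge> 0" "0 \<le> r" "r < s"
  shows "decay \<kappa> r t < decay \<kappa> s t"
proof (cases "r = 0")
  case True
  then show ?thesis using assms decay_den_pos[of \<kappa> s t] by (simp add: decay_def)
next
  case False
  then have r: "r > 0" "s > 0" using assms by auto
  have "inverse s < inverse r" using r assms by (intro less_imp_inverse_less) auto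
  moreover have "\<kappa> * t / (1 + s)\<^sup>2 \<le> \<kappa> * t / (1 + r)\<^sup>2"
    using r assms by (intro divide_left_mono power_mono mult_pos_pos zero_less_power) auto
  moreover have "0 < inverse s + \<kappa> * t / (1 + s)\<^sup>2" using r assms by (intro add_pos_nonneg) auto
  ultimately show ?thesis
    unfolding decay_eq_inverse[OF r(1)] decay_eq_inverse[OF r(2)]
    by (intro less_imp_inverse_less) auto
qed

lemma decay_antimono:
  assumes "\<kappa> \<ge> 0" "0 \<le> r" "0 \<le> t" "t \<le> u"
  shows "decay \<kappa> r u \<le> decay \<kappa> r t"
  unfolding decay_def
proof (rule divide_left_mono)
  show "decay_den \<kappa> r t \<le> decay_den \<kappa> r u"
    unfolding decay_den_def using assms by (intro add_left_mono mult_right_mono mult_left_mono) auto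
  show "0 < decay_den \<kappa> r u * decay_den \<kappa> r t"
    using assms by (intro mult_pos_pos decay_den_pos) auto
qed (use assms in auto)

lemma decay_continuous:
  assumes "\<kappa> \<ge> 0"
  shows "continuous_on ({0..} \<times> {0..}) (\<lambda>(r, t). decay \<kappa> r t)"
proof -
  have "continuous_on ({0..} \<times> {0..}) (\<lambda>x :: real \<times> real. decay_den \<kappa> (fst x) (snd x))"
    unfolding decay_den_def by (intro continuous_intros) auto
  then show ?thesis
    unfolding decay_def case_prod_unfold
  proof (intro continuous_intros ballI)
    fix x :: "real \<times> real" assume "x \<in> {0..} \<times> {0..}"
    then show "decay_den \<kappa> (fst x) (snd x) \<noteq> 0" using decay_den_pos[of \<kappa> "fst x" "snd x"] assms by auto
  qed
qed

lemma decay_tendsto_0: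
  assumes "\<kappa> > 0" "r \<ge> 0"
  shows "(decay \<kappa> r \<longlongrightarrow> 0) at_top"
proof (cases "r = 0")
  case True
  then show ?thesis by (simp add: decay_0[abs_def])
next
  case False
  define c where "c = \<kappa> * (r / (1 + r)\<^sup>2)"
  have c: "c > 0" using assms False unfolding c_def by simp
  have "decay \<kappa> r = (\<lambda>t. r / (1 + c * t))" by (simp add: decay_def decay_den_def c_def fun_eq_iff mult_ac)
  moreover have "filterlim (\<lambda>t. 1 + c * t) at_infinity at_top"
    using c by (intro filterlim_at_top_imp_at_infinity filterlim_tendsto_add_at_top[OF tendsto_const]
        filterlim_tendsto_pos_mult_at_top[OF tendsto_const _ filterlim_ident]) auto
  ultimately show ?thesis using tendsto_divide_0[OF tendsto_const] by metis
qed

lemma decay_has_derivative: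
  assumes "\<kappa> \<ge> 0" "r \<ge> 0" "t \<ge> 0"
  shows "(decay \<kappa> r has_real_derivative (- \<kappa> * (decay \<kappa> r t / (1 + r))\<^sup>2)) (at t within S)"
proof -
  have D: "decay_den \<kappa> r t \<noteq> 0" using decay_den_pos[OF assms] by simp
  have "(decay_den \<kappa> r has_real_derivative \<kappa> * (r / (1 + r)\<^sup>2)) (at t within S)"
  proof -
    define K where "K = r / (1 + r)\<^sup>2"
    show ?thesis
      unfolding decay_den_def[abs_def] K_def[symmetric] by (auto intro!: derivative_eq_intros)
  qed
  then have "(decay \<kappa> r has_real_derivative
      (0 * decay_den \<kappa> r t - r * (\<kappa> * (r / (1 + r)\<^sup>2))) / (decay_den \<kappa> r t * decay_den \<kappa> r t)) (at t within S)"
    unfolding decay_def[abs_def] by (intro DERIV_divide DERIV_const D)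
  moreover have "(0 * decay_den \<kappa> r t - r * (\<kappa> * (r / (1 + r)\<^sup>2))) / (decay_den \<kappa> r t * decay_den \<kappa> r t)
      = - \<kappa> * (decay \<kappa> r t / (1 + r))\<^sup>2"
    unfolding decay_def by (simp add: power2_eq_square mult_ac)
  ultimately show ?thesis by simp
qed

text \<open>The reason for the choice of the profile: one function decays slowly enough for
  \<open>r' = - \<kappa> r\<^sup>1\<^sup>+\<^sup>\<mu>\<close> with either sign of \<open>\<mu>\<close>.\<close>

lemma decay_rate_le:
  fixes u r v \<mu> :: real
  assumes "0 \<le> u" "u \<le> r" "u \<le> v" "0 < v" "\<bar>\<mu>\<bar> \<le> 1"
  shows "(u / (1 + r))\<^sup>2 \<le> v * v powr \<mu>"
proof (cases "u = 0")
  case False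
  then have u: "u > 0" using assms by simp
  \<comment> \<open>The exponent \<open>1 - \<mu>\<close> lies between 0 and 2, so this power is
    absorbed by \<open>(1 + r)\<^sup>2\<close>, and \<open>u powr (1 + \<mu>)\<close> remains of
    \<open>u\<^sup>2\<close>.\<close>
  have "u powr (1 - \<mu>) \<le> (1 + r) powr (1 - \<mu>)" using assms u by (intro powr_mono2) auto
  also have "\<dots> \<le> (1 + r) powr 2" using assms u by (intro powr_mono) auto
  also have "\<dots> = (1 + r)\<^sup>2" using assms by simp
  finally have "u powr (1 - \<mu>) * u powr (1 + \<mu>) \<le> (1 + r)\<^sup>2 * u powr (1 + \<mu>)"
    by (rule mult_right_mono) simp
  moreover have "u powr (1 - \<mu>) * u powr (1 + \<mu>) = u\<^sup>2" using u by (simp flip: powr_add)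
  ultimately have "(u / (1 + r))\<^sup>2 \<le> u powr (1 + \<mu>)" using assms u
    by (simp add: power_divide divide_le_eq mult.commute)
  also have "\<dots> \<le> v powr (1 + \<mu>)" using assms u by (intro powr_mono2) auto
  also have "\<dots> = v * v powr \<mu>" using assms by (simp add: powr_add)
  finally show ?thesis .
qed (use assms in simp)

section \<open>Class K and class KL functions built from the decay profile\<close>

lemma class_K_nonneg: "class_K \<phi> \<Longrightarrow> 0 \<le> s \<Longrightarrow> 0 \<le> \<phi> s"
  using strict_mono_onD[of "{0..}" \<phi> 0 s] by (cases "s = 0") (auto simp: class_K_def)

lemma class_K_mono: "class_K \<phi> \<Longrightarrow> 0 \<le> r \<Longrightarrow> r \<le> s \<Longrightarrow> \<phi> r \<le> \<phi> s"
  using strict_mono_onD[of "{0..}" \<phi> r s] by (cases "r = s") (auto simp: class_K_def)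

lemma class_K_compose:
  assumes "class_K \<phi>" "class_K \<eta>"
  shows "class_K (\<lambda>s. \<eta> (\<phi> s))"
  unfolding class_K_def
proof (intro conjI)
  show "continuous_on {0..} (\<lambda>s. \<eta> (\<phi> s))"
    using assms class_K_nonneg[OF assms(1)]
    by (intro continuous_on_compose2[of "{0..}" \<eta> "{0..}" \<phi>]) (auto simp: class_K_def)
  show "strict_mono_on {0..} (\<lambda>s. \<eta> (\<phi> s))"
    using assms class_K_nonneg[OF assms(1)]
    by (auto simp: class_K_def strict_mono_on_def)
qed (use assms in \<open>auto simp: class_K_def\<close>)

text \<open>In the application \<open>\<phi>\<close> converts the size of the initial error into an
  initial radius, and \<open>\<eta>\<close> converts a radius back into an error bound.\<close>

lemma class_KL_decay:
  assumes \<kappa>: "\<kappa> > 0" and \<phi>: "class_K \<phi>" and \<eta>: "class_K \<eta>"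
  shows "class_KL (\<lambda>s t. \<eta> (decay \<kappa> (\<phi> s) t))"
  unfolding class_KL_def
proof (intro conjI allI impI)
  note \<phi>0 = class_K_nonneg[OF \<phi>]
  have c\<phi>: "continuous_on {0..} \<phi>" and c\<eta>: "continuous_on {0..} \<eta>" using \<phi> \<eta> by (auto simp: class_K_def)
  have "continuous_on ({0..} \<times> {0..}) (\<lambda>x. (\<phi> (fst x), snd x :: real))"
  proof (rule continuous_on_Pair)
    have "continuous_on ({0..} \<times> {0..}) (fst :: real \<times> real \<Rightarrow> real)"
      by (rule continuous_on_fst[OF continuous_on_id])
    then show "continuous_on ({0..} \<times> {0..}) (\<lambda>x :: real \<times> real. \<phi> (fst x))"
      by (rule continuous_on_compose2[OF c\<phi>]) auto
    show "continuous_on ({0..} \<times> {0..}) (\<lambda>x :: real \<times> real. snd x)"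
      by (rule continuous_on_snd[OF continuous_on_id])
  qed
  then have "continuous_on ({0..} \<times> {0..}) (\<lambda>x. decay \<kappa> (\<phi> (fst x)) (snd x))"
  proof -
    assume c: "continuous_on ({0..} \<times> {0..}) (\<lambda>x. (\<phi> (fst x), snd x :: real))"
    have "continuous_on ({0..} \<times> {0..}) (\<lambda>x :: real \<times> real. (\<lambda>(r, t). decay \<kappa> r t) (\<phi> (fst x), snd x))"
    proof (rule continuous_on_compose2[OF decay_continuous[OF less_imp_le[OF \<kappa>]] c])
      show "(\<lambda>x :: real \<times> real. (\<phi> (fst x), snd x)) ` ({0..} \<times> {0..}) \<subseteq> {0..} \<times> {0..}"
        by (auto intro: \<phi>0)
    qed
    then show ?thesis by (simp only: prod.case)
  qed
  then show "continuous_on ({0..} \<times> {0..}) (\<lambda>(s, t). \<eta> (decay \<kappa> (\<phi> s) t))"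
    unfolding case_prod_unfold
  proof (rule continuous_on_compose2[OF c\<eta>])
    show "(\<lambda>x. decay \<kappa> (\<phi> (fst x)) (snd x)) ` ({0..} \<times> {0..}) \<subseteq> {0..}"
      by (auto intro!: decay_nonneg[OF less_imp_le[OF \<kappa>]] \<phi>0)
  qed
  show "class_K (\<lambda>s. \<eta> (decay \<kappa> (\<phi> s) t))" if t: "0 \<le> t" for t
  proof (rule class_K_compose[OF class_K_compose[OF \<phi>] \<eta>])
    show "class_K (\<lambda>r. decay \<kappa> r t)"
      unfolding class_K_def
    proof (intro conjI)
      show "continuous_on {0..} (\<lambda>r. decay \<kappa> r t)"
      proof -
        have c: "continuous_on {0..} (\<lambda>r :: real. (r, t))" by (intro continuous_intros)
        have "continuous_on {0..} (\<lambda>r. (\<lambda>(r, t). decay \<kappa> r t) (r, t))"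
          by (rule continuous_on_compose2[OF decay_continuous[OF less_imp_le[OF \<kappa>]] c]) (use t in auto)
        then show ?thesis by (simp only: prod.case)
      qed
    qed (use decay_strict_mono t \<kappa> in \<open>auto simp: strict_mono_on_def\<close>)
  qed
  show "antimono_on {0..} (\<lambda>t. \<eta> (decay \<kappa> (\<phi> s) t))" if "0 \<le> s" for s
    using decay_antimono \<phi>0[OF that] \<kappa> decay_nonneg
    by (intro monotone_onI class_K_mono[OF \<eta>]) auto
  show "((\<lambda>t. \<eta> (decay \<kappa> (\<phi> s) t)) \<longlongrightarrow> 0) at_top" if "0 \<le> s" for s
  proof -
    have "((\<lambda>t. \<eta> (decay \<kappa> (\<phi> s) t)) \<longlongrightarrow> \<eta> 0) at_top"
    proof (rule continuous_on_tendsto_compose[OF c\<eta> decay_tendsto_0[OF \<kappa> \<phi>0[OF that]]])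
      show "\<forall>\<^sub>F t in at_top. decay \<kappa> (\<phi> s) t \<in> {0..}"
        using eventually_ge_at_top[of 0] by eventually_elim (use decay_nonneg \<phi>0[OF that] \<kappa> in auto)
    qed simp
    then show ?thesis using \<eta> by (simp add: class_K_def)
  qed
qed

text \<open>A scale large enough for the dilation by \<open>- ln r\<close> to bring a vector of norm
  \<open>y\<close> into the unit ball. For \<open>r \<ge> 1\<close> the worst case requires
  \<open>y \<le> r powr (1 / 2)\<close>, for \<open>r < 1\<close> it requires
  \<open>y \<le> r powr (3 / 2)\<close>; the two summands cover these cases.\<close>

definition radius :: "real \<Rightarrow> real" where "radius y = y\<^sup>2 + sqrt y"

text \<open>The expansion at scale \<open>r\<close> is at most \<open>sqrt r\<close> for
  \<open>r < 1\<close> and \<open>r * sqrt r\<close> otherwise; the sum bounds both by one strictly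
  increasing function.\<close>

definition spread :: "real \<Rightarrow> real" where "spread r = sqrt r + r * sqrt r"

lemma class_K_radius: "k > 0 \<Longrightarrow> class_K (\<lambda>s. radius (k * s))"
  unfolding class_K_def radius_def
  by (auto intro!: continuous_intros strict_mono_onI add_strict_mono power_strict_mono)

lemma class_K_spread:
  assumes "c > 0"
  shows "class_K (\<lambda>r. c * spread (2 * r))"
  unfolding class_K_def
proof (intro conjI strict_mono_onI)
  show "continuous_on {0..} (\<lambda>r. c * spread (2 * r))"
    unfolding spread_def by (intro continuous_intros)
  fix r s :: real assume rs: "r \<in> {0..}" "r < s"
  have "x * sqrt x < y * sqrt y" if "0 \<le> x" "x < y" for x y
    using that by (intro mult_strict_mono') auto
  from this[of "2 * r" "2 * s"] have "2 * r * sqrt (2 * r) < 2 * s * sqrt (2 * s)"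
    using rs by simp
  then have "spread (2 * r) < spread (2 * s)"
    unfolding spread_def using rs by (intro add_strict_mono) auto
  then show "c * spread (2 * r) < c * spread (2 * s)" using assms by simp
qed (simp add: spread_def)

lemma radius_nonneg: "0 \<le> y \<Longrightarrow> 0 \<le> radius y"
  by (simp add: radius_def)

lemma le_radius:
  assumes "y \<ge> 0" shows "y \<le> radius y"
proof (cases "y \<le> 1")
  case True
  then have "y \<le> sqrt y" using assms by (intro real_le_rsqrt) (simp add: power2_eq_square mult_left_le)
  then show ?thesis by (simp add: radius_def add_increasing)
next
  case False
  then have "y \<le> y\<^sup>2" by (simp add: power2_eq_square)
  then show ?thesis using assms by (simp add: radius_def add_increasing2)
qed

text \<open>On scale \<open>r\<close> the dilations differ from \<open>r I\<close> by at most the factor \<open>exp (|ln r| / 2)\<close>.\<close>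

lemma dilation_radius:
  assumes r: "r > 0" and y: "y \<ge> 0" "radius y \<le> r"
  shows "exp (- ln r + \<bar>ln r\<bar> / 2) * y \<le> 1"
proof (cases "r \<ge> 1")
  case True
  have "y\<^sup>2 \<le> r" using y by (simp add: radius_def add_increasing2 order_trans[rotated])
  then have "y \<le> sqrt r" by (rule real_le_rsqrt)
  also have "sqrt r = exp (ln (sqrt r))" using r by simp
  also have "\<dots> = exp (ln r / 2)" using r by (simp add: ln_sqrt)
  finally have "exp (- ln r / 2) * y \<le> exp (- ln r / 2) * exp (ln r / 2)" by (intro mult_left_mono) auto
  then show ?thesis using True by (simp add: exp_add[symmetric])
next
  case False
  then have l: "ln r < 0" using r by simp
  have y1: "y \<le> 1"
  proof (rule ccontr)
    assume "\<not> y \<le> 1"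
    then have "y \<le> r" using le_radius[OF y(1)] y(2) by linarith
    with \<open>\<not> y \<le> 1\<close> False show False by linarith
  qed
  have "sqrt y \<le> r" using y(2) zero_le_power2[of y] unfolding radius_def by linarith
  then have "y \<le> r\<^sup>2" using y(1) r by (simp add: real_sqrt_le_iff sqrt_le_D)
  also have "r\<^sup>2 = exp (ln (r\<^sup>2))" using r by simp
  also have "\<dots> = exp (2 * ln r)" using r by (simp add: ln_realpow)
  finally have "exp (- 3 / 2 * ln r) * y \<le> exp (- 3 / 2 * ln r) * exp (2 * ln r)" by (intro mult_left_mono) auto
  also have "\<dots> = exp (ln r / 2)" by (simp add: exp_add[symmetric])
  also have "\<dots> \<le> 1" using l by simp
  finally show ?thesis using l by simp
qed

lemma exp_le_spread:
  assumes r: "r > 0"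
  shows "exp (ln r + \<bar>ln r\<bar> / 2) \<le> spread r"
proof (cases "r \<ge> 1")
  case True
  then have "exp (ln r + \<bar>ln r\<bar> / 2) = exp (ln r + ln r / 2)" by simp
  also have "\<dots> = exp (ln r) * exp (ln r / 2)" by (rule exp_add)
  also have "\<dots> = r * sqrt r" using r by (simp flip: ln_sqrt)
  finally show ?thesis using r by (simp add: spread_def)
next
  case False
  then have "exp (ln r + \<bar>ln r\<bar> / 2) = exp (ln r / 2)" using r by simp
  also have "\<dots> = sqrt r" using r by (simp flip: ln_sqrt)
  finally show ?thesis using r by (simp add: spread_def)
qed

text \<open>The larger argument is at least half of the sum. This separates the decaying part of the
  radius from the part due to the disturbance.\<close>

lemma spread_add_le:
  assumes "0 \<le> a" "0 \<le> b"
  shows "spread (a + b) \<le> spread (2 * a) + spread (2 * b)"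
proof -
  have mono: "spread x \<le> spread y" if "0 \<le> x" "x \<le> y" for x y
    using that by (auto simp: spread_def intro!: add_mono mult_mono)
  have nonneg: "0 \<le> spread x" if "0 \<le> x" for x using that by (simp add: spread_def)
  show ?thesis
    using mono[of "a + b" "2 * a"] mono[of "a + b" "2 * b"] nonneg[of "2 * a"] nonneg[of "2 * b"] assms
    by (cases "a \<le> b") auto
qed

text \<open>Finiteness is carried over from the whole line to \<open>{0..<t}\<close> first, because
  \<open>enn2real\<close> sends infinity to 0.\<close>

lemma Linf_norm_on_AE:
  fixes q :: "real \<Rightarrow> 'a::euclidean_space"
  assumes "Linf q"
  obtains N where "negligible N"
    "\<And>s. s \<in> {0..t} - N \<Longrightarrow> infnorm (q s) \<le> enn2real (Linf_norm_on {0..<t} q)"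
proof -
  have q: "q \<in> borel_measurable lebesgue" "Linf_norm_on UNIV q < \<infinity>" using assms by (auto simp: Linf_def)
  have inf: "infnorm \<in> borel_measurable (borel :: 'a measure)"
    by (intro borel_measurable_continuous_onI continuous_on_infnorm continuous_on_id)
  have m: "(\<lambda>s. ennreal (infnorm (q s))) \<in> borel_measurable lebesgue"
    using measurable_compose[OF q(1) inf] by measurable
  then have m': "(\<lambda>s. ennreal (infnorm (q s))) \<in> borel_measurable (lebesgue_on {0..<t})"
    by (rule measurable_restrict_space1)
  have "Linf_norm_on {0..<t} q \<le> Linf_norm_on UNIV q"
    unfolding Linf_norm_on_def
  proof (rule esssup_I[OF m'])
    have "AE s in lebesgue. ennreal (infnorm (q s)) \<le> esssup (lebesgue_on UNIV) (\<lambda>t. ennreal (infnorm (q t)))"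
      using esssup_AE[of "\<lambda>t. ennreal (infnorm (q t))" "lebesgue_on UNIV"]
      by (subst (asm) AE_restrict_space_iff) auto
    then show "AE s in lebesgue_on {0..<t}. ennreal (infnorm (q s)) \<le> esssup (lebesgue_on UNIV) (\<lambda>t. ennreal (infnorm (q t)))"
      by (subst AE_restrict_space_iff) auto
  qed
  then have fin: "Linf_norm_on {0..<t} q < \<infinity>" using q(2) by (rule order_le_less_trans)
  have "AE s in lebesgue_on {0..<t}. ennreal (infnorm (q s)) \<le> Linf_norm_on {0..<t} q"
    unfolding Linf_norm_on_def by (rule esssup_AE)
  then have "AE s in lebesgue. s \<in> {0..<t} \<longrightarrow> ennreal (infnorm (q s)) \<le> Linf_norm_on {0..<t} q"
    by (subst (asm) AE_restrict_space_iff) auto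
  then obtain N where N: "N \<in> null_sets lebesgue"
    "\<And>s. s \<notin> N \<Longrightarrow> s \<in> {0..<t} \<Longrightarrow> ennreal (infnorm (q s)) \<le> Linf_norm_on {0..<t} q"
    by (auto elim!: AE_E3)
  show thesis
  proof
    \<comment> \<open>The norm is taken over the half-open interval, so the end point
      \<open>t\<close> joins the null set.\<close>
    show "negligible (insert t N)"
      using N(1) by (simp add: negligible_iff_null_sets)
    fix s assume "s \<in> {0..t} - insert t N"
    then have "ennreal (infnorm (q s)) \<le> Linf_norm_on {0..<t} q" by (intro N(2)) auto
    then have "enn2real (ennreal (infnorm (q s))) \<le> enn2real (Linf_norm_on {0..<t} q)"
      using fin by (intro enn2real_mono) auto
    then show "infnorm (q s) \<le> enn2real (Linf_norm_on {0..<t} q)" by (simp add: infnorm_pos_le)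
  qed
qed

section \<open>The scaled error equation\<close>

text \<open>Read off from the difference of observer and plant with a dummy control
  \<open>u = 0\<close>, \<open>B = 0\<close>, which avoids expanding the block matrices
  again.\<close>

lemma error_rhs_agent:
  fixes q :: "real \<Rightarrow> (real^'n) \<times> (real^'p)" and e :: "real^('N::finite \<times> 'n)"
  assumes E: "irrefl E" and H: "H = H_gain own \<zeta> M"
    and \<omega>: "\<omega> = out_block own i (C *v agent e i - snd (q t))"
  shows "agent (error_rhs A C own G0 E P H \<mu> \<nu> \<gamma> x q t e) i
    = A *v agent e i + g_fun \<mu> G0 (norm \<omega>) *v (H i *v \<omega>)
      + \<nu> *\<^sub>R (agent_hnorm \<mu> G0 P (theta E e i) powr \<mu>) *\<^sub>R theta E e i
      + (\<gamma> t (agent e i + x t) - \<gamma> t (x t)) - fst (q t)"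
proof -
  define xh where "xh = e + kronv 1 (x t)"
  have e: "e = xh - kronv 1 (x t)" by (simp add: xh_def)
  have ei: "agent xh i = agent e i + x t" by (simp add: xh_def)
  have om: "out_block own i (C *v agent xh i - (C *v x t + snd (q t))) = \<omega>"
    by (simp add: \<omega> ei matrix_vector_right_distrib)
  have th: "theta E xh i = theta E e i" unfolding e by (simp add: theta_shift)
  have "agent (error_rhs A C own G0 E P H \<mu> \<nu> \<gamma> x q t e) i
      = observer_rhs A (0::real^'n^'n) C own G0 E P H \<mu> \<nu> \<gamma> (\<lambda>_. 0) (\<lambda>t. C *v x t + snd (q t)) t xh i
           - plant_rhs A (0::real^'n^'n) \<gamma> (\<lambda>_. 0) (\<lambda>t. fst (q t)) t (x t)"
    using observer_minus_plant[OF E H, where x = x and t = t and q = q and xh = xh and i = i and A = A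
        and B = "0 :: real^'n^'n" and C = C and ?G0.0 = G0 and Pa = P and \<mu> = \<mu> and \<nu> = \<nu> and \<gamma> = \<gamma> and u = "\<lambda>_. 0"]
    unfolding e[symmetric] by (rule sym)
  then show ?thesis
    unfolding observer_rhs_def plant_rhs_def Let_def om th ei
    by (simp add: matrix_vector_right_distrib \<omega>)
qed

definition single :: "'N \<Rightarrow> real^'n \<Rightarrow> real^('N::finite \<times> 'n)" where
  "single i v = stack (\<lambda>j. if j = i then v else 0)"

lemma agent_single: "agent (single i v) j = (if j = i then v else 0)"
  by (simp add: single_def)

lemma agent_ext: "(\<And>i. agent x i = agent y i) \<Longrightarrow> x = y"
  by (simp add: vec_eq_iff agent_def split_paired_all)

lemma wnorm_kron_single: "wnorm (kron (mat 1) P) (single i v) = wnorm P v"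
proof -
  have "single i v \<bullet> (kron (mat 1) P *v single i v)
      = (\<Sum>l\<in>UNIV. \<Sum>m\<in>UNIV. if m = i then if l = i then v \<bullet> (P *v v) else 0 else 0)"
    unfolding inner_kron by (intro sum.cong refl) (auto simp: agent_single mat_def)
  then show ?thesis by (simp add: wnorm_def)
qed

lemma kron_left_single: "kron (mat 1) (M :: real^'n^'n) *v single i v = single i (M *v v)"
  by (rule agent_ext) (simp add: agent_kron_left agent_single)

lemma single_eq_0_iff: "single i v = 0 \<longleftrightarrow> v = 0"
proof
  assume "single i v = 0"
  then have "agent (single i v) i = agent 0 i" by simp
  then show "v = 0" by (simp add: agent_single) (simp add: agent_def vec_eq_iff)
qed (simp add: single_def stack_def vec_eq_iff)

text \<open>Both sides are the same definite description: on \<open>single i v\<close> the stacked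
  dilation and the stacked norm reduce to those of one agent.\<close>

lemma stacked_hnorm_single: "stacked_hnorm \<mu> G0 P (single i v) = agent_hnorm \<mu> G0 P v"
  by (simp add: stacked_hnorm_def agent_hnorm_def hom_norm_def stacked_wnorm_def stacked_dilation_def
      wnorm_kron_single kron_left_single single_eq_0_iff)

text \<open>A deviation of a single agent turns the stacked condition into one for each agent.\<close>

lemma gamma_condition_agent:
  assumes "gamma_condition TYPE('N::finite) G0 P \<mu> \<tau> \<gamma>" "t > 0" "v \<noteq> 0"
  shows "wnorm P (dilation (dil_gen \<mu> G0) (- ln (agent_hnorm \<mu> G0 P v)) *v (\<gamma> t (v + x) - \<gamma> t x))
    \<le> \<tau> * agent_hnorm \<mu> G0 P v powr \<mu>"
proof -
  fix i :: 'N
  define xh where "xh = single i v + kronv 1 x"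
  have s: "xh - kronv 1 x = single i v" by (simp add: xh_def)
  have "xh \<noteq> kronv 1 x" using assms(3) s by (metis right_minus_eq single_eq_0_iff)
  then have "stacked_wnorm P (stacked_dilation \<mu> G0 (- ln (stacked_hnorm \<mu> G0 P (xh - kronv 1 x)))
             *v (gamma_hat \<gamma> t xh - gamma_tilde \<gamma> t x))
        \<le> \<tau> * stacked_hnorm \<mu> G0 P (xh - kronv 1 x) powr \<mu>"
    using assms(1,2) unfolding gamma_condition_def by blast
  moreover have "gamma_hat \<gamma> t xh - gamma_tilde \<gamma> t x = single i (\<gamma> t (v + x) - \<gamma> t x)"
    by (rule agent_ext) (simp add: gamma_hat_def gamma_tilde_def agent_single xh_def)
  ultimately show ?thesis
    by (simp add: s stacked_hnorm_single stacked_wnorm_def stacked_dilation_def kron_left_single wnorm_kron_single)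
qed

lemma mexp_scalar: "mexp (c *\<^sub>R mat 1 :: real^'a^'a) = exp c *\<^sub>R mat 1"
  using mexp_add_scalar[of "0 :: real^'a^'a" c] by simp

lemma theta_kron_left: "theta E (kron (mat 1) (M :: real^'n^'n) *v z) i = M *v theta E z i"
  by (simp add: theta_def agent_kron_left linear_sum[OF matrix_vector_mul_linear] o_def
      matrix_vector_mult_scaleR matrix_vector_mult_diff_distrib)

section \<open>Homogeneity of the error equation and its distance from the linear observer\<close>

context small_dilation
begin

text \<open>The hypothesis makes \<open>A\<close> intertwine \<open>dil_gen \<mu> G0\<close> with
  the same generator plus \<open>\<mu>\<close> times the identity, and the scalar shift becomes an
  exponential factor: \<open>A\<close> is homogeneous of degree \<open>\<mu>\<close>.\<close>

lemma dilation_intertwine: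
  assumes "A ** G0 = (G0 + mat 1) ** A"
  shows "d (- s) *v (A *v x) = exp (\<mu> * s) *\<^sub>R (A *v (d (- s) *v x))"
proof -
  note bilin = bounded_bilinear.add_left[OF bounded_bilinear_matrix_mult]
    bounded_bilinear.minus_left[OF bounded_bilinear_matrix_mult]
    bounded_bilinear.minus_right[OF bounded_bilinear_matrix_mult]
    bounded_bilinear.diff_left[OF bounded_bilinear_matrix_mult]
    bounded_bilinear.diff_right[OF bounded_bilinear_matrix_mult]
    bounded_bilinear.add_right[OF bounded_bilinear_matrix_mult]
    bounded_bilinear.scaleR_left[OF bounded_bilinear_matrix_mult]
    bounded_bilinear.scaleR_right[OF bounded_bilinear_matrix_mult]
  have "A ** (- s *\<^sub>R dil_gen \<mu> G0) = (- s *\<^sub>R dil_gen \<mu> G0 + (- s * \<mu>) *\<^sub>R mat 1) ** A"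
    unfolding dil_gen_def by (simp add: bilin assms algebra_simps)
  then have "A ** d (- s) = mexp (- s *\<^sub>R dil_gen \<mu> G0 + (- s * \<mu>) *\<^sub>R mat 1) ** A"
    unfolding dilation_def by (rule mexp_intertwine)
  also have "\<dots> = exp (- s * \<mu>) *\<^sub>R (d (- s) ** A)"
    unfolding mexp_add_scalar by (simp add: dilation_def bilin)
  finally have "A *v (d (- s) *v x) = exp (- s * \<mu>) *\<^sub>R (d (- s) *v (A *v x))"
    by (simp add: matrix_vector_mul_assoc scaleR_matrix_vector_assoc)
  then show ?thesis by (simp add: exp_minus mult.commute)
qed

text \<open>Since \<open>C\<close> annihilates \<open>G0\<close>, it sees only the identity part of
  the generator, so outputs scale with weight one.\<close>

lemma output_dilation:
  assumes "C ** G0 = 0"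
  shows "C *v (d s *v x) = exp s *\<^sub>R (C *v x)"
proof -
  note bilin = bounded_bilinear.add_right[OF bounded_bilinear_matrix_mult]
    bounded_bilinear.scaleR_left[OF bounded_bilinear_matrix_mult]
    bounded_bilinear.scaleR_right[OF bounded_bilinear_matrix_mult]
  have "C ** (s *\<^sub>R dil_gen \<mu> G0) = (s *\<^sub>R mat 1) ** C"
    unfolding dil_gen_def by (simp add: bilin assms)
  then have "C ** d s = mexp (s *\<^sub>R mat 1) ** C"
    unfolding dilation_def by (rule mexp_intertwine)
  then show ?thesis
    by (simp add: mexp_scalar bilin matrix_vector_mul_assoc scaleR_matrix_vector_assoc)
qed

text \<open>The generators commute, and the two contributions of \<open>s\<close> along
  \<open>G0\<close> cancel, leaving the scalar \<open>(\<mu> - 1) * s\<close>. The weight one of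
  \<open>\<omega>\<close> later raises the degree to \<open>\<mu>\<close>.\<close>

lemma gain_dilation:
  assumes "r > 0"
  shows "d (- s) *v (g_fun \<mu> G0 (exp s * r) *v v) = exp ((\<mu> - 1) * s) *\<^sub>R (g_fun \<mu> G0 r *v v)"
proof -
  note bilin = bounded_bilinear.add_left[OF bounded_bilinear_matrix_mult]
    bounded_bilinear.minus_left[OF bounded_bilinear_matrix_mult]
    bounded_bilinear.minus_right[OF bounded_bilinear_matrix_mult]
    bounded_bilinear.diff_left[OF bounded_bilinear_matrix_mult]
    bounded_bilinear.diff_right[OF bounded_bilinear_matrix_mult]
    bounded_bilinear.add_right[OF bounded_bilinear_matrix_mult]
    bounded_bilinear.scaleR_left[OF bounded_bilinear_matrix_mult]
    bounded_bilinear.scaleR_right[OF bounded_bilinear_matrix_mult]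
  have "d (- s) ** g_fun \<mu> G0 (exp s * r)
      = mexp (- s *\<^sub>R dil_gen \<mu> G0 + (\<mu> * ln (exp s * r)) *\<^sub>R (G0 + mat 1))"
    unfolding dilation_def g_fun_def
    by (rule mexp_add_commuting[symmetric]) (simp add: dil_gen_def bilin algebra_simps)
  also have "- s *\<^sub>R dil_gen \<mu> G0 + (\<mu> * ln (exp s * r)) *\<^sub>R (G0 + mat 1)
      = (\<mu> * ln r) *\<^sub>R (G0 + mat 1) + ((\<mu> - 1) * s) *\<^sub>R mat 1"
    using assms by (simp add: ln_mult dil_gen_def algebra_simps)
  also have "mexp \<dots> = exp ((\<mu> - 1) * s) *\<^sub>R g_fun \<mu> G0 r"
    unfolding mexp_add_scalar by (simp add: g_fun_def)
  finally show ?thesis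
    by (simp add: matrix_vector_mul_assoc scaleR_matrix_vector_assoc)
qed

lemma agent_stacked_dilation: "agent (stacked_dilation \<mu> G0 s *v e) i = d s *v agent e i"
  by (simp add: stacked_dilation_def agent_kron_left)

text \<open>Plant, injection and coupling all have degree \<open>\<mu>\<close>, so one positive
  factor \<open>exp (\<mu> * s)\<close> comes out in front. Only \<open>\<gamma>\<close> and the
  disturbance keep an explicit trace of the scale.\<close>

lemma error_rhs_scaled:
  fixes e z :: "real^('N::finite \<times> 'n)" and C :: "real^'n^'p"
  assumes E: "irrefl E" and H: "H = H_gain own \<zeta> M"
    and A: "A ** G0 = (G0 + mat 1) ** A" and C: "C ** G0 = 0"
    and z: "z = stacked_dilation \<mu> G0 (- s) *v e"
    and \<omega>: "\<omega> = out_block own i (C *v agent z i - exp (- s) *\<^sub>R snd (q t))"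
  shows "d (- s) *v agent (error_rhs A C own G0 E P H \<mu> \<nu> \<gamma> x q t e) i
    = exp (\<mu> * s) *\<^sub>R (A *v agent z i + g_fun \<mu> G0 (norm \<omega>) *v (H i *v \<omega>)
        + \<nu> *\<^sub>R (hn (theta E z i) powr \<mu>) *\<^sub>R theta E z i
        + exp (- \<mu> * s) *\<^sub>R (d (- s) *v (\<gamma> t (agent e i + x t) - \<gamma> t (x t)))
        - exp (- \<mu> * s) *\<^sub>R (d (- s) *v fst (q t)))"
proof -
  have zi: "agent z i = d (- s) *v agent e i" by (simp add: z agent_stacked_dilation)
  have ei: "agent e i = d s *v agent z i" by (simp add: zi)
  define \<omega>' where "\<omega>' = out_block own i (C *v agent e i - snd (q t))"
  have om: "\<omega>' = exp s *\<^sub>R \<omega>"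
    unfolding \<omega>'_def \<omega> out_block_scaleR[symmetric] ei output_dilation[OF C]
    by (simp add: scaleR_right_diff_distrib exp_minus)
  have th: "theta E e i = d s *v theta E z i"
  proof -
    have "e = kron (mat 1) (d s) *v z"
      by (rule agent_ext) (simp add: agent_kron_left z agent_stacked_dilation)
    then show ?thesis by (simp add: theta_kron_left)
  qed
  have g: "d (- s) *v (g_fun \<mu> G0 (norm \<omega>') *v (H i *v \<omega>')) = exp (\<mu> * s) *\<^sub>R (g_fun \<mu> G0 (norm \<omega>) *v (H i *v \<omega>))"
  proof (cases "\<omega> = 0")
    case False
    have "d (- s) *v (g_fun \<mu> G0 (exp s * norm \<omega>) *v (H i *v \<omega>'))
        = exp ((\<mu> - 1) * s) *\<^sub>R (g_fun \<mu> G0 (norm \<omega>) *v (H i *v \<omega>'))"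
      by (rule gain_dilation) (use False in simp)
    moreover have "exp ((\<mu> - 1) * s) * exp s = exp (\<mu> * s)"
      by (simp add: exp_add[symmetric] algebra_simps)
    ultimately show ?thesis by (simp add: om matrix_vector_mult_scaleR)
  qed (simp add: om)
  have t: "d (- s) *v ((hn (theta E e i) powr \<mu>) *\<^sub>R theta E e i) = exp (\<mu> * s) *\<^sub>R (hn (theta E z i) powr \<mu>) *\<^sub>R theta E z i"
  proof (cases "theta E z i = 0")
    case False
    obtain r u where "hn (theta E z i) = exp r" and "theta E z i = d r *v u" "nrm u = 1" "\<bar>r\<bar> \<le> 2 * \<bar>ln (nrm (theta E z i))\<bar>"
      using hn_cases[OF False] .
    then show ?thesis
      by (simp add: th hn_dilate matrix_vector_mult_scaleR powr_mult)
        (simp add: powr_def)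
  qed (simp add: th)
  have t': "(\<nu> * hn (theta E e i) powr \<mu>) *\<^sub>R (d (- s) *v theta E e i)
      = (exp (\<mu> * s) * (\<nu> * hn (theta E z i) powr \<mu>)) *\<^sub>R theta E z i"
    using arg_cong[OF t, of "\<lambda>v. \<nu> *\<^sub>R v"] by (simp add: matrix_vector_mult_scaleR mult_ac)
  show ?thesis
    unfolding error_rhs_agent[OF E H, where \<omega> = \<omega>' and C = C and e = e and q = q and t = t and i = i,
        OF \<omega>'_def]
    by (simp add: matrix_vector_right_distrib matrix_vector_mult_diff_distrib matrix_vector_mult_scaleR
        dilation_intertwine[OF A] g t' zi[symmetric] scaleR_right_distrib scaleR_right_diff_distrib
        exp_minus mult.assoc scaleR_left_commute)
qed

text \<open>Here \<open>\<epsilon>\<close> collects everything by which the scaled equation differs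
  from the linear observer: the nonlinear gain and coupling (order
  \<open>\<bar>\<mu>\<bar>\<close>), \<open>\<gamma>\<close> (its linear part plus order
  \<open>\<bar>\<mu>\<bar>\<close>), and the scaled disturbances and the drift \<open>c\<close> of
  the moving scale (order \<open>\<delta>\<close>).\<close>

lemma field_deviation:
  fixes z :: "real^('N::finite \<times> 'n)" and H :: "real^'p^'n" and C :: "real^'n^'p"
  assumes hH: "\<And>y. nrm (H *v y) \<le> hH * norm y" "hH \<ge> 0"
    and hC: "\<And>x. norm (C *v x) \<le> hC * nrm x" "hC \<ge> 0"
    and m: "\<bar>\<mu>\<bar> * (4 * K + 2) \<le> 1 / 2" and \<tau>: "0 \<le> \<tau>" "\<tau> \<le> \<rho>" and \<nu>: "\<nu> \<ge> 0"
    and R: "\<And>j. nrm (agent z j) \<le> R" and \<delta>: "0 \<le> \<delta>" "\<delta> \<le> 1"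
    and y: "norm y \<le> \<delta>" and \<omega>: "\<omega> = out_block own i (C *v agent z i - y)"
    and p: "nrm p \<le> \<delta>" and c: "\<bar>c\<bar> \<le> \<delta>"
    and w: "agent z i \<noteq> 0 \<Longrightarrow> nrm (d (- ln (hn (agent z i))) *v w) \<le> \<tau> * hn (agent z i) powr \<mu>"
      "agent z i = 0 \<Longrightarrow> w = 0"
    and \<epsilon>: "\<epsilon> = (g_fun \<mu> G0 (norm \<omega>) *v (H *v \<omega>) - H *v out_block own i (C *v agent z i))
        + \<nu> *\<^sub>R ((hn (theta E z i) powr \<mu>) *\<^sub>R theta E z i - theta E z i)
        + w - p + c *\<^sub>R (dil_gen \<mu> G0 *v agent z i)"
    and D: "D = hH * ((K + 1) * (2 + (hC * R + 1) ^ 3)) + \<nu> * (2 * (2 + (2 * real CARD('N) * R) ^ 3))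
        + \<rho> * (2 * (2 * K + 1) * (2 + R ^ 3)) + hH + 1 + 2 * R"
  shows "nrm \<epsilon> \<le> \<tau> * nrm (agent z i) + D * (\<bar>\<mu>\<bar> + \<delta>)"
proof -
  have R0: "R \<ge> 0" using nrm_nonneg R by (rule order_trans)
  have \<mu>K: "0 \<le> \<bar>\<mu>\<bar> * K" using K_nonneg by simp
  \<comment> \<open>The single condition on \<open>\<bar>\<mu>\<bar> * (4 * K + 2)\<close> covers
    the smallness required by all three deviation lemmas.\<close>
  have m1: "\<bar>\<mu>\<bar> \<le> 1 / 4" "\<bar>\<mu>\<bar> * (K + 1) \<le> 1 / 2" "\<bar>\<mu>\<bar> * (2 * (2 * K + 1)) \<le> 1 / 2" "\<bar>\<mu>\<bar> * K \<le> 1"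
    using m \<mu>K by (auto simp: algebra_simps)
  have K1: "nrm ((G0 + mat 1) *v x) \<le> (K + 1) * nrm x" for x
    using nrm_triangle[of "G0 *v x" x] G0_bound[of x]
    by (simp add: matrix_vector_mult_add_rdistrib algebra_simps)
  have "norm \<omega> \<le> norm (C *v agent z i - y)" unfolding \<omega> by (rule norm_out_block_le)
  also have "\<dots> \<le> norm (C *v agent z i) + norm y" by (rule norm_triangle_ineq4)
  also have "\<dots> \<le> hC * R + 1"
    using hC(1)[of "agent z i"] mult_left_mono[OF R hC(2), of i] y \<delta> by linarith
  finally have \<omega>R: "norm \<omega> \<le> hC * R + 1" .
  have g: "nrm (g_fun \<mu> G0 (norm \<omega>) *v (H *v \<omega>) - H *v \<omega>) \<le> hH * (\<bar>\<mu>\<bar> * (K + 1) * (2 + (hC * R + 1) ^ 3))"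
    using K_nonneg m1 by (intro g_term_deviation K1 hH \<omega>R) auto
  have o: "nrm (H *v \<omega> - H *v out_block own i (C *v agent z i)) \<le> hH * \<delta>"
  proof -
    have "nrm (H *v \<omega> - H *v out_block own i (C *v agent z i)) = nrm (- (H *v out_block own i y))"
      by (simp only: \<omega> out_block_diff matrix_vector_mult_diff_distrib) simp
    also have "\<dots> \<le> hH * norm (out_block own i y)" using hH by simp
    also have "\<dots> \<le> hH * \<delta>"
      using hH(2) y norm_out_block_le[of own i y] by (intro mult_left_mono) auto
    finally show ?thesis .
  qed
  have \<theta>R: "nrm (theta E z i) \<le> 2 * real CARD('N) * R"
  proof -
    have "nrm (theta E z i) \<le> (\<Sum>j\<in>UNIV. nrm (adj E i j *\<^sub>R (agent z j - agent z i)))"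
      unfolding theta_def by (rule nrm_sum)
    also have "\<dots> \<le> (\<Sum>j\<in>(UNIV::'N set). 2 * R)"
    proof (rule sum_mono)
      fix j
      have "nrm (agent z j - agent z i) \<le> 2 * R" using nrm_diff[of "agent z j" "agent z i"] R[of j] R[of i] by linarith
      then show "nrm (adj E i j *\<^sub>R (agent z j - agent z i)) \<le> 2 * R" using R0 by (simp add: adj_def)
    qed
    finally show ?thesis by (simp add: mult_ac)
  qed
  have t: "nrm (\<nu> *\<^sub>R ((hn (theta E z i) powr \<mu>) *\<^sub>R theta E z i - theta E z i))
      \<le> \<nu> * (2 * \<bar>\<mu>\<bar> * (2 + (2 * real CARD('N) * R) ^ 3))"
    using \<nu> mult_left_mono[OF theta_term_deviation[OF m1(1) \<theta>R] \<nu>] by simp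
  have w': "nrm w \<le> \<tau> * nrm (agent z i) + \<rho> * (\<bar>\<mu>\<bar> * (2 * (2 * K + 1)) * (2 + R ^ 3))"
  proof (cases "agent z i = 0")
    case True
    then show ?thesis using w(2) \<tau> R0 K_nonneg by (simp add: mult_nonneg_nonneg)
  next
    case False
    have "nrm w \<le> \<tau> * nrm (agent z i) + \<tau> * (\<bar>\<mu>\<bar> * (2 * (2 * K + 1)) * (2 + R ^ 3))"
      by (rule gamma_term_deviation[OF m1(3) R \<tau>(1) False w(1)[OF False]])
    \<comment> \<open>In the remainder \<open>\<tau>\<close> is replaced by \<open>\<rho>\<close>,
      which makes \<open>D\<close> independent of \<open>\<tau>\<close>; the leading coefficient
      stays sharp.\<close>
    also have "\<dots> \<le> \<tau> * nrm (agent z i) + \<rho> * (\<bar>\<mu>\<bar> * (2 * (2 * K + 1)) * (2 + R ^ 3))"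
      using \<tau> R0 K_nonneg by (intro add_left_mono mult_right_mono mult_nonneg_nonneg add_nonneg_nonneg) auto
    finally show ?thesis .
  qed
  have cz: "nrm (c *\<^sub>R (dil_gen \<mu> G0 *v agent z i)) \<le> \<delta> * (2 * R)"
  proof -
    have "nrm (dil_gen \<mu> G0 *v agent z i) \<le> \<bar>\<mu>\<bar> * nrm (G0 *v agent z i) + nrm (agent z i)"
      using nrm_triangle[of "\<mu> *\<^sub>R (G0 *v agent z i)" "agent z i"]
      by (simp add: dil_gen_def matrix_vector_mult_add_rdistrib scaleR_matrix_vector_assoc[symmetric])
    also have "\<dots> \<le> \<bar>\<mu>\<bar> * (K * nrm (agent z i)) + nrm (agent z i)"
      using G0_bound by (intro add_right_mono mult_left_mono) auto
    also have "\<dots> = (\<bar>\<mu>\<bar> * K + 1) * nrm (agent z i)" by (simp add: algebra_simps)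
    also have "\<dots> \<le> 2 * R" using m1(4) \<mu>K R by (intro mult_mono) auto
    finally show ?thesis using c \<delta> by (simp add: mult_mono)
  qed
  define k1 where "k1 = hH * ((K + 1) * (2 + (hC * R + 1) ^ 3))"
  define k2 where "k2 = \<nu> * (2 * (2 + (2 * real CARD('N) * R) ^ 3))"
  define k3 where "k3 = \<rho> * (2 * (2 * K + 1) * (2 + R ^ 3))"
  have D': "D = k1 + k2 + k3 + hH + 1 + 2 * R" by (simp add: D k1_def k2_def k3_def)
  have k: "k1 \<ge> 0" "k2 \<ge> 0" "k3 \<ge> 0"
    unfolding k1_def k2_def k3_def using hH(2) hC(2) \<nu> \<tau> R0 K_nonneg
    by (auto intro!: mult_nonneg_nonneg add_nonneg_nonneg)
  define n1 where "n1 = g_fun \<mu> G0 (norm \<omega>) *v (H *v \<omega>) - H *v \<omega>"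
  define n2 where "n2 = H *v \<omega> - H *v out_block own i (C *v agent z i)"
  define n3 where "n3 = \<nu> *\<^sub>R ((hn (theta E z i) powr \<mu>) *\<^sub>R theta E z i - theta E z i)"
  define n4 where "n4 = c *\<^sub>R (dil_gen \<mu> G0 *v agent z i)"
  have "\<epsilon> = n1 + n2 + n3 + w - p + n4" by (simp add: \<epsilon> n1_def n2_def n3_def n4_def)
  then have "nrm \<epsilon> \<le> nrm n1 + nrm n2 + nrm n3 + nrm w + nrm p + nrm n4"
    using nrm_triangle[of "n1 + n2 + n3 + w - p" n4] nrm_diff[of "n1 + n2 + n3 + w" p]
      nrm_triangle[of "n1 + n2 + n3" w] nrm_triangle[of "n1 + n2" n3] nrm_triangle[of n1 n2] by simp
  also have "\<dots> \<le> \<tau> * nrm (agent z i) + (\<bar>\<mu>\<bar> * (k1 + k2 + k3) + \<delta> * (hH + 1 + 2 * R))"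
  proof -
    have "nrm n1 \<le> \<bar>\<mu>\<bar> * k1" using g by (simp only: n1_def k1_def mult_ac)
    moreover have "nrm n2 \<le> \<delta> * hH" using o by (simp only: n2_def mult_ac)
    moreover have "nrm n3 \<le> \<bar>\<mu>\<bar> * k2" using t by (simp only: n3_def k2_def mult_ac)
    moreover have "nrm w \<le> \<tau> * nrm (agent z i) + \<bar>\<mu>\<bar> * k3" using w' by (simp only: k3_def mult_ac)
    moreover have "nrm n4 \<le> \<delta> * (2 * R)" using cz by (simp only: n4_def)
    ultimately show ?thesis using p by (simp only: distrib_left mult_1_right)
  qed
  also have "\<dots> \<le> \<tau> * nrm (agent z i) + (\<bar>\<mu>\<bar> * D + \<delta> * D)"
  proof (intro add_left_mono add_mono)
    show "\<bar>\<mu>\<bar> * (k1 + k2 + k3) \<le> \<bar>\<mu>\<bar> * D"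
      using k hH(2) R0 by (intro mult_left_mono) (simp_all add: D')
    show "\<delta> * (hH + 1 + 2 * R) \<le> \<delta> * D"
      using k \<delta>(1) by (intro mult_left_mono) (simp_all add: D')
  qed
  also have "\<dots> = \<tau> * nrm (agent z i) + D * (\<bar>\<mu>\<bar> + \<delta>)" by (simp add: algebra_simps)
  finally show ?thesis .
qed

end

lemma bounded_bilinear_kron_left:
  "bounded_bilinear (\<lambda>(M :: real^'n^'n) (z :: real^('N::finite \<times> 'n)). kron (mat 1) M *v z)"
  unfolding bilinear_conv_bounded_bilinear[symmetric] bilinear_def
  by (auto intro!: linearI agent_ext simp: agent_kron_left matrix_vector_right_distrib matrix_vector_mult_add_rdistrib
      scaleR_matrix_vector_assoc[symmetric] matrix_vector_mult_scaleR)

lemma (in pd_matrix) lyap_le: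
  assumes "\<And>i. nrm (agent z i) \<le> m"
  shows "lyap S z z \<le> ((\<Sum>a\<in>UNIV. \<Sum>i\<in>UNIV. \<bar>S $ a $ i\<bar>) * m)\<^sup>2"
proof -
  have "sqrt (lyap S z z) = L2_set (\<lambda>a. nrm (modal S a z)) UNIV"
    by (simp add: lyap_eq L2_set_def)
  also have "\<dots> \<le> (\<Sum>a\<in>UNIV. nrm (modal S a z))"
    by (rule L2_set_le_sum) simp
  also have "\<dots> \<le> (\<Sum>a\<in>UNIV. \<Sum>i\<in>UNIV. \<bar>S $ a $ i\<bar> * m)"
  proof (rule sum_mono)
    fix a
    have "nrm (modal S a z) \<le> (\<Sum>i\<in>UNIV. nrm (S $ a $ i *\<^sub>R agent z i))"
      unfolding modal_def by (rule nrm_sum)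
    also have "\<dots> \<le> (\<Sum>i\<in>UNIV. \<bar>S $ a $ i\<bar> * m)"
      using assms by (intro sum_mono) (simp add: mult_left_mono)
    finally show "nrm (modal S a z) \<le> (\<Sum>i\<in>UNIV. \<bar>S $ a $ i\<bar> * m)" .
  qed
  also have "\<dots> = (\<Sum>a\<in>UNIV. \<Sum>i\<in>UNIV. \<bar>S $ a $ i\<bar>) * m"
    by (simp add: sum_distrib_right)
  finally have "sqrt (lyap S z z) \<le> \<dots>" .
  then show ?thesis by (rule sqrt_le_D)
qed

section \<open>Invariance of shrinking homogeneous sublevel sets\<close>

context small_dilation
begin

text \<open>The product rule is used twice, for the dilation applied to \<open>e\<close> and then
  for \<open>lyap\<close> of the result with itself. Differentiating the moving dilation produces
  the term with \<open>\<sigma>' t\<close> and the generator.\<close>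

lemma lyap_barrier:
  fixes e :: "real \<Rightarrow> real^('N::finite \<times> 'n)" and S :: "real^'N^'a"
  defines "z \<equiv> \<lambda>t \<sigma>. stacked_dilation \<mu> G0 (- \<sigma> t) *v e t"
  assumes T: "0 \<le> T" and e: "primitive_on T f e"
    and \<sigma>: "\<And>t. t \<in> {0..T} \<Longrightarrow> (\<sigma> has_real_derivative \<sigma>' t) (at t within {0..T})"
    and \<sigma>': "continuous_on {0..T} \<sigma>'"
    and N: "negligible N"
    and init: "lyap S (z 0 \<sigma>) (z 0 \<sigma>) \<le> 1"
    and dec: "\<And>t. t \<in> {0..T} - N \<Longrightarrow> 1 \<le> lyap S (z t \<sigma>) (z t \<sigma>) \<Longrightarrow> lyap S (z t \<sigma>) (z t \<sigma>) \<le> 2 \<Longrightarrow>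
      lyap S (z t \<sigma>) (stacked_dilation \<mu> G0 (- \<sigma> t) *v f t - \<sigma>' t *\<^sub>R (kron (mat 1) (dil_gen \<mu> G0) *v z t \<sigma>)) \<le> 0"
  shows "lyap S (z T \<sigma>) (z T \<sigma>) \<le> 1"
proof -
  define D' where "D' t = (- \<sigma>' t) *\<^sub>R (dil_gen \<mu> G0 ** d (- \<sigma> t))" for t
  have D: "primitive_on T D' (\<lambda>t. d (- \<sigma> t))"
  proof (rule primitive_on_C1)
    fix t assume "t \<in> {0..T}"
    then have "((\<lambda>t. - \<sigma> t) has_vector_derivative - \<sigma>' t) (at t within {0..T})"
      using \<sigma> by (intro has_vector_derivative_minus) (simp add: has_real_derivative_iff_has_vector_derivative)
    from vector_diff_chain_within[OF this d_has_vector_derivative]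
    show "((\<lambda>t. d (- \<sigma> t)) has_vector_derivative D' t) (at t within {0..T})"
      by (simp add: o_def D'_def)
  next
    have "continuous_on {0..T} \<sigma>" by (rule DERIV_continuous_on[OF \<sigma>])
    then have "continuous_on {0..T} (\<lambda>t. d (- \<sigma> t))"
      by (intro continuous_on_compose2[OF continuous_on_d[of UNIV]] continuous_on_minus) auto
    then show "continuous_on {0..T} D'"
      unfolding D'_def
      by (intro continuous_on_scaleR continuous_on_minus \<sigma>'
          bounded_linear.continuous_on[OF bounded_bilinear.bounded_linear_right[OF bounded_bilinear_matrix_mult]])
  qed
  define z' where "z' t = kron (mat 1) (d (- \<sigma> t)) *v f t + kron (mat 1) (D' t) *v e t" for t
  have zp: "primitive_on T z' (\<lambda>t. z t \<sigma>)"
    unfolding z'_def z_def stacked_dilation_def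
    by (rule primitive_on_product[OF bounded_bilinear_kron_left D e])
  have z': "z' t = stacked_dilation \<mu> G0 (- \<sigma> t) *v f t - \<sigma>' t *\<^sub>R (kron (mat 1) (dil_gen \<mu> G0) *v z t \<sigma>)" for t
    by (rule agent_ext)
       (simp add: z'_def z_def D'_def agent_kron_left agent_stacked_dilation
         scaleR_matrix_vector_assoc[symmetric] matrix_vector_mul_assoc[symmetric]
         bounded_bilinear.minus_left[OF bounded_bilinear_matrix_vector_mult])
  show ?thesis
  proof (rule primitive_on_barrier[OF primitive_on_product[OF bounded_bilinear_lyap zp zp] T init N])
    fix t assume "t \<in> {0..T} - N" "1 \<le> lyap S (z t \<sigma>) (z t \<sigma>)" "lyap S (z t \<sigma>) (z t \<sigma>) \<le> 2"
    from dec[OF this] show "lyap S (z t \<sigma>) (z' t) + lyap S (z' t) (z t \<sigma>) \<le> 0"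
      using lyap_commute[of S "z' t" "z t \<sigma>"] by (simp add: z')
  qed
qed

text \<open>
  The sublevel set \<open>V (d (- ln r) e) \<le> 1\<close> of radius \<open>r\<close> is invariant while \<open>r\<close> shrinks along
  \<open>r t = a + decay \<delta> b t\<close>: by homogeneity the scaled error satisfies an equation that is
  uniformly close to the linear one.
\<close>

lemma error_bound:
  fixes e :: "real \<Rightarrow> real^('N::finite \<times> 'n)" and S :: "real^'N^'a" and C :: "real^'n^'p"
    and H :: "'N \<Rightarrow> real^'p^'n"
  assumes E: "irrefl E" and H: "H = H_gain own \<zeta> M"
    and A: "A ** G0 = (G0 + mat 1) ** A" and C: "C ** G0 = 0"
    and lin: "\<And>\<tau> \<eta> z y \<epsilon>. 0 \<le> \<tau> \<Longrightarrow> \<tau> \<le> \<rho> / 3 \<Longrightarrow> 0 \<le> \<eta> \<Longrightarrow>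
      (\<And>i. agent y i = A *v agent z i + H i *v out_block own i (C *v agent z i) + \<nu> *\<^sub>R theta E z i + \<epsilon> i) \<Longrightarrow>
      (\<And>i. nrm (\<epsilon> i) \<le> \<tau> * nrm (agent z i) + \<eta>) \<Longrightarrow> lyap S z z \<le> 2 \<Longrightarrow>
      lyap S z y \<le> - (\<rho> / 12) * lyap S z z + k * \<eta>"
    and \<nu>: "\<nu> \<ge> 0" and \<rho>: "\<rho> > 0"
    and hH: "\<And>i y. nrm (H i *v y) \<le> hH * norm y" "hH \<ge> 0"
    and hC: "\<And>x. norm (C *v x) \<le> hC * nrm x" "hC \<ge> 0"
    and R: "\<And>(x :: real^('N \<times> 'n)) i. lyap S x x \<le> 2 \<Longrightarrow> nrm (agent x i) \<le> R"
    and m: "\<bar>\<mu>\<bar> * (4 * K + 2) \<le> 1 / 2"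
    and D: "D = hH * ((K + 1) * (2 + (hC * R + 1) ^ 3)) + \<nu> * (2 * (2 + (2 * real CARD('N) * R) ^ 3))
        + \<rho> * (2 * (2 * K + 1) * (2 + R ^ 3)) + hH + 1 + 2 * R"
    and \<delta>: "0 < \<delta>" "\<delta> \<le> 1" and small_D: "k * (D * (\<bar>\<mu>\<bar> + \<delta>)) \<le> \<rho> / 12" "0 \<le> D"
    and \<gamma>: "gamma_condition TYPE('N) G0 P \<mu> \<tau> \<gamma>" and \<tau>: "0 < \<tau>" "\<tau> < \<rho> / 3"
    and T: "0 \<le> T" and e: "primitive_on T (\<lambda>t. error_rhs A C own G0 E P H \<mu> \<nu> \<gamma> x q t (e t)) e"
    and N: "negligible N" and Q: "0 \<le> Q"
    and q: "\<And>t. t \<in> {0..T} - N \<Longrightarrow> norm (snd (q t)) \<le> Q \<and> nrm (fst (q t)) \<le> Q"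
    and a: "0 < a" "radius (Q / \<delta>) \<le> a" and b: "radius y0 \<le> b" and y0: "0 \<le> y0"
    and kL: "\<And>z :: real^('N \<times> 'n). (\<And>i. nrm (agent z i) * kL \<le> 1) \<Longrightarrow> lyap S z z \<le> 1" "0 \<le> kL"
    and e0: "\<And>i. nrm (agent (e 0) i) * kL \<le> y0"
  shows "nrm (agent (e T) i) \<le> spread (a + decay \<delta> b T) * R"
proof -
  have b0: "0 \<le> b" using radius_nonneg[OF y0] b by linarith
  \<comment> \<open>The floor \<open>a > 0\<close> dominates the disturbance for all times and keeps
    \<open>ln (r t)\<close> meaningful.\<close>
  define r where "r t = a + decay \<delta> b t" for t
  have dn: "0 \<le> decay \<delta> b t" if "t \<in> {0..T}" for t
    using that \<delta> b0 by (intro decay_nonneg) auto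
  have r: "r t > 0" if "t \<in> {0..T}" for t using dn[OF that] a(1) by (simp add: r_def)
  define r' where "r' t = - \<delta> * (decay \<delta> b t / (1 + b))\<^sup>2" for t
  have r_der: "(r has_real_derivative r' t) (at t within {0..T})" if "t \<in> {0..T}" for t
  proof -
    have "((\<lambda>t. a + decay \<delta> b t) has_real_derivative 0 + r' t) (at t within {0..T})"
      unfolding r'_def using that \<delta> b0 by (intro DERIV_add DERIV_const decay_has_derivative) auto
    then show ?thesis by (simp add: r_def[abs_def])
  qed
  define \<sigma> where "\<sigma> t = ln (r t)" for t
  define \<sigma>' where "\<sigma>' t = r' t / r t" for t
  have \<sigma>_der: "(\<sigma> has_real_derivative \<sigma>' t) (at t within {0..T})" if "t \<in> {0..T}" for t
    unfolding \<sigma>_def[abs_def] \<sigma>'_def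
    using DERIV_chain2[OF DERIV_ln_divide[OF r[OF that]] r_der[OF that]] by simp
  have c_r: "continuous_on {0..T} r" by (rule DERIV_continuous_on[OF r_der])
  then have "continuous_on {0..T} (\<lambda>t. r t - a)" by (intro continuous_on_diff continuous_on_const)
  then have c_dec: "continuous_on {0..T} (decay \<delta> b)" by (simp add: r_def)
  have rn: "r t \<noteq> 0" if "0 \<le> t" "t \<le> T" for t using r[of t] that by simp
  have c_\<sigma>': "continuous_on {0..T} \<sigma>'"
    unfolding \<sigma>'_def r'_def using b0
    by (intro continuous_on_divide continuous_on_mult continuous_on_minus continuous_on_const
        continuous_on_power c_dec c_r) (auto simp: rn)
  define z where "z t = stacked_dilation \<mu> G0 (- \<sigma> t) *v e t" for t
  have m1: "\<bar>\<mu>\<bar> \<le> 1" "\<bar>\<mu>\<bar> * (K + 1) \<le> 1 / 2"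
    using m mult_nonneg_nonneg[OF abs_ge_zero[of \<mu>] K_nonneg] by (auto simp: algebra_simps)
  \<comment> \<open>Time 0 is put into the exceptional set because the growth condition on
    \<open>\<gamma>\<close> is available for \<open>t > 0\<close> only.\<close>
  have dec: "lyap S (z t) (stacked_dilation \<mu> G0 (- \<sigma> t) *v error_rhs A C own G0 E P H \<mu> \<nu> \<gamma> x q t (e t)
        - \<sigma>' t *\<^sub>R (kron (mat 1) (dil_gen \<mu> G0) *v z t)) \<le> 0"
    if t: "t \<in> {0..T} - (insert 0 N)" and V: "1 \<le> lyap S (z t) (z t)" "lyap S (z t) (z t) \<le> 2" for t
  proof -
    have t0: "t > 0" "t \<in> {0..T}" "t \<in> {0..T} - N" using t by auto
    note rt = r[OF t0(2)]
    have ra: "a \<le> r t" using dn[OF t0(2)] by (simp add: r_def)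
    define s where "s = \<sigma> t"
    have rs: "r t = exp s" using rt by (simp add: s_def \<sigma>_def)
    \<comment> \<open>The logarithmic shrinking rate of the radius, measured in the time scale
      \<open>exp (\<mu> * s)\<close> of the scaled equation. The choice of the decay profile gives
      \<open>0 \<le> c \<le> \<delta>\<close> for either sign of \<open>\<mu>\<close>.\<close>
    define c where "c = - \<sigma>' t * exp (- \<mu> * s)"
    have ce: "- \<sigma>' t = exp (\<mu> * s) * c" by (simp add: c_def exp_minus)
    have "(decay \<delta> b t / (1 + b))\<^sup>2 \<le> r t * r t powr \<mu>"
      using dn[OF t0(2)] decay_le[of \<delta> b t] t0 \<delta> b0 rt a(1) m1(1)
      by (intro decay_rate_le) (auto simp: r_def)
    moreover have "r t powr \<mu> = exp (\<mu> * s)" by (simp add: rs powr_def)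
    ultimately have "\<delta> * (decay \<delta> b t / (1 + b))\<^sup>2 / r t \<le> \<delta> * exp (\<mu> * s)"
      using rt \<delta> by (simp add: divide_le_eq mult_ac)
    then have "- \<sigma>' t \<le> \<delta> * exp (\<mu> * s)" by (simp add: \<sigma>'_def r'_def)
    then have "c \<le> \<delta> * exp (\<mu> * s) * exp (- \<mu> * s)" unfolding c_def by (rule mult_right_mono) simp
    then have "c \<le> \<delta>" by (simp add: exp_minus mult.assoc)
    moreover have "0 \<le> c" unfolding c_def \<sigma>'_def r'_def using rt \<delta> by simp
    ultimately have c: "\<bar>c\<bar> \<le> \<delta>" by simp

    have zi: "agent (z t) i = d (- s) *v agent (e t) i" for i by (simp add: z_def agent_stacked_dilation s_def)
    have ei: "agent (e t) i = d s *v agent (z t) i" for i by (simp add: zi)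
    define y where "y = exp (- s) *\<^sub>R snd (q t)"
    define p where "p = exp (- \<mu> * s) *\<^sub>R (d (- s) *v fst (q t))"
    define \<omega> where "\<omega> i = out_block own i (C *v agent (z t) i - y)" for i
    define w where "w i = exp (- \<mu> * s) *\<^sub>R (d (- s) *v (\<gamma> t (agent (e t) i + x t) - \<gamma> t (x t)))" for i
    define \<epsilon> where "\<epsilon> i = (g_fun \<mu> G0 (norm (\<omega> i)) *v (H i *v \<omega> i) - H i *v out_block own i (C *v agent (z t) i))
        + \<nu> *\<^sub>R ((hn (theta E (z t) i) powr \<mu>) *\<^sub>R theta E (z t) i - theta E (z t) i)
        + w i - p + c *\<^sub>R (dil_gen \<mu> G0 *v agent (z t) i)" for i
    have y\<delta>: "norm y \<le> \<delta>"
    proof -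
      have "Q / \<delta> \<le> r t" using le_radius[of "Q / \<delta>"] Q \<delta>(1) a(2) ra by auto
      then have "Q \<le> \<delta> * exp s" using \<delta>(1) by (simp add: divide_le_eq mult.commute rs)
      then have "exp (- s) * Q \<le> \<delta>" by (simp add: exp_minus field_simps)
      moreover have "norm y \<le> exp (- s) * Q" using q[OF t0(3)] by (simp add: y_def)
      ultimately show ?thesis by linarith
    qed
    have p\<delta>: "nrm p \<le> \<delta>"
    proof -
      \<comment> \<open>The time change and the anisotropy of the dilation cost
        \<open>\<bar>\<mu>\<bar> * \<bar>s\<bar>\<close> and
        \<open>\<bar>\<mu>\<bar> * K * \<bar>s\<bar>\<close> in the exponent. Together they stay
        below the \<open>\<bar>s\<bar> / 2\<close> for which \<open>radius\<close> was
        designed.\<close>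
      have "- \<mu> * s \<le> \<bar>\<mu>\<bar> * \<bar>s\<bar>" by (metis abs_ge_minus_self abs_mult mult_minus_left)
      moreover have "\<bar>s\<bar> * (\<bar>\<mu>\<bar> * (K + 1)) \<le> \<bar>s\<bar> / 2" using mult_left_mono[OF m1(2), of "\<bar>s\<bar>"] by simp
      ultimately have ex: "- \<mu> * s + (- s + \<bar>- s\<bar> * (\<bar>\<mu>\<bar> * K)) \<le> - s + \<bar>s\<bar> / 2"
        by (simp add: algebra_simps)
      have "nrm p = exp (- \<mu> * s) * nrm (d (- s) *v fst (q t))" by (simp add: p_def)
      also have "\<dots> \<le> exp (- \<mu> * s) * (exp (- s + \<bar>- s\<bar> * (\<bar>\<mu>\<bar> * K)) * nrm (fst (q t)))"
        by (intro mult_left_mono nrm_d_le) auto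
      also have "\<dots> = exp (- \<mu> * s + (- s + \<bar>- s\<bar> * (\<bar>\<mu>\<bar> * K))) * nrm (fst (q t))"
        by (simp only: exp_add mult.assoc)
      also have "\<dots> \<le> exp (- s + \<bar>s\<bar> / 2) * Q"
        using ex q[OF t0(3)] by (intro mult_mono) auto
      also have "\<dots> = exp (- ln (r t) + \<bar>ln (r t)\<bar> / 2) * (Q / \<delta>) * \<delta>"
        using \<delta>(1) by (simp add: rs)
      also have "\<dots> \<le> 1 * \<delta>"
        using \<delta>(1) Q a(2) ra rt by (intro mult_right_mono dilation_radius) auto
      finally show ?thesis by simp
    qed
    have wi: "nrm (d (- ln (hn (agent (z t) i))) *v w i) \<le> \<tau> * hn (agent (z t) i) powr \<mu>"
      if nz: "agent (z t) i \<noteq> 0" for i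
    proof -
      obtain l u where l: "hn (agent (z t) i) = exp l" and "agent (z t) i = d l *v u" "nrm u = 1"
          "\<bar>l\<bar> \<le> 2 * \<bar>ln (nrm (agent (z t) i))\<bar>"
        using hn_cases[OF nz] .
      \<comment> \<open>The growth bound is invariant under scaling: it is applied to the unscaled
        error, whose homogeneous norm is \<open>exp s\<close> times that of the scaled one.\<close>
      have he: "hn (agent (e t) i) = exp (s + l)" unfolding ei hn_dilate l by (simp add: exp_add)
      have "agent (e t) i \<noteq> 0" using nz zi[of i] by auto
      from gamma_condition_agent[OF \<gamma> t0(1) this, of "x t"]
      have 1: "nrm (d (- (s + l)) *v (\<gamma> t (agent (e t) i + x t) - \<gamma> t (x t))) \<le> \<tau> * exp (\<mu> * (s + l))"
        by (simp add: he powr_def)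
      have "d (- l) *v w i = exp (- \<mu> * s) *\<^sub>R (d (- (s + l)) *v (\<gamma> t (agent (e t) i + x t) - \<gamma> t (x t)))"
        using d_add[of "- l" "- s"] by (simp add: w_def matrix_vector_mult_scaleR add.commute)
      then have "nrm (d (- l) *v w i) \<le> exp (- \<mu> * s) * (\<tau> * exp (\<mu> * (s + l)))"
        using mult_left_mono[OF 1, of "exp (- \<mu> * s)"] by simp
      also have "\<dots> = \<tau> * exp (\<mu> * l)" by (simp add: distrib_left exp_add exp_minus field_simps)
      finally show ?thesis by (simp add: l powr_def)
    qed
    have w0: "w i = 0" if "agent (z t) i = 0" for i
      using that ei[of i] by (simp add: w_def)
    have \<epsilon>_le: "nrm (\<epsilon> i) \<le> \<tau> * nrm (agent (z t) i) + D * (\<bar>\<mu>\<bar> + \<delta>)" for i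
      by (rule field_deviation[OF hH(1) hH(2) hC m _ _ \<nu> R[OF V(2)] _ \<delta>(2) y\<delta> \<omega>_def p\<delta> c wi w0 \<epsilon>_def D])
         (use \<tau> \<rho> \<delta> in auto)
    define v where "v = stack (\<lambda>i. A *v agent (z t) i + H i *v out_block own i (C *v agent (z t) i)
      + \<nu> *\<^sub>R theta E (z t) i + \<epsilon> i)"
    have "lyap S (z t) v \<le> - (\<rho> / 12) * lyap S (z t) (z t) + k * (D * (\<bar>\<mu>\<bar> + \<delta>))"
      by (rule lin[OF _ _ _ _ \<epsilon>_le V(2)]) (use \<tau> \<delta> small_D in \<open>auto simp: v_def\<close>)
    \<comment> \<open>All deviations together cost at most \<open>\<rho> / 12\<close>, which the
      decay compensates because the Lyapunov function is at least 1 here.\<close>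
    also have "\<dots> \<le> - (\<rho> / 12) * lyap S (z t) (z t) + \<rho> / 12" using small_D by simp
    also have "\<dots> \<le> 0" using mult_left_mono[OF V(1), of "\<rho> / 12"] \<rho> by simp
    finally have v0: "lyap S (z t) v \<le> 0" .
    have eq: "stacked_dilation \<mu> G0 (- \<sigma> t) *v error_rhs A C own G0 E P H \<mu> \<nu> \<gamma> x q t (e t)
        - \<sigma>' t *\<^sub>R (kron (mat 1) (dil_gen \<mu> G0) *v z t) = exp (\<mu> * s) *\<^sub>R v"
    proof (rule agent_ext)
      fix i
      have \<omega>i: "\<omega> i = out_block own i (C *v agent (z t) i - exp (- s) *\<^sub>R snd (q t))"
        by (simp add: \<omega>_def y_def)
      have zt: "z t = stacked_dilation \<mu> G0 (- s) *v e t" by (simp add: z_def s_def)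
      have "agent (stacked_dilation \<mu> G0 (- \<sigma> t) *v error_rhs A C own G0 E P H \<mu> \<nu> \<gamma> x q t (e t)
          - \<sigma>' t *\<^sub>R (kron (mat 1) (dil_gen \<mu> G0) *v z t)) i
        = d (- s) *v agent (error_rhs A C own G0 E P H \<mu> \<nu> \<gamma> x q t (e t)) i
          + (- \<sigma>' t) *\<^sub>R (dil_gen \<mu> G0 *v agent (z t) i)"
        by (simp add: agent_stacked_dilation agent_kron_left s_def)
      also have "\<dots> = exp (\<mu> * s) *\<^sub>R (A *v agent (z t) i + g_fun \<mu> G0 (norm (\<omega> i)) *v (H i *v \<omega> i)
          + \<nu> *\<^sub>R (hn (theta E (z t) i) powr \<mu>) *\<^sub>R theta E (z t) i + w i - p)
          + (exp (\<mu> * s) * c) *\<^sub>R (dil_gen \<mu> G0 *v agent (z t) i)"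
        unfolding error_rhs_scaled[where \<omega> = "\<omega> i" and q = q and t = t and i = i and C = C and z = "z t",
            OF E H A C zt \<omega>i] ce w_def p_def ..
      also have "\<dots> = exp (\<mu> * s) *\<^sub>R (A *v agent (z t) i + g_fun \<mu> G0 (norm (\<omega> i)) *v (H i *v \<omega> i)
          + \<nu> *\<^sub>R (hn (theta E (z t) i) powr \<mu>) *\<^sub>R theta E (z t) i + w i - p
          + c *\<^sub>R (dil_gen \<mu> G0 *v agent (z t) i))"
        by (simp only: scaleR_right_distrib scaleR_scaleR)
      also have "\<dots> = agent (exp (\<mu> * s) *\<^sub>R v) i"
        unfolding agent_simps v_def \<epsilon>_def
        by (rule arg_cong[where f = "\<lambda>v. exp (\<mu> * s) *\<^sub>R v"]) (simp add: scaleR_right_diff_distrib)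
      finally show "agent (stacked_dilation \<mu> G0 (- \<sigma> t) *v error_rhs A C own G0 E P H \<mu> \<nu> \<gamma> x q t (e t)
          - \<sigma>' t *\<^sub>R (kron (mat 1) (dil_gen \<mu> G0) *v z t)) i = agent (exp (\<mu> * s) *\<^sub>R v) i" .
    qed
    show ?thesis
      unfolding eq bounded_bilinear.scaleR_right[OF bounded_bilinear_lyap]
      using v0 by (simp add: mult_nonneg_nonpos)
  qed
  have z0: "lyap S (z 0) (z 0) \<le> 1"
  proof (rule kL(1))
    fix i
    \<comment> \<open>Since \<open>b\<close> is at least \<open>radius y0\<close>, the initial scale
      is large enough to start inside the sublevel set.\<close>
    have r0: "r 0 = a + b" "r 0 > 0" using a(1) b0 by (auto simp: r_def)
    have "nrm (agent (z 0) i) \<le> exp (- \<sigma> 0 + \<bar>\<sigma> 0\<bar> / 2) * nrm (agent (e 0) i)"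
      using nrm_d_half_le[of "- \<sigma> 0"] by (simp add: z_def agent_stacked_dilation)
    then have "nrm (agent (z 0) i) * kL \<le> exp (- \<sigma> 0 + \<bar>\<sigma> 0\<bar> / 2) * nrm (agent (e 0) i) * kL"
      using kL(2) by (rule mult_right_mono)
    also have "\<dots> = exp (- \<sigma> 0 + \<bar>\<sigma> 0\<bar> / 2) * (nrm (agent (e 0) i) * kL)" by simp
    also have "\<dots> \<le> exp (- \<sigma> 0 + \<bar>\<sigma> 0\<bar> / 2) * y0" using e0 by (intro mult_left_mono) auto
    also have "\<dots> \<le> 1"
      unfolding \<sigma>_def using r0 y0 b a(1) by (intro dilation_radius) auto
    finally show "nrm (agent (z 0) i) * kL \<le> 1" .
  qed
  have N': "negligible (insert 0 N)" using N by simp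
  have "lyap S (z T) (z T) \<le> 1"
    using lyap_barrier[where S = S and T = T and e = e and \<sigma> = \<sigma> and \<sigma>' = \<sigma>' and N = "insert 0 N",
        OF T e \<sigma>_der c_\<sigma>' N'] z0 dec
    unfolding z_def by blast
  then have zR: "nrm (agent (z T) i) \<le> R" by (intro R) simp
  have T': "T \<in> {0..T}" using T by simp
  have "agent (e T) i = d (\<sigma> T) *v agent (z T) i" by (simp add: z_def agent_stacked_dilation)
  then have "nrm (agent (e T) i) \<le> exp (\<sigma> T + \<bar>\<sigma> T\<bar> / 2) * nrm (agent (z T) i)"
    using nrm_d_half_le by simp
  also have "\<dots> \<le> spread (r T) * R"
    unfolding \<sigma>_def using exp_le_spread[OF r[OF T']] zR
    by (intro mult_mono) (auto intro: order_trans[OF _ exp_le_spread[OF r[OF T']]])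
  finally show ?thesis by (simp add: r_def)
qed

end

section \<open>Input-to-state stability\<close>

lemma pos_def_invertible:
  assumes "pos_def M"
  shows "invertible M"
proof -
  have "x = 0" if "M *v x = 0" for x
    using assms that unfolding pos_def_def by (metis inner_zero_right less_irrefl)
  then have "\<exists>B. B ** M = mat 1" using matrix_left_invertible_ker by blast
  then show ?thesis by (simp add: invertible_left_inverse)
qed

text \<open>Multiplying \<open>L\<^sub>0 = 0\<close> by the invertible \<open>mat 1 + G0\<close>
  gives \<open>Y0 = 0\<close>, and the defining equation of \<open>G0\<close> reduces to the
  homogeneity of \<open>A\<close>.\<close>

lemma homogeneous_plant:
  fixes A G0 :: "real^'n^'n" and Y0 :: "real^'p^'n" and C :: "real^'n^'p"
  assumes "G0 ** A - A ** G0 + Y0 ** C = - A"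
    and "invertible (mat 1 + G0)" "matrix_inv (mat 1 + G0) ** Y0 = 0"
  shows "A ** G0 = (G0 + mat 1) ** A"
proof -
  have "Y0 = (mat 1 + G0) ** (matrix_inv (mat 1 + G0) ** Y0)"
    by (simp add: matrix_mul_assoc matrix_inv_mult[OF assms(2)])
  then have "Y0 = 0" using assms(3) by (simp add: bounded_bilinear.zero_right[OF bounded_bilinear_matrix_mult])
  then have "G0 ** A - A ** G0 = - A"
    using assms(1) by (simp add: bounded_bilinear.zero_left[OF bounded_bilinear_matrix_mult])
  then have "G0 ** A - (G0 ** A - A ** G0) = G0 ** A - (- A)" by (rule arg_cong)
  then have "A ** G0 = G0 ** A + A" by (simp only: diff_diff_eq2 add_diff_cancel_left' diff_minus_eq_add)
  then show ?thesis by (simp add: bounded_bilinear.add_left[OF bounded_bilinear_matrix_mult])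
qed

text \<open>The quadratic form of the matrix inequality is twice that of its non-symmetrised half.
  For small \<open>\<mu>\<close> the generator contributes at least
  \<open>(nrm x)\<^sup>2 / 2\<close>, so the rate \<open>\<rho>\<close> in the inequality leaves
  \<open>\<rho> / 2\<close>.\<close>

lemma (in small_dilation) mean_dissipation:
  assumes lmi: "neg_def (P ** A + transpose A ** P + Y ** C + transpose C ** transpose Y
      + \<rho> *\<^sub>R (P ** dil_gen \<mu> G0 + transpose (dil_gen \<mu> G0) ** P))" and \<rho>: "\<rho> > 0"
  shows "ip x ((A + (matrix_inv P ** Y) ** C) *v x) \<le> - (\<rho> / 2) * (nrm x)\<^sup>2"
proof (cases "x = 0")
  case False
  have PY: "P *v (matrix_inv P *v v) = v" for v
    by (simp add: matrix_vector_mul_assoc matrix_inv_mult[OF pos_def_invertible[OF pd]])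
  have tr: "x \<bullet> (transpose M *v v) = v \<bullet> (M *v x)" for M :: "real^'n^'k" and v
    by (simp add: dot_lmul_matrix[symmetric] inner_commute)
  have "x \<bullet> ((P ** A + transpose A ** P + Y ** C + transpose C ** transpose Y
      + \<rho> *\<^sub>R (P ** dil_gen \<mu> G0 + transpose (dil_gen \<mu> G0) ** P)) *v x) < 0"
    using lmi False by (simp add: neg_def_def)
  also have "x \<bullet> ((P ** A + transpose A ** P + Y ** C + transpose C ** transpose Y
      + \<rho> *\<^sub>R (P ** dil_gen \<mu> G0 + transpose (dil_gen \<mu> G0) ** P)) *v x)
    = 2 * (ip x (A *v x) + x \<bullet> (Y *v (C *v x)) + \<rho> * ip x (dil_gen \<mu> G0 *v x))"
  proof -
    have 1: "x \<bullet> (transpose C *v (transpose Y *v x)) = x \<bullet> (Y *v (C *v x))"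
      unfolding tr by (metis dot_lmul_matrix inner_commute transpose_matrix_vector)
    have 2: "x \<bullet> (transpose M *v (P *v x)) = ip x (M *v x)" for M :: "real^'n^'n"
      unfolding tr by (metis inner_commute ip_commute)
    show ?thesis
      by (simp add: matrix_vector_mult_add_rdistrib scaleR_matrix_vector_assoc[symmetric]
          matrix_vector_mul_assoc[symmetric] inner_add_right 1 2 del: transpose_matrix_vector)
  qed
  finally have "ip x (A *v x) + x \<bullet> (Y *v (C *v x)) + \<rho> * ip x (dil_gen \<mu> G0 *v x) < 0" by simp
  moreover have "(nrm x)\<^sup>2 / 2 \<le> ip x (dil_gen \<mu> G0 *v x)"
  proof -
    have "\<bar>\<mu>\<bar> * \<bar>ip x (G0 *v x)\<bar> \<le> \<bar>\<mu>\<bar> * (nrm x * (K * nrm x))"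
      by (intro mult_left_mono order_trans[OF ip_le_nrm] G0_bound) auto
    also have "\<dots> = (\<bar>\<mu>\<bar> * K) * (nrm x)\<^sup>2" by (simp add: power2_eq_square)
    also have "\<dots> \<le> 1 / 2 * (nrm x)\<^sup>2" by (rule mult_right_mono[OF small]) simp
    finally have "- (\<mu> * ip x (G0 *v x)) \<le> (nrm x)\<^sup>2 / 2"
      using abs_ge_minus_self[of "\<mu> * ip x (G0 *v x)"] by (simp add: abs_mult)
    moreover have "ip x (dil_gen \<mu> G0 *v x) = \<mu> * ip x (G0 *v x) + (nrm x)\<^sup>2"
      by (simp add: dil_gen_def matrix_vector_mult_add_rdistrib scaleR_matrix_vector_assoc[symmetric]
          ip_simps nrm_sq)
    ultimately show ?thesis by simp
  qed
  then have "\<rho> * ((nrm x)\<^sup>2 / 2) \<le> \<rho> * ip x (dil_gen \<mu> G0 *v x)" using \<rho> by (intro mult_left_mono) auto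
  moreover have "ip x ((A + (matrix_inv P ** Y) ** C) *v x) = ip x (A *v x) + x \<bullet> (Y *v (C *v x))"
    by (simp add: matrix_vector_mult_add_rdistrib matrix_vector_mul_assoc[symmetric] ip_simps PY)
  ultimately show ?thesis by simp
qed simp

lemma norm_agents_le:
  fixes e :: "real^('N::finite \<times> 'n::finite)"
  assumes "\<And>i. norm (agent e i) \<le> m"
  shows "norm e \<le> real CARD('N) * m"
proof -
  have e: "e = stack (agent e)" by (rule agent_ext) simp
  have "norm e = L2_set (\<lambda>i. norm (agent e i)) UNIV"
    by (subst e) (simp add: L2_set_def norm_stack_sq[symmetric])
  also have "\<dots> \<le> (\<Sum>i\<in>UNIV. norm (agent e i))" by (rule L2_set_le_sum) simp
  also have "\<dots> \<le> (\<Sum>i\<in>(UNIV :: 'N set). m)" using assms by (intro sum_mono)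
  finally show ?thesis by simp
qed

lemma norm_agent_le:
  fixes e :: "real^('N::finite \<times> 'n::finite)"
  shows "norm (agent e i) \<le> norm e"
proof -
  have e: "e = stack (agent e)" by (rule agent_ext) simp
  have "(norm (agent e i))\<^sup>2 \<le> (\<Sum>i\<in>UNIV. (norm (agent e i))\<^sup>2)"
    by (rule member_le_sum) auto
  also have "\<dots> = (norm e)\<^sup>2" by (subst (2) e) (simp add: norm_stack_sq)
  finally show ?thesis by (simp add: power2_le_iff_abs_le)
qed

lemma solves_on_primitive:
  assumes "solves_on S f x" "0 \<le> T" "ereal T < S"
  shows "primitive_on T (\<lambda>s. f s (x s)) x"
  unfolding primitive_on_def
proof (intro conjI ballI)
  show "(\<lambda>s. f s (x s)) absolutely_integrable_on {0..T}"
    using assms by (simp add: solves_on_def)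
  fix t assume "t \<in> {0..T}"
  then have "0 \<le> t" "ereal t < S" using assms(3) by (auto intro: order.strict_trans1[rotated])
  then show "x t = x 0 + integral {0..t} (\<lambda>s. f s (x s))"
    using assms(1) unfolding solves_on_def by blast
qed

text \<open>Removes the auxiliary \<open>\<epsilon>\<close> that keeps the radius positive when the
  disturbance vanishes.\<close>

lemma le_of_le_shifted:
  fixes f :: "real \<Rightarrow> real"
  assumes c: "continuous_on {0..} f" and le: "\<And>\<epsilon>. \<epsilon> > 0 \<Longrightarrow> y \<le> f \<epsilon>"
  shows "y \<le> f 0"
proof -
  have "(f \<longlongrightarrow> f 0) (at 0 within {0..})" using c by (auto simp: continuous_on_def)
  then have "(f \<longlongrightarrow> f 0) (at_right 0)" by (rule tendsto_within_subset) auto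
  moreover have "\<forall>\<^sub>F \<epsilon> in at_right 0. y \<le> f \<epsilon>"
    using le by (auto simp: eventually_at_right_field intro!: exI[of _ 1])
  ultimately show ?thesis by (rule tendsto_lowerbound) simp
qed

text \<open>"Large enough" and "close enough to zero" become nested quantifiers:
  \<open>\<nu>0\<close> is independent of \<open>\<mu>\<close>, while \<open>\<mu>0\<close> may
  depend on \<open>\<nu>\<close> but neither on \<open>\<gamma>\<close> nor on
  \<open>\<tau>\<close>. The inequalities involving \<open>\<mu>\<close> are premises for each
  individual \<open>\<mu>\<close>.\<close>

theorem proposition1:
  fixes A :: "real^'n^'n" and B :: "real^'m^'n" and C :: "real^'n^'p" and own :: "'p \<Rightarrow> 'N::finite"
    and G0 :: "real^'n^'n" and Y0 :: "real^'p^'n"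
    and E :: "('N \<times> 'N) set" and \<zeta> :: "real^'N"
    and T :: "real^('l::finite option)^'N" and \<Delta> :: "real^'l^'l"
    and \<rho> :: real and Pa :: "real^'n^'n" and Y :: "real^'p^'n"
  assumes observable: "observable A C"
    and G0_eq: "G0 ** A - A ** G0 + Y0 ** C = - A"
    and CG0: "C ** G0 = 0"
    and inv_G0: "invertible (mat 1 + G0)"
    and nilpotent: "nilpotent_matrix (A + (matrix_inv (mat 1 + G0) ** Y0) ** C)"
    and L0_zero: "matrix_inv (mat 1 + G0) ** Y0 = 0"
    and no_loops: "irrefl E"
    and connected: "strongly_connected E"
    and zeta: "left_null_vector E \<zeta>"
    and splitting: "laplacian_splitting E \<zeta> T \<Delta>"
    and rho: "\<rho> > 0"
    and LMI1: "pos_def Pa"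
    and LMI2: "pos_def (kron (transpose \<Delta> + \<Delta>) Pa)"
  shows "\<exists>\<nu>0>0. \<forall>\<nu>\<ge>\<nu>0. \<exists>\<mu>0>0. \<forall>\<mu>.
     \<mu> \<noteq> 0 \<longrightarrow> \<bar>\<mu>\<bar> < \<mu>0 \<longrightarrow> \<mu> > - 1 / real (obs_index A C) \<longrightarrow>
     pos_def (Pa ** dil_gen \<mu> G0 + transpose (dil_gen \<mu> G0) ** Pa) \<longrightarrow>
     neg_def (Pa ** A + transpose A ** Pa + Y ** C + transpose C ** transpose Y
              + \<rho> *\<^sub>R (Pa ** dil_gen \<mu> G0 + transpose (dil_gen \<mu> G0) ** Pa)) \<longrightarrow>
     (\<forall>\<gamma> \<tau>. continuous_on UNIV (\<lambda>(t, x). \<gamma> t x) \<longrightarrow> 0 < \<tau> \<longrightarrow> \<tau> < \<rho> / 3 \<longrightarrow>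
        gamma_condition TYPE('N) G0 Pa \<mu> \<tau> \<gamma> \<longrightarrow>
        input_to_state_stable
          (error_trajectory A B C own G0 E Pa (H_gain own \<zeta> (matrix_inv Pa ** Y)) \<mu> \<nu> \<gamma>))"
proof -
  interpret pd_matrix Pa by unfold_locales (rule LMI1)
  define M where "M = matrix_inv Pa ** Y"
  define S where "S = matrix_inv T"
  define H where "H = H_gain own \<zeta> M"
  have AG: "A ** G0 = (G0 + mat 1) ** A" by (rule homogeneous_plant[OF G0_eq inv_G0 L0_zero])
  have TS: "T ** S = mat 1"
    using splitting matrix_inv_mult(1) by (auto simp: laplacian_splitting_def S_def)
  \<comment> \<open>The dissipation inequality is still a premise inside \<open>lin\<close>: it
    needs the matrix inequality at a particular \<open>\<mu>\<close>, which is fixed only after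
    \<open>\<nu>\<close>.\<close>
  obtain \<nu>0 k where \<nu>0: "\<nu>0 > 0" and k: "k > 0"
    and lin: "\<And>\<nu> \<tau> \<eta> z y \<epsilon>. \<nu> \<ge> \<nu>0 \<Longrightarrow> 0 \<le> \<tau> \<Longrightarrow> \<tau> \<le> \<rho> / 3 \<Longrightarrow> 0 \<le> \<eta> \<Longrightarrow>
      (\<And>x. ip x ((A + M ** C) *v x) \<le> - (\<rho> / 2) * (nrm x)\<^sup>2) \<Longrightarrow>
      (\<And>i. agent y i = A *v agent z i
        + H i *v out_block own i (C *v agent z i) + \<nu> *\<^sub>R theta E z i + \<epsilon> i) \<Longrightarrow>
      (\<And>i. nrm (\<epsilon> i) \<le> \<tau> * nrm (agent z i) + \<eta>) \<Longrightarrow>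
      lyap S z z \<le> 2 \<Longrightarrow> lyap S z y \<le> - (\<rho> / 12) * lyap S z z + k * \<eta>"
    using linear_estimate[OF no_loops connected zeta splitting LMI2 rho, of A M C own]
    unfolding S_def H_def by metis
  obtain K where K: "K \<ge> 0" "\<And>x. nrm (G0 *v x) \<le> K * nrm x" using nrm_mult_le_nrm by blast
  obtain hC where hC: "hC \<ge> 0" "\<And>x. norm (C *v x) \<le> hC * nrm x" using norm_mult_le_nrm by blast
  obtain cn where cn: "cn > 0" "\<And>x. norm x \<le> cn * nrm x" using norm_le_nrm by blast
  obtain cm where cm: "cm \<ge> 0" "\<And>x. nrm (mat 1 *v x) \<le> cm * norm x" using nrm_le_norm[of "mat 1"] by blast
  have cm': "nrm x \<le> cm * norm x" for x using cm(2)[of x] by simp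
  \<comment> \<open>Adding up one admissible constant per node gives a bound valid for all
    nodes.\<close>
  define hH where "hH = (\<Sum>i\<in>UNIV. SOME h. h \<ge> 0 \<and> (\<forall>y. nrm (H i *v y) \<le> h * norm y))"
  have hHi: "(SOME h. h \<ge> 0 \<and> (\<forall>y. nrm (H i *v y) \<le> h * norm y)) \<ge> 0 \<and>
      (\<forall>y. nrm (H i *v y) \<le> (SOME h. h \<ge> 0 \<and> (\<forall>y. nrm (H i *v y) \<le> h * norm y)) * norm y)" for i
    by (rule someI_ex) (metis nrm_le_norm)
  have hH0: "hH \<ge> 0" unfolding hH_def using hHi by (intro sum_nonneg) auto
  have hH: "nrm (H i *v y) \<le> hH * norm y" for i y
  proof -
    have "(SOME h. h \<ge> 0 \<and> (\<forall>y. nrm (H i *v y) \<le> h * norm y)) \<le> hH"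
      unfolding hH_def using hHi by (intro member_le_sum) auto
    then show ?thesis using hHi[of i] by (meson mult_right_mono norm_ge_zero order_trans)
  qed
  \<comment> \<open>Bounds every agent on the region where the Lyapunov function is at most 2; the
    factor 2 is a crude bound for its square root.\<close>
  define R where "R = (\<Sum>i\<in>UNIV. \<Sum>a\<in>UNIV. \<bar>T $ i $ a\<bar>) * 2"
  have R: "nrm (agent z i) \<le> R" if "lyap S z z \<le> 2" for z :: "real^('N \<times> 'n)" and i
  proof -
    have "sqrt (lyap S z z) \<le> 2" using that by (intro real_le_lsqrt) (auto simp: lyap_nonneg)
    moreover have "(\<Sum>a\<in>UNIV. \<bar>T $ i $ a\<bar>) \<le> (\<Sum>i\<in>UNIV. \<Sum>a\<in>UNIV. \<bar>T $ i $ a\<bar>)"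
      by (rule member_le_sum) (auto intro: sum_nonneg)
    ultimately have "(\<Sum>a\<in>UNIV. \<bar>T $ i $ a\<bar>) * sqrt (lyap S z z) \<le> R"
      unfolding R_def by (intro mult_mono sum_nonneg) (auto simp: lyap_nonneg)
    then show ?thesis using nrm_agent_le[OF TS, of z i] by linarith
  qed
  have R0: "R \<ge> 0" by (simp add: R_def sum_nonneg)
  \<comment> \<open>The entries of \<open>S\<close> bound the Lyapunov function by the agents; the
    added 1 makes \<open>kL\<close> positive.\<close>
  define kL where "kL = (\<Sum>a\<in>UNIV. \<Sum>i\<in>UNIV. \<bar>S $ a $ i\<bar>) + 1"
  have kL0: "kL > 0" unfolding kL_def by (intro add_nonneg_pos sum_nonneg) auto
  have kL: "lyap S z z \<le> 1" if "\<And>i. nrm (agent z i) * kL \<le> 1" for z :: "real^('N \<times> 'n)"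
  proof -
    have "lyap S z z \<le> ((\<Sum>a\<in>UNIV. \<Sum>i\<in>UNIV. \<bar>S $ a $ i\<bar>) * (1 / kL))\<^sup>2"
      using that kL0 by (intro lyap_le) (simp add: field_simps)
    also have "\<dots> \<le> 1\<^sup>2"
      using kL0 by (intro power_mono) (auto simp: kL_def intro!: sum_nonneg divide_nonneg_pos)
    finally show ?thesis by simp
  qed
  \<comment> \<open>The root of the dimension passes from the maximum norm to the Euclidean norm,
    and \<open>cm + 1\<close> dominates both 1 and the factor to the \<open>Pa\<close>-norm.\<close>
  define kq where "kq = (cm + 1) * sqrt DIM((real^'n) \<times> (real^'p))"
  have kq: "kq > 0"
    unfolding kq_def using cm(1)
    by (intro mult_pos_pos) (simp_all only: real_sqrt_gt_0_iff of_nat_0_less_iff DIM_positive add_nonneg_pos zero_less_one)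
  have qbound: "norm (snd v) \<le> kq * infnorm v \<and> nrm (fst v) \<le> kq * infnorm v" for v :: "(real^'n) \<times> (real^'p)"
  proof -
    have "(cm + 1) * norm v \<le> kq * infnorm v"
      using mult_left_mono[OF norm_le_infnorm[of v], of "cm + 1"] cm(1) by (simp add: kq_def mult.assoc)
    moreover have "norm (snd v) \<le> norm v" "norm (fst v) \<le> norm v"
      by (metis norm_snd_le prod.collapse, metis norm_fst_le prod.collapse)
    moreover from this have "nrm (fst v) \<le> cm * norm v"
      using cm'[of "fst v"] mult_left_mono[OF _ cm(1), of "norm (fst v)" "norm v"] by linarith
    moreover have "norm v \<le> (cm + 1) * norm v" "cm * norm v \<le> (cm + 1) * norm v"
      using cm(1) by (auto simp: distrib_right)
    ultimately show ?thesis by linarith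
  qed
  show ?thesis
  proof (rule exI[of _ \<nu>0], intro conjI allI impI \<nu>0)
    fix \<nu> assume \<nu>: "\<nu> \<ge> \<nu>0"
    define D where "D = hH * ((K + 1) * (2 + (hC * R + 1) ^ 3)) + \<nu> * (2 * (2 + (2 * real CARD('N) * R) ^ 3))
        + \<rho> * (2 * (2 * K + 1) * (2 + R ^ 3)) + hH + 1 + 2 * R"
    have D: "D > 0"
      unfolding D_def using hH0 hC(1) R0 K(1) \<nu> \<nu>0 rho
      by (intro add_pos_nonneg add_nonneg_pos add_nonneg_nonneg mult_nonneg_nonneg zero_le_power) auto
    \<comment> \<open>Half of the allowance \<open>\<rho> / 12\<close> goes to
      \<open>\<delta>\<close>; the other half covers \<open>\<bar>\<mu>\<bar>\<close>, which is
      taken below \<open>\<delta>\<close>.\<close>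
    define \<delta> where "\<delta> = min 1 (\<rho> / (24 * (k * D)))"
    have \<delta>: "0 < \<delta>" "\<delta> \<le> 1" "k * D * \<delta> \<le> \<rho> / 24"
    proof -
      show "0 < \<delta>" "\<delta> \<le> 1" using rho k D by (auto simp: \<delta>_def)
      have "k * D * \<delta> \<le> k * D * (\<rho> / (24 * (k * D)))"
        using k D by (intro mult_left_mono) (auto simp: \<delta>_def)
      also have "\<dots> = \<rho> / 24" using k D by simp
      finally show "k * D * \<delta> \<le> \<rho> / 24" .
    qed
    show "\<exists>\<mu>0>0. \<forall>\<mu>.
     \<mu> \<noteq> 0 \<longrightarrow> \<bar>\<mu>\<bar> < \<mu>0 \<longrightarrow> \<mu> > - 1 / real (obs_index A C) \<longrightarrow>
     pos_def (Pa ** dil_gen \<mu> G0 + transpose (dil_gen \<mu> G0) ** Pa) \<longrightarrow>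
     neg_def (Pa ** A + transpose A ** Pa + Y ** C + transpose C ** transpose Y
              + \<rho> *\<^sub>R (Pa ** dil_gen \<mu> G0 + transpose (dil_gen \<mu> G0) ** Pa)) \<longrightarrow>
     (\<forall>\<gamma> \<tau>. continuous_on UNIV (\<lambda>(t, x). \<gamma> t x) \<longrightarrow> 0 < \<tau> \<longrightarrow> \<tau> < \<rho> / 3 \<longrightarrow>
        gamma_condition TYPE('N) G0 Pa \<mu> \<tau> \<gamma> \<longrightarrow>
        input_to_state_stable
          (error_trajectory A B C own G0 E Pa (H_gain own \<zeta> (matrix_inv Pa ** Y)) \<mu> \<nu> \<gamma>))"
    \<comment> \<open>The second bound yields
      \<open>\<bar>\<mu>\<bar> * (4 * K + 2) \<le> 1 / 2\<close>, the smallness behind the dilation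
      and deviation estimates.\<close>
    proof (intro exI[of _ "min \<delta> (1 / (2 * (4 * K + 2)))"] conjI allI impI)
      show "0 < min \<delta> (1 / (2 * (4 * K + 2)))" using \<delta> K(1) by simp
      fix \<mu> :: real and \<gamma> and \<tau> :: real
      assume \<mu>: "\<bar>\<mu>\<bar> < min \<delta> (1 / (2 * (4 * K + 2)))"
        and lmi: "neg_def (Pa ** A + transpose A ** Pa + Y ** C + transpose C ** transpose Y
              + \<rho> *\<^sub>R (Pa ** dil_gen \<mu> G0 + transpose (dil_gen \<mu> G0) ** Pa))"
        and \<tau>: "0 < \<tau>" "\<tau> < \<rho> / 3"
        and \<gamma>: "gamma_condition TYPE('N) G0 Pa \<mu> \<tau> \<gamma>"
      have m: "\<bar>\<mu>\<bar> * (4 * K + 2) \<le> 1 / 2"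
        using \<mu> K(1) by (simp add: field_simps)
      interpret small_dilation Pa G0 \<mu> K
        by unfold_locales (use K m mult_nonneg_nonneg[OF abs_ge_zero[of \<mu>] K(1)] in \<open>auto simp: algebra_simps\<close>)
      note AMC = mean_dissipation[OF lmi rho, folded M_def]
      have kD: "k * (D * (\<bar>\<mu>\<bar> + \<delta>)) \<le> \<rho> / 12"
      proof -
        have "k * D * \<bar>\<mu>\<bar> \<le> k * D * \<delta>" using \<mu> k D by (intro mult_left_mono) auto
        moreover have "k * (D * (\<bar>\<mu>\<bar> + \<delta>)) = k * D * \<bar>\<mu>\<bar> + k * D * \<delta>" by (simp add: algebra_simps)
        ultimately show ?thesis using \<delta>(3) by linarith
      qed
      \<comment> \<open>Converts \<open>Pa\<close>-norm bounds on the agents into a Euclidean bound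
        on the stacked error; \<open>R + 1\<close> in place of \<open>R\<close> makes
        \<open>c\<close> strictly positive.\<close>
      define c where "c = real CARD('N) * (cn * (R + 1))"
      have c: "c > 0" unfolding c_def using cn(1) R0 by simp
      define \<beta> where "\<beta> s t = c * spread (2 * decay \<delta> (radius (kL * (cm + 1) * s)) t)" for s t
      define \<alpha> where "\<alpha> s = c * spread (2 * radius (kq / \<delta> * s))" for s
      have kc: "kL * (cm + 1) > 0" using kL0 cm(1) by simp
      have \<beta>: "class_KL \<beta>" unfolding \<beta>_def
        by (rule class_KL_decay[OF \<delta>(1) class_K_radius[OF kc] class_K_spread[OF c]])
      have \<alpha>: "class_K \<alpha>" unfolding \<alpha>_def
        by (rule class_K_compose[OF class_K_radius class_K_spread[OF c]]) (use kq \<delta> in simp)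
      have bound: "norm (e t) \<le> \<beta> (norm (e 0)) t + \<alpha> (enn2real (Linf_norm_on {0..<t} q))"
        if q: "Linf q" and tr: "error_trajectory A B C own G0 E Pa H \<mu> \<nu> \<gamma> Sf e q"
          and t: "0 \<le> t" "ereal t < Sf" for Sf t and e :: "real \<Rightarrow> real^('N \<times> 'n)"
          and q :: "real \<Rightarrow> (real^'n) \<times> (real^'p)"
      proof -
        obtain x where "solves_on Sf (error_rhs A C own G0 E Pa H \<mu> \<nu> \<gamma> x q) e"
          using tr unfolding error_trajectory_def by blast
        from solves_on_primitive[OF this t]
        have e: "primitive_on t (\<lambda>s. error_rhs A C own G0 E Pa H \<mu> \<nu> \<gamma> x q s (e s)) e" .
        define Q where "Q = enn2real (Linf_norm_on {0..<t} q)"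
        have Q: "Q \<ge> 0" by (simp add: Q_def)
        obtain N where N: "negligible N" "\<And>s. s \<in> {0..t} - N \<Longrightarrow> infnorm (q s) \<le> Q"
          using Linf_norm_on_AE[OF q, of t] unfolding Q_def by blast
        define b where "b = radius (kL * (cm + 1) * norm (e 0))"
        define a where "a = radius (kq / \<delta> * Q)"
        have a0: "a \<ge> 0" unfolding a_def using Q kq \<delta> by (intro radius_nonneg) simp
        have b0: "b \<ge> 0" unfolding b_def using kc by (intro radius_nonneg) simp
        \<comment> \<open>The floor \<open>a\<close> is 0 for a vanishing disturbance, so the radius
          is lifted by \<open>\<epsilon>\<close> and the limit is taken afterwards.\<close>
        have main: "norm (e t) \<le> c * spread (a + \<epsilon> + decay \<delta> b t)" if \<epsilon>: "\<epsilon> > 0" for \<epsilon>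
        proof -
          have \<nu>_nonneg: "\<nu> \<ge> 0" using \<nu> \<nu>0 by simp
          have kqQ: "0 \<le> kq * Q" using kq Q by simp
          have a\<epsilon>: "0 < a + \<epsilon>" using a0 \<epsilon> by simp
          have b_eq: "radius (kL * (cm + 1) * norm (e 0)) \<le> b" by (simp add: b_def)
          have y0: "0 \<le> kL * (cm + 1) * norm (e 0)" using kc by simp
          have "nrm (agent (e t) i) \<le> spread (a + \<epsilon> + decay \<delta> b t) * R" for i
          proof (rule error_bound[where H = H and S = S and C = C and N = N and ?y0.0 = "kL * (cm + 1) * norm (e 0)"
                and Q = "kq * Q" and kL = kL and x = x and q = q and hH = hH and hC = hC and k = k and D = D])
            show "lyap S z y \<le> - (\<rho> / 12) * lyap S z z + k * \<eta>"
              if "0 \<le> \<tau>" "\<tau> \<le> \<rho> / 3" "0 \<le> \<eta>"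
                "\<And>i. agent y i = A *v agent z i + H i *v out_block own i (C *v agent z i) + \<nu> *\<^sub>R theta E z i + \<epsilon> i"
                "\<And>i. nrm (\<epsilon> i) \<le> \<tau> * nrm (agent z i) + \<eta>" "lyap S z z \<le> 2"
              for \<tau> \<eta> z y \<epsilon>
              by (rule lin[OF \<nu> that(1-3) AMC that(4-6)])
            show "norm (snd (q s)) \<le> kq * Q \<and> nrm (fst (q s)) \<le> kq * Q" if "s \<in> {0..t} - N" for s
              using qbound[of "q s"] mult_left_mono[OF N(2)[OF that], of kq] kq by linarith
            show "nrm (agent (e 0) i) * kL \<le> kL * (cm + 1) * norm (e 0)" for i
            proof -
              have "nrm (agent (e 0) i) \<le> cm * norm (agent (e 0) i)" by (rule cm')
              also have "\<dots> \<le> (cm + 1) * norm (e 0)"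
                using cm(1) norm_agent_le[of "e 0" i] by (intro mult_mono) auto
              finally show ?thesis using kL0 by (simp add: mult.commute mult_left_mono mult.left_commute)
            qed
            show "radius (kq * Q / \<delta>) \<le> a + \<epsilon>" using \<epsilon> by (simp add: a_def)
          qed (fact no_loops H_def AG CG0 \<nu>_nonneg rho hH hH0 hC R m D_def \<delta>(1,2) kD less_imp_le[OF D]
              \<gamma> \<tau> t(1) e N(1) kqQ a\<epsilon> b_eq y0 kL less_imp_le[OF kL0])+
          then have "norm (agent (e t) i) \<le> cn * (spread (a + \<epsilon> + decay \<delta> b t) * R)" for i
            using cn(2)[of "agent (e t) i"] mult_left_mono[OF _ less_imp_le[OF cn(1)]] by (meson order_trans)
          then have "norm (e t) \<le> real CARD('N) * (cn * (spread (a + \<epsilon> + decay \<delta> b t) * R))"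
            by (rule norm_agents_le)
          also have "\<dots> \<le> real CARD('N) * (cn * (spread (a + \<epsilon> + decay \<delta> b t) * (R + 1)))"
            using cn(1) a0 \<epsilon> decay_nonneg[of \<delta> b t] \<delta>(1) b0 t(1)
            by (intro mult_left_mono) (auto simp: spread_def)
          also have "\<dots> = c * spread (a + \<epsilon> + decay \<delta> b t)" by (simp add: c_def mult_ac)
          finally show ?thesis .
        qed
        have "norm (e t) \<le> c * spread (a + 0 + decay \<delta> b t)"
          by (rule le_of_le_shifted[of "\<lambda>\<epsilon>. c * spread (a + \<epsilon> + decay \<delta> b t)", OF _ main])
             (auto simp: spread_def intro!: continuous_intros)
        also have "c * spread (a + 0 + decay \<delta> b t) = c * spread (a + decay \<delta> b t)" by simp
        also have "\<dots> \<le> c * (spread (2 * a) + spread (2 * decay \<delta> b t))"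
          using c a0 decay_nonneg[of \<delta> b t] \<delta>(1) b0 t(1) by (intro mult_left_mono spread_add_le) auto
        also have "\<dots> = \<beta> (norm (e 0)) t + \<alpha> Q"
          by (simp add: \<beta>_def \<alpha>_def a_def b_def distrib_left)
        finally show ?thesis by (simp add: Q_def)
      qed
      show "input_to_state_stable
          (error_trajectory A B C own G0 E Pa (H_gain own \<zeta> (matrix_inv Pa ** Y)) \<mu> \<nu> \<gamma>)"
        unfolding input_to_state_stable_def using \<beta> \<alpha> bound unfolding H_def M_def by blast
    qed
  qed
qed

end
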